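(* Let $X$ be a real-valued Lévy process, let $r\ge 0$, and let $f:\mathbb{R}\to\mathbb{R}$ be a bounded and continuous function. For $T\in[0,\infty)$ and $x\in\mathbb{R}$ let $$v(T,x)=\sup_{\tau\in\mathcal{T}}\mathbb{E}_x\left[e^{-r(\tau\wedge T)}f(X_{\tau\wedge T})\right],$$ and for $n\ge 1$, $k\ge 0$ and $x\in\mathbb{R}$ let $$V^{(n)}_k(x)=\sup_{\tau\in\widetilde{\mathcal{T}}^{(n)}}\mathbb{E}_x\left[D^{(n)}(\tau\wedge T^{(n)}_k)\,f(X_{\tau\wedge T^{(n)}_k})\right],$$ where $\mathcal{T}$, $\widetilde{\mathcal{T}}^{(n)}$, $D^{(n)}$ and $T^{(n)}_k$ are as defined in the context. Then the following hold. (i) For any $n\ge 1$, the sequence of functions $(V^{(n)}_k)_{k\ge 0}$ satisfies the recursion $$V^{(n)}_0(x)=f(x),\qquad V^{(n)}_k(x)=\max\left\{f(x),\ e^{-r/n}\,\mathbb{E}_x\left[V^{(n)}_{k-1}(X_{\xi^{(n)}})\right]\right\}\quad\text{for } k\ge 1,\ x\in\mathbb{R},$$ where $\xi^{(n)}$ is independent of $X$ and follows an exponential distribution with mean $1/n$. (ii) For any $T\in[0,\infty)$, if $(k(n))_{n\ge 1}$ is a sequence of natural numbers such that $k(n)/n\to T$ as $n\to\infty$, then, as $n\to\infty$, $$T^{(n)}_{k(n)}\longrightarrow T\ \text{ a.s.}\qquad\text{and}\qquad V^{(n)}_{k(n)}(x)\longrightarrow v(T,x)\ \text{ for all } x\i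n\mathbb{R}.$$
   Context: $X$ is a Lévy process (stationary independent increments, right-continuous paths with left limits) on a filtered probability space $(\Omega,\mathcal{F},\mathbf{F},\mathbb{P})$, where $\mathbf{F}=(\mathcal{F}_t)_{t\ge 0}$ is the naturally enlarged filtration generated by $X$ (i.e. the filtration generated by $X$, suitably completed and made right-continuous). $\mathbb{P}_x$ denotes the law under which $X$ is started at $x\in\mathbb{R}$ and $\mathbb{E}_x$ the corresponding expectation. $\mathcal{T}$ is the set of $\mathbf{F}$-stopping times. For every $n\in\mathbb{N}$, $n\ge1$, the probability space is enlarged so as to carry a Poisson process $N^{(n)}$ with intensity $n$, independent of $X$. Its jump times are $T^{(n)}_k:=\inf\{t\ge 0: N^{(n)}_t\ge k\}$ for $k\ge 1$, and $T^{(n)}_0:=0$. $\widetilde{\mathbf{F}}^{(n)}$ is the naturally enlarged filtration generated by the pair $(X,N^{(n)})$, and $$\widetilde{\mathcal{T}}^{(n)}:=\left\{\tau:\ \tau\text{ is an }\widetilde{\mathbf{F}}^{(n)}\text{-stopping time and }\tau\in\{0=T^{(n)}_0,T^{(n)}_1,T^{(n)}_2,\ldots\}\right\}.$$ For a random time $\tau$ taking values in $\{T^{(n)}_0,T^{(n)}_1,\ldots\}$, $$D^{(n)}(\tau):=\sum_{i=0}^{\infty}\mathbf{1}_{\{\tau=T^{(n)}_i\}}e^{-ri/n}.$$ Here $\mathbb{N}$ includes $0$ for the index $k$. *)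

theory Defs
  imports "HOL-Probability.Probability"
begin

definition cadlag :: "(real \<Rightarrow> real) \<Rightarrow> bool" where
  "cadlag g \<longleftrightarrow>
     (\<forall>t\<ge>0. (g \<longlongrightarrow> g t) (at_right t)) \<and>
     (\<forall>t>0. \<exists>l. (g \<longlongrightarrow> l) (at_left t))"

text \<open>
  Processes are indexed by all reals, but only the times \<open>t \<ge> 0\<close> are ever constrained or used.
  A Levy process starts at \<open>0\<close>; the process started at \<open>x\<close> is \<open>x + X\<close>, so that
  \<open>\<E>\<^sub>x[G(X)]\<close> is rendered as the expectation of \<open>G(x + X)\<close>.
\<close>

locale levy_process = prob_space M for M :: "'a measure" +
  fixes X :: "real \<Rightarrow> 'a \<Rightarrow> real"
  assumes measurable_X: "t \<ge> 0 \<Longrightarrow> X t \<in> borel_measurable M"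
    and start: "AE \<omega> in M. X 0 \<omega> = 0"
    and independent_increments:
      "0 \<le> u 0 \<Longrightarrow> mono u \<Longrightarrow>
        indep_vars (\<lambda>_. borel) (\<lambda>i \<omega>. X (u (Suc i)) \<omega> - X (u i) \<omega>) {..<(m::nat)}"
    and stationary_increments:
      "0 \<le> s \<Longrightarrow> s \<le> t \<Longrightarrow>
        distr M borel (\<lambda>\<omega>. X t \<omega> - X s \<omega>) = distr M borel (X (t - s))"
    and cadlag_paths: "\<omega> \<in> space M \<Longrightarrow> cadlag (\<lambda>t. X t \<omega>)"

locale poisson_process = levy_process M "\<lambda>t \<omega>. real (N t \<omega>)"
  for M :: "'a measure" and lam :: real and N :: "real \<Rightarrow> 'a \<Rightarrow> nat" +
  assumes rate_pos: "lam > 0"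
    and poisson_marginals:
      "t > 0 \<Longrightarrow> distr M (count_space UNIV) (N t) = measure_pmf (poisson_pmf (lam * t))"

definition process_events ::
    "'a measure \<Rightarrow> 'b measure \<Rightarrow> (real \<Rightarrow> 'a \<Rightarrow> 'b) \<Rightarrow> 'a set set" where
  "process_events M S Y =
     sigma_sets (space M) {Y s -` B \<inter> space M | s B. 0 \<le> s \<and> B \<in> sets S}"

text \<open>
  Time ranges over \<open>[0, \<infinity>]\<close>, rendered by \<^typ>\<open>ennreal\<close>; stopping times may be infinite.
  \<open>completed_history M S Y t\<close> is generated by \<open>Y s\<close> for \<open>s \<le> t\<close> together with all subsets of
  null sets of \<open>M\<close>, and \<open>nat_filtration\<close> is its right-continuous version. The index \<open>\<infinity>\<close> in the
  intersection only matters at \<open>t = \<infinity>\<close>, where no larger \<open>u\<close> exists.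
  As \<open>M\<close> need not be complete, stopping times are in general only measurable with respect to
  \<open>completion M\<close>, which is why expectations below are integrals over \<open>completion M\<close>.
\<close>

definition completed_history ::
    "'a measure \<Rightarrow> 'b measure \<Rightarrow> (real \<Rightarrow> 'a \<Rightarrow> 'b) \<Rightarrow> ennreal \<Rightarrow> 'a measure" where
  "completed_history M S Y t =
     sigma (space M)
       ({Y s -` B \<inter> space M | s B. 0 \<le> s \<and> ennreal s \<le> t \<and> B \<in> sets S} \<union>
        null_sets (completion M))"

definition nat_filtration ::
    "'a measure \<Rightarrow> 'b measure \<Rightarrow> (real \<Rightarrow> 'a \<Rightarrow> 'b) \<Rightarrow> ennreal \<Rightarrow> 'a measure" where
  "nat_filtration M S Y t =
     sigma (space M) (\<Inter>u\<in>insert \<infinity> {t<..}. sets (completed_history M S Y u))"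

definition at_time :: "(real \<Rightarrow> 'a \<Rightarrow> 'b) \<Rightarrow> ('a \<Rightarrow> ennreal) \<Rightarrow> 'a \<Rightarrow> 'b" where
  "at_time Y \<tau> \<omega> = Y (enn2real (\<tau> \<omega>)) \<omega>"

text \<open>The infimum is taken in \<open>[0, \<infinity>]\<close>, so it is \<open>\<infinity>\<close> if level \<open>k\<close> is never reached.\<close>

definition jump_time :: "(real \<Rightarrow> 'a \<Rightarrow> nat) \<Rightarrow> nat \<Rightarrow> 'a \<Rightarrow> ennreal" where
  "jump_time N k \<omega> = (if k = 0 then 0 else Inf {ennreal t | t. 0 \<le> t \<and> N t \<omega> \<ge> k})"

definition stopping_times :: "'a measure \<Rightarrow> (real \<Rightarrow> 'a \<Rightarrow> real) \<Rightarrow> ('a \<Rightarrow> ennreal) set" where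
  "stopping_times M X = {\<tau>. stopping_time (nat_filtration M borel X) \<tau>}"

definition jump_stopping_times ::
    "'a measure \<Rightarrow> (real \<Rightarrow> 'a \<Rightarrow> real) \<Rightarrow> (real \<Rightarrow> 'a \<Rightarrow> nat) \<Rightarrow> ('a \<Rightarrow> ennreal) set" where
  "jump_stopping_times M X N =
     {\<tau>. stopping_time
            (nat_filtration M (borel \<Otimes>\<^sub>M count_space UNIV) (\<lambda>t \<omega>. (X t \<omega>, N t \<omega>))) \<tau> \<and>
         (\<forall>\<omega>\<in>space M. \<tau> \<omega> \<in> range (\<lambda>k. jump_time N k \<omega>))}"

definition discount ::
    "real \<Rightarrow> nat \<Rightarrow> (real \<Rightarrow> 'a \<Rightarrow> nat) \<Rightarrow> ('a \<Rightarrow> ennreal) \<Rightarrow> 'a \<Rightarrow> real" where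
  "discount r n N \<tau> \<omega> =
     (\<Sum>i. of_bool (\<tau> \<omega> = jump_time N i \<omega>) * exp (- r * real i / real n))"

definition opt_value ::
    "'a measure \<Rightarrow> (real \<Rightarrow> 'a \<Rightarrow> real) \<Rightarrow> real \<Rightarrow> (real \<Rightarrow> real) \<Rightarrow> real \<Rightarrow> real \<Rightarrow> real" where
  "opt_value M X r f T x =
     (SUP \<tau>\<in>stopping_times M X.
        let \<sigma> = (\<lambda>\<omega>. min (\<tau> \<omega>) (ennreal T)) in
        (\<integral>\<omega>. exp (- r * enn2real (\<sigma> \<omega>)) * f (x + at_time X \<sigma> \<omega>) \<partial>completion M))"

definition rand_value ::
    "'a measure \<Rightarrow> (real \<Rightarrow> 'a \<Rightarrow> real) \<Rightarrow> (real \<Rightarrow> 'a \<Rightarrow> nat) \<Rightarrow> real \<Rightarrow> (real \<Rightarrow> real) \<Rightarrow>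
     nat \<Rightarrow> nat \<Rightarrow> real \<Rightarrow> real" where
  "rand_value M X N r f n k x =
     (SUP \<tau>\<in>jump_stopping_times M X N.
        let \<sigma> = (\<lambda>\<omega>. min (\<tau> \<omega>) (jump_time N k \<omega>)) in
        (\<integral>\<omega>. discount r n N \<sigma> \<omega> * f (x + at_time X \<sigma> \<omega>) \<partial>completion M))"

end

theory Submission
  imports Defs
begin

text \<open>
  Both values are compared with finite-horizon dynamic programs. At the jump times of the Poisson
  clock the pair \<open>(X, N)\<close> has a strong Markov property with the resolvent \<open>K g(x) = \<E> g(x + X\<^sub>\<xi>)\<close> as
  one-step kernel, also for the enlarged filtration, so \<open>V\<^sub>k\<close> is the \<open>k\<close>-step value of a Markov chain;
  this is (i). Likewise, rounding a stopping time up to a grid shows that \<open>v(T, \<cdot>)\<close> is the supremum of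
  the Bermudan values \<open>B\<^sub>m\<close> of exercise at multiples of \<open>T / m\<close>.

  For (ii), \<open>T\<^sub>k\<^sub>(\<^sub>n\<^sub>) \<rightarrow> T\<close> follows from Chernoff bounds and Borel-Cantelli. Lower bound: \<open>j\<close> steps of
  \<open>K\<close> evaluate at \<open>X\<^sub>T\<^sub>j\<close>, and \<open>T\<^sub>j \<rightarrow> T / m\<close> almost surely for \<open>j \<sim> n T / m\<close>, while \<open>X\<close> has no fixed
  jumps; hence the recursion dominates every \<open>B\<^sub>m\<close> in the limit. Upper bound: discounting by the
  constant \<open>\<beta> = e\<^sup>-\<^sup>r\<^sup>/\<^sup>n\<close> per jump of a rate \<open>n\<close> clock is exactly continuous discounting at rate
  \<open>n (1 - \<beta>)\<close> along a clock of rate \<open>n \<beta>\<close>. For a function \<open>u(t, x)\<close> that dominates \<open>f\<close> and is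
  superharmonic, \<open>u(s + t, x) \<ge> e\<^sup>-\<^sup>\<rho>\<^sup>s \<E> u(t, x + X\<^sub>s)\<close>, the recursion is therefore bounded by
  \<open>\<E> u(S, x)\<close> with \<open>S\<close> Erlang distributed and concentrated near \<open>T\<close>.
\<close>

subsection \<open>Completeness, independence and finite-horizon optimal stopping\<close>

text \<open>Three obstacles shape the argument. Stopping times are measurable only for the completed
  space, and jump times behave well only almost surely; hence all work is done on a complete space,
  where null-set modifications and almost sure limits stay measurable, and the result is carried
  back at the end. Second, conditioning is done at deterministic times: random times are rounded up
  to a grid, the identity is checked for each grid value, and the mesh tends to 0 by right
  continuity of paths and continuity of the semigroup. Third, the randomized discount counts jumps
  instead of time. Its exact conversion has rate \<open>n * (1 - exp (- r / n))\<close>, which only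
  tends to \<open>r\<close>, so the upper bound needs semicontinuity of \<open>v\<close> in rate and
  horizon together. Since nothing is assumed about the joint law of the clocks for different
  \<open>n\<close>, almost sure convergence of the jump times has to come from summable tail bounds.
  Because both values reduce to recursions driven by the semigroup of \<open>X\<close>, stopping
  times of the two filtrations are never compared.\<close>

lemma completion_idem: "completion (completion M) = completion M"
proof (rule measure_eqI)
  show s: "sets (completion (completion M)) = sets (completion M)"
  proof
    show "sets (completion (completion M)) \<subseteq> sets (completion M)"
    proof
      fix A assume "A \<in> sets (completion (completion M))"
      then obtain S N N' where *: "A = S \<union> N" "N \<subseteq> N'" "N' \<in> null_sets (completion M)"
          "S \<in> sets (completion M)"
        by (rule sets_completionE)
      then have "N \<in> null_sets (completion M)" by (metis null_sets_completion_subset)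
      then show "A \<in> sets (completion M)" using * by auto
    qed
  qed auto
  fix A assume "A \<in> sets (completion (completion M))"
  with s have "A \<in> sets (completion M)" by simp
  then show "emeasure (completion (completion M)) A = emeasure (completion M) A"
    by (subst emeasure_completion) (simp_all add: main_part_sets)
qed

text \<open>An equation between measures, so that the integrals over \<open>completion M\<close> and
  the null sets in the definitions of values and filtrations rewrite to those of
  \<open>M\<close>.\<close>

locale complete_prob_space = prob_space +
  assumes complete: "completion M = M"
begin

lemma null_sets_subset: "A \<in> null_sets M \<Longrightarrow> B \<subseteq> A \<Longrightarrow> B \<in> null_sets M"
  using null_sets_completion_subset[of B A M] complete by simp

lemma sets_if_AE_eq:
  assumes "A \<in> sets M" "B \<subseteq> space M" "AE \<omega> in M. \<omega> \<in> A \<longleftrightarrow> \<omega> \<in> B"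
  shows "B \<in> sets M"
proof -
  obtain Z where Z: "Z \<in> null_sets M" "{\<omega>\<in>space M. \<not> (\<omega> \<in> A \<longleftrightarrow> \<omega> \<in> B)} \<subseteq> Z"
    using assms(3) unfolding eventually_ae_filter by auto
  have "A - B \<in> null_sets M" "B - A \<in> null_sets M"
    using assms(1,2) sets.sets_into_space[OF assms(1)] Z(2)
    by (auto intro!: null_sets_subset[OF Z(1)])
  then have "(A - (A - B)) \<union> (B - A) \<in> sets M" using assms(1) by auto
  moreover have "(A - (A - B)) \<union> (B - A) = B" by auto
  ultimately show ?thesis by simp
qed

lemma measurable_if_AE_eq:
  assumes "f \<in> measurable M N" "\<And>\<omega>. \<omega> \<in> space M \<Longrightarrow> g \<omega> \<in> space N" "AE \<omega> in M. f \<omega> = g \<omega>"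
  shows "g \<in> measurable M N"
proof (rule measurableI)
  fix A assume A: "A \<in> sets N"
  show "g -` A \<inter> space M \<in> sets M"
  proof (rule sets_if_AE_eq)
    show "f -` A \<inter> space M \<in> sets M" using A assms(1) by (rule measurable_sets[rotated])
    show "AE \<omega> in M. \<omega> \<in> f -` A \<inter> space M \<longleftrightarrow> \<omega> \<in> g -` A \<inter> space M"
      using assms(3) by eventually_elim auto
  qed auto
qed (use assms in auto)

text \<open>Completeness gives measurability of paths evaluated at random times: such evaluations
  are almost sure limits of evaluations at grid times.\<close>

lemma borel_measurable_AE_limit:
  fixes f :: "nat \<Rightarrow> 'a \<Rightarrow> real"
  assumes "\<And>i. f i \<in> borel_measurable M" "AE \<omega> in M. (\<lambda>i. f i \<omega>) \<longlonglongrightarrow> g \<omega>"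
  shows "g \<in> borel_measurable M"
proof (rule measurable_if_AE_eq)
  show "(\<lambda>\<omega>. lim (\<lambda>i. f i \<omega>)) \<in> borel_measurable M"
    by (intro borel_measurable_lim_metric assms)
  show "AE \<omega> in M. lim (\<lambda>i. f i \<omega>) = g \<omega>"
    using assms(2) by eventually_elim (rule limI)
qed auto

end

lemma (in prob_space) bounded_convergence:
  fixes f :: "nat \<Rightarrow> 'a \<Rightarrow> real"
  assumes "\<And>i. f i \<in> borel_measurable M" "g \<in> borel_measurable M"
    and "AE \<omega> in M. (\<lambda>i. f i \<omega>) \<longlonglongrightarrow> g \<omega>" "\<And>i \<omega>. \<bar>f i \<omega>\<bar> \<le> C"
  shows "(\<lambda>i. expectation (f i)) \<longlonglongrightarrow> expectation g"
  by (rule integral_dominated_convergence[where w="\<lambda>_. C"]) (use assms in auto)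

lemma (in complete_prob_space) bounded_convergence_complete:
  fixes f :: "nat \<Rightarrow> 'a \<Rightarrow> real"
  assumes "\<And>i. f i \<in> borel_measurable M"
    and "AE \<omega> in M. (\<lambda>i. f i \<omega>) \<longlonglongrightarrow> g \<omega>" "\<And>i \<omega>. \<bar>f i \<omega>\<bar> \<le> C"
  shows "(\<lambda>i. expectation (f i)) \<longlonglongrightarrow> expectation g"
  using assms borel_measurable_AE_limit[OF assms(1,2)] by (intro bounded_convergence) auto

lemma (in prob_space) integrable_bounded:
  fixes f :: "'a \<Rightarrow> real"
  assumes "f \<in> borel_measurable M" "\<And>\<omega>. \<omega> \<in> space M \<Longrightarrow> \<bar>f \<omega>\<bar> \<le> C"
  shows "integrable M f"
  by (rule integrable_const_bound[where B=C]) (use assms in auto)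

text \<open>A non-integrable \<open>f\<close> has integral 0 by convention, and
  \<open>0 \<le> C\<close> covers that case.\<close>

lemma (in prob_space) abs_expectation_le:
  fixes f :: "'a \<Rightarrow> real"
  assumes "AE \<omega> in M. \<bar>f \<omega>\<bar> \<le> C" "0 \<le> C"
  shows "\<bar>expectation f\<bar> \<le> C"
proof (cases "integrable M f")
  case True
  have "\<bar>expectation f\<bar> \<le> expectation (\<lambda>\<omega>. \<bar>f \<omega>\<bar>)" by (rule integral_abs_bound)
  also have "\<dots> \<le> expectation (\<lambda>_. C)"
    using True assms by (intro integral_mono_AE) auto
  finally show ?thesis by (simp add: prob_space)
qed (use assms in \<open>simp add: not_integrable_integral_eq\<close>)

text \<open>Reduces a claim about a countably valued random time to one claim per value.\<close>

lemma (in prob_space) expectation_partition_sums: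
  fixes \<phi> :: "'a \<Rightarrow> real" and J :: "'a \<Rightarrow> nat"
  assumes [measurable]: "J \<in> measurable M (count_space UNIV)" "\<phi> \<in> borel_measurable M"
    and "\<And>\<omega>. \<bar>\<phi> \<omega>\<bar> \<le> C"
  shows "(\<lambda>j. expectation (\<lambda>\<omega>. of_bool (J \<omega> = j) * \<phi> \<omega>)) sums expectation \<phi>"
proof -
  have int: "integrable M (\<lambda>\<omega>. of_bool (J \<omega> = j) * \<phi> \<omega>)" for j
    by (rule integrable_bounded[where C=C]) (use assms(3) in \<open>auto simp: of_bool_def intro: order_trans[OF abs_ge_zero]\<close>)
  have *: "(\<Sum>j<n. expectation (\<lambda>\<omega>. of_bool (J \<omega> = j) * \<phi> \<omega>)) = expectation (\<lambda>\<omega>. of_bool (J \<omega> < n) * \<phi> \<omega>)" for n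
  proof -
    have "(\<Sum>j<n. of_bool (J \<omega> = j) * \<phi> \<omega>) = of_bool (J \<omega> < n) * \<phi> \<omega>" for \<omega>
      by (induction n) auto
    then show ?thesis using int by (subst Bochner_Integration.integral_sum[symmetric]) (auto simp del: sum_of_bool_mult_eq)
  qed
  show ?thesis unfolding sums_def *
  proof (rule bounded_convergence[where C=C])
    fix \<omega> show "\<bar>of_bool (J \<omega> < i) * \<phi> \<omega>\<bar> \<le> C" for i
      using assms(3)[of \<omega>] by (auto simp: of_bool_def intro: order_trans[OF abs_ge_zero])
  next
    have "(\<lambda>i. of_bool (J \<omega> < i) * \<phi> \<omega>) \<longlonglongrightarrow> \<phi> \<omega>" for \<omega>
      by (rule tendsto_eventually) (auto intro!: eventually_mono[OF eventually_gt_at_top[of "J \<omega>"]])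
    then show "AE \<omega> in M. (\<lambda>i. of_bool (J \<omega> < i) * \<phi> \<omega>) \<longlonglongrightarrow> \<phi> \<omega>" by simp
  qed auto
qed

text \<open>The joint law of \<open>U\<close> and \<open>V\<close> is a product measure because
  rectangles factor, and Fubini then freezes \<open>U\<close>. Independence is asked of two families
  of events, since the past is given as a sigma-algebra and the future as a family of
  preimages.\<close>

lemma (in prob_space) indep_set_expectation:
  assumes "indep_set H F"
    and U: "random_variable S U" "\<And>A. A \<in> sets S \<Longrightarrow> U -` A \<inter> space M \<in> H"
    and V: "random_variable T V" "\<And>A. A \<in> sets T \<Longrightarrow> V -` A \<inter> space M \<in> F"
    and \<Psi>: "case_prod \<Psi> \<in> borel_measurable (S \<Otimes>\<^sub>M T)"
    and b: "\<And>u v. \<bar>\<Psi> u v :: real\<bar> \<le> C"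
  shows "expectation (\<lambda>\<omega>. \<Psi> (U \<omega>) (V \<omega>)) = expectation (\<lambda>\<omega>. expectation (\<lambda>\<omega>'. \<Psi> (U \<omega>) (V \<omega>')))"
proof -
  note [measurable] = U(1) V(1) \<Psi>
  note eme = emeasure_eq_measure
  have rect: "prob ((U -` A \<inter> space M) \<inter> (V -` B \<inter> space M)) = prob (U -` A \<inter> space M) * prob (V -` B \<inter> space M)"
    if "A \<in> sets S" "B \<in> sets T" for A B
    using that U V by (intro indep_setD[OF assms(1)])
  interpret A: prob_space "distr M S U" by (rule prob_space_distr) fact
  interpret B: prob_space "distr M T V" by (rule prob_space_distr) fact
  interpret PP: pair_prob_space "distr M S U" "distr M T V" ..
  have d: "distr M S U \<Otimes>\<^sub>M distr M T V = distr M (S \<Otimes>\<^sub>M T) (\<lambda>\<omega>. (U \<omega>, V \<omega>))"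
  proof (rule pair_measure_eqI)
    fix A B assume "A \<in> sets (distr M S U)" "B \<in> sets (distr M T V)"
    then have A: "A \<in> sets S" and B: "B \<in> sets T" by auto
    have "(\<lambda>\<omega>. (U \<omega>, V \<omega>)) -` (A \<times> B) \<inter> space M = (U -` A \<inter> space M) \<inter> (V -` B \<inter> space M)" by auto
    with rect[OF A B] show "emeasure (distr M S U) A * emeasure (distr M T V) B =
        emeasure (distr M (S \<Otimes>\<^sub>M T) (\<lambda>\<omega>. (U \<omega>, V \<omega>))) (A \<times> B)"
      using A B by (simp add: emeasure_distr eme ennreal_mult)
  qed (auto intro: A.sigma_finite_measure_axioms B.sigma_finite_measure_axioms)
  have "expectation (\<lambda>\<omega>. \<Psi> (U \<omega>) (V \<omega>)) = (\<integral>z. case_prod \<Psi> z \<partial>distr M (S \<Otimes>\<^sub>M T) (\<lambda>\<omega>. (U \<omega>, V \<omega>)))"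
    by (subst integral_distr) auto
  also have "\<dots> = (\<integral>u. \<integral>v. \<Psi> u v \<partial>distr M T V \<partial>distr M S U)"
    unfolding d[symmetric]
  proof (subst PP.integral_fst'[symmetric])
    show "integrable (distr M S U \<Otimes>\<^sub>M distr M T V) (\<lambda>(u, v). \<Psi> u v)"
      by (rule PP.P.integrable_bounded[where C=C]) (auto simp: b)
  qed simp
  also have "\<dots> = expectation (\<lambda>\<omega>. \<integral>v. \<Psi> (U \<omega>) v \<partial>distr M T V)"
    by (subst integral_distr) auto
  also have "\<dots> = expectation (\<lambda>\<omega>. expectation (\<lambda>\<omega>'. \<Psi> (U \<omega>) (V \<omega>')))"
    using measurable_space[OF U(1)]
    by (intro Bochner_Integration.integral_cong refl) (subst integral_distr, auto)
  finally show ?thesis .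
qed

text \<open>The class on which all transition operators act: continuity lets pathwise limits pass
  through \<open>g\<close>, boundedness supplies the dominating constant, and both survive one step
  of either recursion.\<close>

definition bounded_continuous :: "(real \<Rightarrow> real) \<Rightarrow> bool" where
  "bounded_continuous g \<longleftrightarrow> continuous_on UNIV g \<and> bounded (range g)"

lemma bounded_continuousE:
  assumes "bounded_continuous g"
  obtains C where "0 \<le> C" "\<And>y. \<bar>g y\<bar> \<le> C"
proof -
  obtain b where "b > 0" "\<And>y. \<bar>g y\<bar> \<le> b"
    using assms unfolding bounded_continuous_def bounded_pos by auto
  then show ?thesis using that[of b] by auto
qed

lemma bounded_continuous_measurable: "bounded_continuous g \<Longrightarrow> g \<in> borel_measurable borel"
  by (simp add: bounded_continuous_def borel_measurable_continuous_onI)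

lemma bounded_continuous_tendsto:
  "bounded_continuous g \<Longrightarrow> (y \<longlongrightarrow> z) F \<Longrightarrow> ((\<lambda>i. g (y i)) \<longlongrightarrow> g z) F"
  by (rule isCont_tendsto_compose[where g=g]) (auto simp: bounded_continuous_def continuous_on_eq_continuous_at)

lemma bounded_continuousI:
  assumes "\<And>y z. y \<longlonglongrightarrow> z \<Longrightarrow> (\<lambda>i. g (y i)) \<longlonglongrightarrow> g z" "\<And>y. \<bar>g y\<bar> \<le> C"
  shows "bounded_continuous g"
  unfolding bounded_continuous_def
proof
  show "continuous_on UNIV g"
    by (auto simp: continuous_on_sequentially o_def intro: assms)
  show "bounded (range g)" using assms(2) by (auto simp: bounded_iff)
qed

lemma bounded_continuous_max:
  assumes "bounded_continuous g" "bounded_continuous h"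
  shows "bounded_continuous (\<lambda>y. max (g y) (c * h y))"
proof -
  obtain C D where b: "\<And>y. \<bar>g y\<bar> \<le> C" "\<And>y. \<bar>h y\<bar> \<le> D"
    using assms bounded_continuousE by (metis (no_types))
  show ?thesis
  proof (rule bounded_continuousI)
    show "\<bar>max (g y) (c * h y)\<bar> \<le> max C (\<bar>c\<bar> * D)" for y
    proof -
      have "\<bar>c * h y\<bar> \<le> \<bar>c\<bar> * D" using b(2)[of y] by (auto simp: abs_mult mult_left_mono)
      then show ?thesis using b(1)[of y] by (auto simp: max_def abs_if split: if_splits)
    qed
    show "(\<lambda>i. max (g (y i)) (c * h (y i))) \<longlonglongrightarrow> max (g z) (c * h z)" if "y \<longlonglongrightarrow> z" for y z
      using that by (intro tendsto_max tendsto_mult tendsto_const assms[THEN bounded_continuous_tendsto])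
  qed
qed

lemma bounded_continuous_cmult:
  assumes g: "bounded_continuous g"
  shows "bounded_continuous (\<lambda>y. c * g y)"
proof -
  obtain C where C: "\<And>y. \<bar>g y\<bar> \<le> C" using g bounded_continuousE by blast
  show ?thesis
    by (rule bounded_continuousI[where C="\<bar>c\<bar> * C"])
       (auto simp: abs_mult C intro!: mult_left_mono tendsto_mult bounded_continuous_tendsto[OF g])
qed

text \<open>
  \<open>w j\<close> is the value with \<open>j\<close> steps to go and \<open>L j\<close> the conditional expectation of \<open>w j\<close> one step ahead;
  \<open>step\<close> is the Markov property, needed only on the events that \<open>\<kappa>\<close> has not yet stopped.
\<close>

lemma (in prob_space) optimal_stopping_le:
  fixes Y :: "nat \<Rightarrow> 'a \<Rightarrow> real" and w L :: "nat \<Rightarrow> real \<Rightarrow> real" and \<kappa> :: "'a \<Rightarrow> nat"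
  assumes Y[measurable]: "\<And>i. Y i \<in> borel_measurable M"
    and \<kappa>[measurable]: "\<kappa> \<in> measurable M (count_space UNIV)"
    and w: "\<And>j. bounded_continuous (w j)" and L: "\<And>j. bounded_continuous (L j)"
    and "0 \<le> \<beta>"
    and w0: "w 0 = f" and wSuc: "\<And>j y. w (Suc j) y = max (f y) (\<beta> * L j y)"
    and step: "\<And>i. i < k \<Longrightarrow> expectation (\<lambda>\<omega>. of_bool (i < \<kappa> \<omega>) * w (k - Suc i) (Y (Suc i) \<omega>)) =
                     expectation (\<lambda>\<omega>. of_bool (i < \<kappa> \<omega>) * L (k - Suc i) (Y i \<omega>))"
  shows "expectation (\<lambda>\<omega>. \<beta> ^ min (\<kappa> \<omega>) k * f (Y (min (\<kappa> \<omega>) k) \<omega>)) \<le> expectation (\<lambda>\<omega>. w k (Y 0 \<omega>))"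
    and "(AE \<omega> in M. \<kappa> \<omega> = (LEAST i. w (k - i) (Y i \<omega>) \<le> f (Y i \<omega>))) \<Longrightarrow>
         expectation (\<lambda>\<omega>. \<beta> ^ min (\<kappa> \<omega>) k * f (Y (min (\<kappa> \<omega>) k) \<omega>)) = expectation (\<lambda>\<omega>. w k (Y 0 \<omega>))"
proof -
  have [measurable]: "w j \<in> borel_measurable borel" "L j \<in> borel_measurable borel" "f \<in> borel_measurable borel" for j
    using w L w0 bounded_continuous_measurable by metis+
  have [measurable]: "(\<lambda>\<omega>. Y (min (\<kappa> \<omega>) j) \<omega>) \<in> borel_measurable M" for j
    by (rule measurable_compose_countable[where g="\<lambda>\<omega>. min (\<kappa> \<omega>) j"]) auto
  have int: "integrable M (\<lambda>\<omega>. g (Z \<omega>))" if g: "bounded_continuous g" "Z \<in> borel_measurable M" for g Z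
  proof -
    obtain C where "\<And>y. \<bar>g y\<bar> \<le> C" using g(1) bounded_continuousE by blast
    then show ?thesis using g bounded_continuous_measurable by (intro integrable_bounded[where C=C]) auto
  qed
  have intb: "integrable M (\<lambda>\<omega>. of_bool (P \<omega>) * h \<omega>)"
    if "Measurable.pred M P" "integrable M h" for P and h :: "'a \<Rightarrow> real"
  proof -
    have "integrable M (\<lambda>\<omega>. indicator {\<omega>\<in>space M. P \<omega>} \<omega> *\<^sub>R h \<omega>)"
      using that by (intro integrable_mult_indicator) auto
    then show ?thesis
      by (rule Bochner_Integration.integrable_cong[THEN iffD1, OF refl, rotated]) (auto simp: indicator_def)
  qed
  \<comment> \<open>The discounted reward if \<open>\<kappa>\<close> has stopped before
    \<open>j\<close>, and the discounted remaining value otherwise: \<open>G\<close> leads from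
    \<open>w k (Y 0)\<close> at \<open>j = 0\<close> to the payoff at \<open>j = k\<close>.\<close>
  define G where "G j \<omega> = (if \<kappa> \<omega> < j then \<beta> ^ \<kappa> \<omega> * f (Y (\<kappa> \<omega>) \<omega>) else \<beta> ^ j * w (k - j) (Y j \<omega>))" for j \<omega>
  have bcf: "bounded_continuous f" using w[of 0] w0 by simp
  \<comment> \<open>One step of \<open>G\<close> loses \<open>d1\<close> if \<open>\<kappa>\<close>
    stops at \<open>j\<close> where the remaining value is larger, and \<open>d2\<close> if it goes
    on where stopping is better; \<open>e\<close> is the martingale part, whose mean vanishes by
    \<open>step\<close>.\<close>
  define d1 where "d1 j \<omega> = of_bool (\<kappa> \<omega> = j) * (\<beta> ^ j * (w (k - j) (Y j \<omega>) - f (Y j \<omega>)))" for j \<omega>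
  define d2 where "d2 j \<omega> = of_bool (j < \<kappa> \<omega>) * (\<beta> ^ j * (w (k - j) (Y j \<omega>) - \<beta> * L (k - Suc j) (Y j \<omega>)))" for j \<omega>
  define e where "e j \<omega> = \<beta> ^ Suc j * (of_bool (j < \<kappa> \<omega>) * L (k - Suc j) (Y j \<omega>)) - \<beta> ^ Suc j * (of_bool (j < \<kappa> \<omega>) * w (k - Suc j) (Y (Suc j) \<omega>))" for j \<omega>
  have iw: "integrable M (\<lambda>\<omega>. w i (Y j \<omega>))" and iL: "integrable M (\<lambda>\<omega>. L i (Y j \<omega>))"
    and iF: "integrable M (\<lambda>\<omega>. f (Y j \<omega>))" for i j
    using int w L bcf Y by blast+
  have pred[measurable]: "Measurable.pred M (\<lambda>\<omega>. j < \<kappa> \<omega>)" "Measurable.pred M (\<lambda>\<omega>. \<kappa> \<omega> = j)" for j by measurable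
  have i1: "integrable M (d1 j)" for j
    unfolding d1_def by (rule intb[OF pred(2)]) (simp add: iw iF)
  have i2: "integrable M (d2 j)" for j
    unfolding d2_def by (rule intb[OF pred(1)]) (simp add: iw iL)
  have i3: "integrable M (\<lambda>\<omega>. c * (of_bool (j < \<kappa> \<omega>) * L i (Y j' \<omega>)))"
      "integrable M (\<lambda>\<omega>. c * (of_bool (j < \<kappa> \<omega>) * w i (Y j' \<omega>)))" for i j j' c
    by (intro integrable_mult_right intb[OF pred(1)] iw iL)+
  have ie: "integrable M (e j)" for j
    unfolding e_def by (intro Bochner_Integration.integrable_diff i3)
  have e0: "expectation (e j) = 0" if "j < k" for j
    unfolding e_def using step[OF that]
    by (subst Bochner_Integration.integral_diff[OF i3]) simp
  have dec: "G j \<omega> = G (Suc j) \<omega> + d1 j \<omega> + d2 j \<omega> + e j \<omega>" for j \<omega>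
  proof -
    consider "\<kappa> \<omega> < j" | "\<kappa> \<omega> = j" | "j < \<kappa> \<omega>" by linarith
    then show ?thesis by cases (auto simp: G_def d1_def d2_def e_def algebra_simps)
  qed
  have intG: "integrable M (G j)" for j
  proof (induction j)
    case 0
    show ?case unfolding G_def by (simp add: iw)
  next
    case (Suc j)
    have "G (Suc j) = (\<lambda>\<omega>. G j \<omega> - d1 j \<omega> - d2 j \<omega> - e j \<omega>)" by (rule ext) (simp add: dec[of j])
    then show ?case using Suc i1 i2 ie by auto
  qed
  have EG: "expectation (G j) = expectation (G (Suc j)) + expectation (d1 j) + expectation (d2 j)" if "j < k" for j
    unfolding dec[of j] using intG i1 i2 ie e0[OF that] by simp
  have wf: "f y \<le> w j y" for j y using w0 wSuc by (cases j) auto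
  have wL: "\<beta> * L (k - Suc j) y \<le> w (k - j) y" if "j < k" for j y
    using that wSuc[of "k - Suc j" y] by (simp add: Suc_diff_Suc)
  have d1: "0 \<le> expectation (d1 j)" for j
    using \<open>0 \<le> \<beta>\<close> wf unfolding d1_def by (intro Bochner_Integration.integral_nonneg) auto
  have d2: "0 \<le> expectation (d2 j)" if "j < k" for j
    using \<open>0 \<le> \<beta>\<close> wL[OF that] unfolding d2_def by (intro Bochner_Integration.integral_nonneg) auto
  have G0: "G 0 \<omega> = w k (Y 0 \<omega>)" for \<omega> by (simp add: G_def)
  have Gk: "G k \<omega> = \<beta> ^ min (\<kappa> \<omega>) k * f (Y (min (\<kappa> \<omega>) k) \<omega>)" for \<omega> by (auto simp: G_def w0 min_def)
  have "j \<le> k \<Longrightarrow> expectation (G j) \<le> expectation (G 0)" for j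
  proof (induction j)
    case (Suc j)
    then show ?case using EG[of j] d1[of j] d2[of j] by auto
  qed auto
  from this[of k] show "expectation (\<lambda>\<omega>. \<beta> ^ min (\<kappa> \<omega>) k * f (Y (min (\<kappa> \<omega>) k) \<omega>)) \<le> expectation (\<lambda>\<omega>. w k (Y 0 \<omega>))"
    by (simp add: G0[abs_def] Gk[abs_def])
  assume \<kappa>: "AE \<omega> in M. \<kappa> \<omega> = (LEAST i. w (k - i) (Y i \<omega>) \<le> f (Y i \<omega>))"
  have "j \<le> k \<Longrightarrow> expectation (G j) = expectation (G 0)" for j
  proof (induction j)
    case (Suc j)
    then have j: "j < k" by simp
    have ex: "w (k - k) (Y k \<omega>) \<le> f (Y k \<omega>)" for \<omega> by (simp add: w0)
    \<comment> \<open>For the least index both losses vanish: where \<open>\<kappa>\<close> stops,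
      \<open>w\<close> does not exceed \<open>f\<close>; before that \<open>w\<close> is larger than
      \<open>f\<close> and so equals the continuation value.\<close>
    have "AE \<omega> in M. d1 j \<omega> = 0"
      using \<kappa>
    proof eventually_elim
      case (elim \<omega>)
      show ?case
      proof (cases "\<kappa> \<omega> = j")
        case True
        then have "w (k - j) (Y j \<omega>) \<le> f (Y j \<omega>)" using elim LeastI[of "\<lambda>i. w (k - i) (Y i \<omega>) \<le> f (Y i \<omega>)", OF ex] by simp
        then show ?thesis using wf[of "Y j \<omega>" "k - j"] by (simp add: d1_def)
      qed (simp add: d1_def)
    qed
    moreover have "AE \<omega> in M. d2 j \<omega> = 0"
      using \<kappa>
    proof eventually_elim
      case (elim \<omega>)
      show ?case
      proof (cases "j < \<kappa> \<omega>")
        case True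
        then have "\<not> w (k - j) (Y j \<omega>) \<le> f (Y j \<omega>)" using elim not_less_Least[of j "\<lambda>i. w (k - i) (Y i \<omega>) \<le> f (Y i \<omega>)"] by simp
        then show ?thesis using wSuc[of "k - Suc j" "Y j \<omega>"] j by (auto simp: d2_def Suc_diff_Suc)
      qed (simp add: d2_def)
    qed
    ultimately have "expectation (d1 j) = 0" "expectation (d2 j) = 0"
      by (auto intro: integral_eq_zero_AE)
    then show ?case using EG[OF j] Suc by simp
  qed auto
  from this[of k] show "expectation (\<lambda>\<omega>. \<beta> ^ min (\<kappa> \<omega>) k * f (Y (min (\<kappa> \<omega>) k) \<omega>)) = expectation (\<lambda>\<omega>. w k (Y 0 \<omega>))"
    by (simp add: G0[abs_def] Gk[abs_def])
qed

subsection \<open>Levy processes and their transition operators\<close>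

lemma (in prob_space) indep_set_mono:
  assumes "indep_set A B" "A' \<subseteq> A" "B' \<subseteq> B"
  shows "indep_set A' B'"
proof (rule indep_setI)
  have "A \<subseteq> events" "B \<subseteq> events" using assms(1) by (auto simp: indep_sets2_eq)
  then show "A' \<subseteq> events" "B' \<subseteq> events" using assms by auto
  fix a b assume "a \<in> A'" "b \<in> B'"
  then show "prob (a \<inter> b) = prob a * prob b" using assms by (intro indep_setD[OF assms(1)]) auto
qed

lemma Int_stable_vimage: "Int_stable {V -` E \<inter> \<Omega> | E. E \<in> sets T}"
proof (rule Int_stableI)
  fix a b assume "a \<in> {V -` E \<inter> \<Omega> | E. E \<in> sets T}" "b \<in> {V -` E \<inter> \<Omega> | E. E \<in> sets T}"
  then obtain E F where "E \<in> sets T" "F \<in> sets T" "a = V -` E \<inter> \<Omega>" "b = V -` F \<inter> \<Omega>" by auto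
  then have "E \<inter> F \<in> sets T" "a \<inter> b = V -` (E \<inter> F) \<inter> \<Omega>" by auto
  then show "a \<inter> b \<in> {V -` E \<inter> \<Omega> | E. E \<in> sets T}" by blast
qed

section \<open>Completed histories and their null sets\<close>

context complete_prob_space
begin

lemma sets_completed_history:
  "sets (completed_history M S Y t) = sigma_sets (space M)
       ({Y s -` B \<inter> space M | s B. 0 \<le> s \<and> ennreal s \<le> t \<and> B \<in> sets S} \<union> null_sets M)"
  unfolding completed_history_def complete
  by (rule sets_measure_of) (auto dest: sets.sets_into_space null_setsD2)

lemma space_completed_history[simp]: "space (completed_history M S Y t) = space M"
  unfolding completed_history_def by (rule space_measure_of_conv)

lemma null_in_completed_history: "A \<in> null_sets M \<Longrightarrow> A \<in> sets (completed_history M S Y t)"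
  unfolding sets_completed_history by (intro sigma_sets.Basic) auto

lemma completed_history_mono: "s \<le> t \<Longrightarrow> sets (completed_history M S Y s) \<subseteq> sets (completed_history M S Y t)"
  unfolding sets_completed_history by (intro sigma_sets_subseteq) (blast intro: order_trans)

lemma sets_completed_history_subset:
  assumes "\<And>s. 0 \<le> s \<Longrightarrow> Y s \<in> measurable M S"
  shows "sets (completed_history M S Y t) \<subseteq> events"
  unfolding sets_completed_history using assms
  by (intro sets.sigma_sets_subset) (auto intro: measurable_sets)

lemma measurable_completed_history:
  assumes "Y s \<in> measurable M S" "0 \<le> s" "ennreal s \<le> t"
  shows "Y s \<in> measurable (completed_history M S Y t) S"
proof (rule measurableI)
  fix A assume "A \<in> sets S"
  then show "Y s -` A \<inter> space (completed_history M S Y t) \<in> sets (completed_history M S Y t)"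
    unfolding sets_completed_history space_completed_history using assms
    by (intro sigma_sets.Basic) blast
qed (use measurable_space[OF assms(1)] in auto)

text \<open>Histories contain all null sets, so it suffices to describe an event on almost all
  paths.\<close>

lemma completed_history_if_AE_eq:
  assumes "A \<in> sets (completed_history M S Y t)" "B \<subseteq> space M" "AE \<omega> in M. \<omega> \<in> A \<longleftrightarrow> \<omega> \<in> B"
  shows "B \<in> sets (completed_history M S Y t)"
proof -
  have A: "A \<subseteq> space M" using sets.sets_into_space[OF assms(1)] by simp
  obtain Z where Z: "Z \<in> null_sets M" "{\<omega>\<in>space M. \<not> (\<omega> \<in> A \<longleftrightarrow> \<omega> \<in> B)} \<subseteq> Z"
    using assms(3) unfolding eventually_ae_filter by auto
  have "A - B \<in> null_sets M" "B - A \<in> null_sets M"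
    using assms(2) A Z(2) by (auto intro!: null_sets_subset[OF Z(1)])
  then have "(A - (A - B)) \<union> (B - A) \<in> sets (completed_history M S Y t)"
    by (intro sets.Un sets.Diff null_in_completed_history assms(1))
  moreover have "(A - (A - B)) \<union> (B - A) = B" by auto
  ultimately show ?thesis by simp
qed

text \<open>A null set is independent of everything, and the union of a sigma-algebra with the null
  sets is closed under intersection; the pi-lambda theorem then extends independence to the
  generated sigma-algebra.\<close>

lemma indep_set_add_null_sets:
  assumes "indep_set (sigma_sets (space M) G) F" "G \<subseteq> Pow (space M)" "Int_stable F"
  shows "indep_set (sigma_sets (space M) (G \<union> null_sets M)) F"
proof -
  let ?H = "sigma_sets (space M) G"
  have ev: "?H \<subseteq> events" "F \<subseteq> events" using assms(1) by (auto simp: indep_sets2_eq)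
  interpret H: sigma_algebra "space M" ?H by (rule sigma_algebra_sigma_sets) fact
  have "indep_set (?H \<union> null_sets M) F"
  proof (rule indep_setI)
    fix a b assume a: "a \<in> ?H \<union> null_sets M" and b: "b \<in> F"
    show "prob (a \<inter> b) = prob a * prob b"
    proof (cases "a \<in> ?H")
      case True then show ?thesis using b by (intro indep_setD[OF assms(1)])
    next
      case False
      then have "a \<in> null_sets M" "a \<inter> b \<in> null_sets M" using a b ev by (auto intro: null_set_Int2)
      then show ?thesis by (simp add: measure_eq_0_null_sets)
    qed
  qed (use ev in auto)
  moreover have "Int_stable (?H \<union> null_sets M)"
  proof (rule Int_stableI)
    fix a b assume "a \<in> ?H \<union> null_sets M" "b \<in> ?H \<union> null_sets M"
    then show "a \<inter> b \<in> ?H \<union> null_sets M"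
      using ev by (auto intro: null_set_Int1 null_set_Int2)
  qed
  ultimately have "indep_set (sigma_sets (space M) (?H \<union> null_sets M)) (sigma_sets (space M) F)"
    using assms(3) by (rule indep_set_sigma_sets)
  then show ?thesis
    by (rule indep_set_mono) (auto intro!: sigma_sets_mono' simp: sigma_sets.Basic)
qed

end

section \<open>The transition semigroup and the Markov property at fixed times\<close>

locale complete_levy_process = levy_process M X + complete_prob_space M for M :: "'a measure" and X
begin

text \<open>Clipping the time at 0 makes the operator total and jointly continuous on the whole
  plane, from which joint measurability in time and space follows.\<close>

definition transition :: "real \<Rightarrow> (real \<Rightarrow> real) \<Rightarrow> real \<Rightarrow> real" where
  "transition t g y = expectation (\<lambda>\<omega>. g (y + X (max 0 t) \<omega>))"

lemma right_continuous:
  assumes "\<omega> \<in> space M" "0 \<le> t" "\<And>n. t \<le> s n" "(s \<longlongrightarrow> t) F"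
  shows "((\<lambda>n. X (s n) \<omega>) \<longlongrightarrow> X t \<omega>) F"
proof -
  have "continuous (at t within {t..}) (\<lambda>s. X s \<omega>)"
    using cadlag_paths[OF assms(1)] assms(2) by (auto simp: cadlag_def continuous_within at_within_Ici_at_right)
  from continuous_within_tendsto_compose'[OF this _ assms(4)] show ?thesis using assms(3) by auto
qed

text \<open>The jump at \<open>t\<close> is the limit of \<open>X\<^sub>t - X\<^sub>t\<^sub>-\<^sub>d\<close>, which is distributed as \<open>X\<^sub>d\<close> and so tends to \<open>0\<close> in law.\<close>

lemma no_fixed_jump:
  assumes "0 \<le> t"
  shows "AE \<omega> in M. continuous (at t within {0..}) (\<lambda>s. X s \<omega>)"
proof (cases "t = 0")
  case True
  have "continuous (at t within {0..}) (\<lambda>s. X s \<omega>)" if "\<omega> \<in> space M" for \<omega>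
    using cadlag_paths[OF that] True by (auto simp: cadlag_def continuous_within at_within_Ici_at_right)
  then show ?thesis by auto
next
  case False
  then have t: "0 < t" using assms by simp
  have "\<exists>L. \<forall>\<omega>\<in>space M. ((\<lambda>s. X s \<omega>) \<longlongrightarrow> L \<omega>) (at_left t)"
    using cadlag_paths t by (intro bchoice) (auto simp: cadlag_def)
  then obtain L where L: "\<And>\<omega>. \<omega> \<in> space M \<Longrightarrow> ((\<lambda>s. X s \<omega>) \<longlongrightarrow> L \<omega>) (at_left t)" by auto
  \<comment> \<open>The shift by 2 keeps \<open>t - d m\<close> strictly between 0 and
    \<open>t\<close> from \<open>m = 0\<close> on.\<close>
  define d where "d m = t / real (m + 2)" for m
  have d: "0 < d m" "d m < t" for m using t by (auto simp: d_def divide_simps)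
  have d0: "d \<longlonglongrightarrow> 0" unfolding d_def
    by (intro real_tendsto_divide_at_top[OF tendsto_const]) (auto intro!: filterlim_tendsto_add_at_top[OF tendsto_const] filterlim_real_sequentially)
  have [measurable]: "X t \<in> borel_measurable M" "\<And>m. X (t - d m) \<in> borel_measurable M" "\<And>m. X (d m) \<in> borel_measurable M"
    "X 0 \<in> borel_measurable M"
    using d t by (auto intro!: measurable_X simp: less_imp_le)
  \<comment> \<open>Bounded, continuous and zero only at 0: a vanishing mean of
    \<open>\<phi>\<close> of the jump rules the jump out, while \<open>X\<close> itself may have no
    moments.\<close>
  define \<phi> where "\<phi> z = min 1 \<bar>z\<bar>" for z :: real
  have [measurable]: "\<phi> \<in> borel_measurable borel" unfolding \<phi>_def by measurable
  have \<phi>b: "\<bar>\<phi> z\<bar> \<le> 1" for z by (simp add: \<phi>_def)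
  have \<phi>c: "(\<lambda>n. \<phi> (a n)) \<longlonglongrightarrow> \<phi> b" if "a \<longlonglongrightarrow> b" for a b
    unfolding \<phi>_def by (intro tendsto_min tendsto_const tendsto_rabs that)
  have left: "(\<lambda>m. X (t - d m) \<omega>) \<longlonglongrightarrow> L \<omega>" if "\<omega> \<in> space M" for \<omega>
  proof (rule filterlim_compose[OF L[OF that]])
    have "(\<lambda>m. t - d m) \<longlonglongrightarrow> t - 0" by (intro tendsto_diff tendsto_const d0)
    then show "filterlim (\<lambda>m. t - d m) (at_left t) sequentially"
      using d by (auto simp: filterlim_at less_imp_neq[THEN not_sym])
  qed
  have "expectation (\<lambda>\<omega>. \<phi> (X t \<omega> - X (t - d m) \<omega>)) = expectation (\<lambda>\<omega>. \<phi> (X (d m) \<omega>))" for m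
  proof -
    have "expectation (\<lambda>\<omega>. \<phi> (X t \<omega> - X (t - d m) \<omega>)) = (\<integral>z. \<phi> z \<partial>distr M borel (\<lambda>\<omega>. X t \<omega> - X (t - d m) \<omega>))"
      by (subst integral_distr) auto
    also have "\<dots> = (\<integral>z. \<phi> z \<partial>distr M borel (X (d m)))"
      using stationary_increments[of "t - d m" t] d[of m] by simp
    also have "\<dots> = expectation (\<lambda>\<omega>. \<phi> (X (d m) \<omega>))" by (subst integral_distr) auto
    finally show ?thesis .
  qed
  moreover have "(\<lambda>m. expectation (\<lambda>\<omega>. \<phi> (X (d m) \<omega>))) \<longlonglongrightarrow> expectation (\<lambda>\<omega>. \<phi> (X 0 \<omega>))"
    by (rule bounded_convergence_complete[where C=1])
       (use \<phi>b d in \<open>auto intro!: AE_I2 \<phi>c right_continuous d0 simp: less_imp_le\<close>)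
  moreover have "(\<lambda>m. expectation (\<lambda>\<omega>. \<phi> (X t \<omega> - X (t - d m) \<omega>))) \<longlonglongrightarrow> expectation (\<lambda>\<omega>. \<phi> (X t \<omega> - L \<omega>))"
    by (rule bounded_convergence_complete[where C=1])
       (use \<phi>b in \<open>auto intro!: AE_I2 \<phi>c tendsto_diff left\<close>)
  moreover have "expectation (\<lambda>\<omega>. \<phi> (X 0 \<omega>)) = expectation (\<lambda>_. 0)"
    using start by (intro integral_cong_AE) (auto simp: \<phi>_def)
  ultimately have "expectation (\<lambda>\<omega>. \<phi> (X t \<omega> - L \<omega>)) = 0" using LIMSEQ_unique by fastforce
  moreover have [measurable]: "L \<in> borel_measurable M"
    by (rule borel_measurable_AE_limit[of "\<lambda>m. X (t - d m)"]) (auto intro: left)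
  ultimately have "AE \<omega> in M. \<phi> (X t \<omega> - L \<omega>) = 0"
    by (subst (asm) integral_nonneg_eq_0_iff_AE)
       (auto intro!: integrable_bounded[where C=1] \<phi>b simp: \<phi>_def)
  with AE_space show ?thesis
  proof eventually_elim
    fix \<omega> assume "\<omega> \<in> space M" "\<phi> (X t \<omega> - L \<omega>) = 0"
    then have "X t \<omega> = L \<omega>" by (auto simp: \<phi>_def min_def split: if_splits)
    then have "((\<lambda>s. X s \<omega>) \<longlongrightarrow> X t \<omega>) (at_left t)" using L[OF \<open>\<omega> \<in> space M\<close>] by simp
    moreover have "((\<lambda>s. X s \<omega>) \<longlongrightarrow> X t \<omega>) (at_right t)"
      using cadlag_paths[OF \<open>\<omega> \<in> space M\<close>] t unfolding cadlag_def by (meson less_imp_le)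
    ultimately have "((\<lambda>s. X s \<omega>) \<longlongrightarrow> X t \<omega>) (at t)"
      by (rule filterlim_split_at)
    then show "continuous (at t within {0..}) (\<lambda>s. X s \<omega>)"
      unfolding continuous_within by (rule tendsto_within_subset) auto
  qed
qed

lemma transition_abs_le: "(\<And>y. \<bar>g y\<bar> \<le> C) \<Longrightarrow> \<bar>transition t g y\<bar> \<le> C"
  unfolding transition_def by (rule abs_expectation_le) (auto intro: order_trans[OF abs_ge_zero])

text \<open>Joint Feller continuity: the limit time is deterministic, so almost every path is
  continuous there, and times may approach it from both sides.\<close>

lemma transition_tendsto:
  assumes g: "bounded_continuous g" and "s \<longlonglongrightarrow> t" "y \<longlonglongrightarrow> z"
  shows "(\<lambda>n. transition (s n) g (y n)) \<longlonglongrightarrow> transition t g z"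
proof -
  obtain C where "\<And>y. \<bar>g y\<bar> \<le> C" using g bounded_continuousE by blast
  note [measurable] = bounded_continuous_measurable[OF g]
  have [measurable]: "X (max 0 t) \<in> borel_measurable M" for t by (rule measurable_X) simp
  show ?thesis unfolding transition_def
  proof (rule bounded_convergence[where C=C])
    show "AE \<omega> in M. (\<lambda>i. g (y i + X (max 0 (s i)) \<omega>)) \<longlonglongrightarrow> g (z + X (max 0 t) \<omega>)"
      using no_fixed_jump[of "max 0 t", OF max.cobounded1]
    proof eventually_elim
      case (elim \<omega>)
      have "(\<lambda>i. max 0 (s i)) \<longlonglongrightarrow> max 0 t" by (intro tendsto_max tendsto_const assms)
      then have "(\<lambda>i. X (max 0 (s i)) \<omega>) \<longlonglongrightarrow> X (max 0 t) \<omega>"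
        by (intro continuous_within_tendsto_compose'[OF elim]) auto
      then show ?case using assms by (intro bounded_continuous_tendsto[OF g] tendsto_add) auto
    qed
  qed (auto intro: \<open>\<And>y. \<bar>g y\<bar> \<le> C\<close>)
qed

lemma bounded_continuous_transition:
  assumes "bounded_continuous g"
  shows "bounded_continuous (transition t g)"
proof -
  obtain C where "\<And>y. \<bar>g y\<bar> \<le> C" using assms bounded_continuousE by blast
  then show ?thesis
    by (intro bounded_continuousI[where C=C] transition_tendsto assms tendsto_const transition_abs_le)
qed

lemma transition_mono:
  assumes "bounded_continuous g" "bounded_continuous h" "\<And>y. g y \<le> h y"
  shows "transition t g y \<le> transition t h y"
proof -
  obtain C D where "\<And>y. \<bar>g y\<bar> \<le> C" "\<And>y. \<bar>h y\<bar> \<le> D" using assms bounded_continuousE by meson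
  moreover have [measurable]: "X (max 0 t) \<in> borel_measurable M" by (rule measurable_X) simp
  ultimately show ?thesis unfolding transition_def
    using assms(3) bounded_continuous_measurable[OF assms(1)] bounded_continuous_measurable[OF assms(2)]
    by (intro integral_mono integrable_bounded[where C=C] integrable_bounded[where C=D]) auto
qed

lemma measurable_transition:
  assumes "bounded_continuous g"
  shows "(\<lambda>(s, y). transition s g y) \<in> borel_measurable (borel \<Otimes>\<^sub>M borel)"
proof -
  have "continuous_on UNIV (\<lambda>(s, y). transition s g y)"
    unfolding continuous_on_sequentially
  proof (intro allI ballI impI)
    fix z :: "nat \<Rightarrow> real \<times> real" and p assume "(\<forall>n. z n \<in> UNIV) \<and> z \<longlonglongrightarrow> p"
    then have "(\<lambda>n. fst (z n)) \<longlonglongrightarrow> fst p" "(\<lambda>n. snd (z n)) \<longlonglongrightarrow> snd p"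
      by (auto dest: tendsto_fst tendsto_snd)
    from transition_tendsto[OF assms this] show "((\<lambda>(s, y). transition s g y) \<circ> z) \<longlonglongrightarrow> (case p of (s, y) \<Rightarrow> transition s g y)"
      by (simp add: o_def case_prod_beta)
  qed
  then show ?thesis by (simp add: borel_prod borel_measurable_continuous_onI)
qed

lemma expectation_start:
  fixes g :: "real \<Rightarrow> real"
  assumes "g \<in> borel_measurable borel"
  shows "expectation (\<lambda>\<omega>. g (y + X 0 \<omega>)) = g y"
proof -
  have [measurable]: "X 0 \<in> borel_measurable M" by (rule measurable_X) simp
  note [measurable] = assms
  have "expectation (\<lambda>\<omega>. g (y + X 0 \<omega>)) = expectation (\<lambda>\<omega>. g y)"
    using start by (intro integral_cong_AE) auto
  then show ?thesis by (simp add: prob_space)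
qed

lemma transition_0: "bounded_continuous g \<Longrightarrow> transition 0 g y = g y"
  using expectation_start bounded_continuous_measurable by (simp add: transition_def)

lemma transition_increment:
  assumes "bounded_continuous g" "0 \<le> q" "0 \<le> h"
  shows "expectation (\<lambda>\<omega>. g (y + (X (q + h) \<omega> - X q \<omega>))) = transition h g y"
proof -
  note [measurable] = bounded_continuous_measurable[OF assms(1)]
  have [measurable]: "X q \<in> borel_measurable M" "X (q + h) \<in> borel_measurable M" "X h \<in> borel_measurable M"
    using assms measurable_X by auto
  have "expectation (\<lambda>\<omega>. g (y + (X (q + h) \<omega> - X q \<omega>))) = (\<integral>z. g (y + z) \<partial>distr M borel (\<lambda>\<omega>. X (q + h) \<omega> - X q \<omega>))"
    by (subst integral_distr) auto
  also have "\<dots> = (\<integral>z. g (y + z) \<partial>distr M borel (X h))"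
    using stationary_increments[of q "q + h"] assms by simp
  also have "\<dots> = transition h g y" using assms by (subst integral_distr) (auto simp: transition_def)
  finally show ?thesis .
qed

text \<open>Events on finitely many past coordinates generate the past and are closed under
  intersection. Refining their times to a partition expresses them through increments up to
  \<open>q\<close>, which are independent of the later ones. Two consecutive later increments are
  kept because the clock needs both: no jump up to \<open>q + p\<close>, some jump up to
  \<open>q + p'\<close>.\<close>

lemma future_indep_past:
  assumes "0 \<le> q" "0 \<le> p" "p \<le> p'"
  shows "indep_set (sigma_sets (space M) {X s -` B \<inter> space M | s B. 0 \<le> s \<and> s \<le> q \<and> B \<in> sets borel})
           {(\<lambda>\<omega>. (X (q + p) \<omega> - X q \<omega>, X (q + p') \<omega> - X (q + p) \<omega>)) -` E \<inter> space M | E. E \<in> sets (borel \<Otimes>\<^sub>M borel)}"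
    (is "indep_set (sigma_sets _ ?G) ?F")
proof -
  define Z where "Z \<omega> = (X (q + p) \<omega> - X q \<omega>, X (q + p') \<omega> - X (q + p) \<omega>)" for \<omega>
  define Cyl where "Cyl S B = {\<omega>\<in>space M. \<forall>s\<in>S. X s \<omega> \<in> B s}" for S and B :: "real \<Rightarrow> real set"
  let ?P = "{Cyl S B | S B. finite S \<and> S \<subseteq> {0..q} \<and> range B \<subseteq> sets borel}"
  have [measurable]: "X q \<in> borel_measurable M" "X (q + p) \<in> borel_measurable M" "X (q + p') \<in> borel_measurable M"
    using assms by (auto intro!: measurable_X)
  have Zm[measurable]: "Z \<in> measurable M (borel \<Otimes>\<^sub>M borel)" unfolding Z_def by measurable
  have Cyl_ev: "Cyl S B \<in> events" if "finite S" "S \<subseteq> {0..q}" "range B \<subseteq> sets borel" for S B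
  proof -
    have "{\<omega>\<in>space M. X s \<omega> \<in> B s} \<in> events" if "s \<in> S" for s
    proof -
      have [measurable]: "X s \<in> borel_measurable M" "B s \<in> sets borel"
        using that \<open>S \<subseteq> {0..q}\<close> \<open>range B \<subseteq> sets borel\<close> by (auto intro!: measurable_X)
      show ?thesis by measurable
    qed
    then show ?thesis unfolding Cyl_def using that(1) by (intro sets.sets_Collect_finite_All) auto
  qed
  have "indep_set ?P ?F"
  proof (rule indep_setI)
    fix a b assume "a \<in> ?P" "b \<in> ?F"
    then obtain S B E where S: "finite S" "S \<subseteq> {0..q}" and B: "range B \<subseteq> sets borel" and a: "a = Cyl S B"
      and E[measurable]: "E \<in> sets (borel \<Otimes>\<^sub>M borel)" and b: "b = Z -` E \<inter> space M" by (auto simp: Z_def[abs_def])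
    \<comment> \<open>With 0 and \<open>q\<close> among the times, the partial sums of increments
      start from \<open>X 0\<close>, and the last past increment ends at \<open>q\<close>.\<close>
    define l where "l = sorted_list_of_set (insert 0 (insert q S))"
    have set_l: "set l = insert 0 (insert q S)" unfolding l_def using S by (subst set_sorted_list_of_set) auto
    have sl: "sorted l" unfolding l_def by simp
    define m where "m = length l - 1"
    have len: "length l = Suc m" using set_l unfolding m_def by (cases l) auto
    have lb: "0 \<le> l ! i" "l ! i \<le> q" if "i \<le> m" for i
      using nth_mem[of i l] that len set_l S(2) assms(1) by auto
    obtain i0 where "i0 \<le> m" "l ! i0 = 0" using set_l len by (metis in_set_conv_nth insertI1 less_Suc_eq_le)
    then have l0: "l ! 0 = 0" using sorted_nth_mono[OF sl, of 0 i0] lb[of 0] len by simp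
    obtain iq where "iq \<le> m" "l ! iq = q" using set_l len by (metis in_set_conv_nth insertI1 insertI2 less_Suc_eq_le)
    then have lm: "l ! m = q" using sorted_nth_mono[OF sl, of iq m] lb[of m] len by simp
    \<comment> \<open>Constant from index \<open>m + 2\<close> on, so that \<open>u\<close> is
      monotone everywhere and the increments with index \<open>m\<close> and \<open>m + 1\<close>
      are the two future ones.\<close>
    define u where "u i = (if i \<le> m then l ! i else if i = Suc m then q + p else q + p')" for i
    have u: "u 0 = 0" "u m = q" "u (Suc m) = q + p" "u (Suc (Suc m)) = q + p'" using l0 lm by (auto simp: u_def)
    have "u i \<le> u (Suc i)" for i
      using sorted_nth_mono[OF sl, of i "Suc i"] len lb(2)[of i] assms lm
      by (auto simp: u_def not_le not_less_eq_eq le_Suc_eq)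
    then have "mono u" by (simp add: mono_iff_le_Suc)
    define inc where "inc i \<omega> = X (u (Suc i)) \<omega> - X (u i) \<omega>" for i \<omega>
    have "indep_vars (\<lambda>_. borel) inc {..<Suc (Suc m)}"
      unfolding inc_def[abs_def] using u(1) by (intro independent_increments) (auto intro: \<open>mono u\<close>)
    then have iv: "indep_var (Pi\<^sub>M {..<m} (\<lambda>_. borel)) (\<lambda>\<omega>. restrict (\<lambda>i. inc i \<omega>) {..<m})
        (Pi\<^sub>M {m, Suc m} (\<lambda>_. borel)) (\<lambda>\<omega>. restrict (\<lambda>i. inc i \<omega>) {m, Suc m})"
      by (rule indep_var_restrict) auto
    define B' where "B' i = (if u i \<in> S then B (u i) else UNIV)" for i
    have "B' i \<in> sets borel" for i using B by (auto simp: B'_def)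
    \<comment> \<open>The past event in terms of increments: \<open>X (u i)\<close> is the partial
      sum up to \<open>i\<close> wherever \<open>X 0\<close> vanishes, that is, almost
      surely.\<close>
    define Xa where "Xa = {z \<in> space (Pi\<^sub>M {..<m} (\<lambda>_. borel)). \<forall>i\<in>{..m}. (\<Sum>j<i. z j) \<in> B' i}"
    define Xb where "Xb = {z \<in> space (Pi\<^sub>M {m, Suc m} (\<lambda>_. borel)). (z m, z (Suc m)) \<in> E}"
    have Xa: "Xa \<in> sets (Pi\<^sub>M {..<m} (\<lambda>_. borel))"
    proof -
      have "{z \<in> space (Pi\<^sub>M {..<m} (\<lambda>_. borel)). (\<Sum>j<i. z j) \<in> B' i} \<in> sets (Pi\<^sub>M {..<m} (\<lambda>_. borel))" if "i \<in> {..m}" for i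
      proof -
        have "(\<lambda>z. \<Sum>j<i. z j) \<in> borel_measurable (Pi\<^sub>M {..<m} (\<lambda>_. borel :: real measure))"
          using that by (intro borel_measurable_sum measurable_component_singleton) auto
        from measurable_sets[OF this \<open>B' i \<in> sets borel\<close>] show ?thesis
          by (simp add: vimage_def Int_def conj_commute)
      qed
      then show ?thesis unfolding Xa_def by (intro sets.sets_Collect_finite_All) auto
    qed
    have Xb: "Xb \<in> sets (Pi\<^sub>M {m, Suc m} (\<lambda>_. borel))"
    proof -
      have [measurable]: "(\<lambda>z. z m) \<in> borel_measurable (Pi\<^sub>M {m, Suc m} (\<lambda>_. borel :: real measure))"
         "(\<lambda>z. z (Suc m)) \<in> borel_measurable (Pi\<^sub>M {m, Suc m} (\<lambda>_. borel :: real measure))"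
        by (auto intro!: measurable_component_singleton)
      show ?thesis unfolding Xb_def by measurable
    qed
    let ?I = "\<lambda>\<omega>. restrict (\<lambda>i. inc i \<omega>) {..<m}" and ?J = "\<lambda>\<omega>. restrict (\<lambda>i. inc i \<omega>) {m, Suc m}"
    have sum_inc: "(\<Sum>j<i. inc j \<omega>) = X (u i) \<omega>" if "X 0 \<omega> = 0" for i \<omega>
      using that u(1) by (induction i) (auto simp: inc_def)
    have Xa_iff: "?I \<omega> \<in> Xa \<longleftrightarrow> \<omega> \<in> a" if "X 0 \<omega> = 0" "\<omega> \<in> space M" for \<omega>
    proof -
      have "?I \<omega> \<in> Xa \<longleftrightarrow> (\<forall>i\<le>m. (\<Sum>j<i. inc j \<omega>) \<in> B' i)"
        by (auto simp: Xa_def space_PiM)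
      also have "\<dots> \<longleftrightarrow> (\<forall>i\<le>m. X (u i) \<omega> \<in> B' i)" using sum_inc[OF that(1)] by simp
      also have "\<dots> \<longleftrightarrow> (\<forall>s\<in>S. X s \<omega> \<in> B s)"
      proof safe
        fix s assume *: "\<forall>i\<le>m. X (u i) \<omega> \<in> B' i" "s \<in> S"
        then obtain i where "i \<le> m" "l ! i = s" using set_l len by (metis in_set_conv_nth insertI2 less_Suc_eq_le)
        then show "X s \<omega> \<in> B s" using * by (auto simp: u_def B'_def dest!: spec[of _ i])
      qed (auto simp: B'_def)
      finally show ?thesis using that by (simp add: a Cyl_def)
    qed
    have Xb_iff: "?J \<omega> \<in> Xb \<longleftrightarrow> \<omega> \<in> b" if "\<omega> \<in> space M" for \<omega>
      using that by (auto simp: Xb_def b Z_def inc_def u space_PiM)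
    have [measurable]: "a \<in> events" "b \<in> events" using Cyl_ev S B a b by auto
    have rvs: "?I \<in> measurable M (Pi\<^sub>M {..<m} (\<lambda>_. borel))" "?J \<in> measurable M (Pi\<^sub>M {m, Suc m} (\<lambda>_. borel))"
      using iv unfolding indep_var_eq by auto
    have pa: "prob a = prob (?I -` Xa \<inter> space M)"
      using start measurable_sets[OF rvs(1) Xa] by (intro finite_measure_eq_AE) (auto simp: Xa_iff)
    have pb: "prob b = prob (?J -` Xb \<inter> space M)"
      by (rule arg_cong[where f=prob]) (use Xb_iff sets.sets_into_space[OF \<open>b \<in> events\<close>] in auto)
    have pab: "prob (a \<inter> b) = prob ((\<lambda>x. (?I x, ?J x)) -` (Xa \<times> Xb) \<inter> space M)"
    proof (rule finite_measure_eq_AE)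
      show "AE \<omega> in M. \<omega> \<in> a \<inter> b \<longleftrightarrow> \<omega> \<in> (\<lambda>x. (?I x, ?J x)) -` (Xa \<times> Xb) \<inter> space M"
        using start AE_space by eventually_elim (simp add: Xa_iff Xb_iff)
      have "(\<lambda>x. (?I x, ?J x)) -` (Xa \<times> Xb) \<inter> space M = (?I -` Xa \<inter> space M) \<inter> (?J -` Xb \<inter> space M)" by auto
      then show "(\<lambda>x. (?I x, ?J x)) -` (Xa \<times> Xb) \<inter> space M \<in> events"
        using measurable_sets[OF rvs(1) Xa] measurable_sets[OF rvs(2) Xb] by auto
    qed auto
    show "prob (a \<inter> b) = prob a * prob b"
      unfolding pa pb pab by (rule indep_varD[OF iv Xa Xb])
  next
    show "?P \<subseteq> events" using Cyl_ev by auto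
    show "?F \<subseteq> events" using Zm unfolding Z_def[abs_def] by (auto intro: measurable_sets)
  qed
  moreover have "Int_stable ?P"
  proof (rule Int_stableI)
    fix a b assume "a \<in> ?P" "b \<in> ?P"
    then obtain S B S' B' where *: "finite S" "S \<subseteq> {0..q}" "range B \<subseteq> sets borel" "a = Cyl S B"
       "finite S'" "S' \<subseteq> {0..q}" "range B' \<subseteq> sets borel" "b = Cyl S' B'" by auto
    define B'' where "B'' s = (if s \<in> S then B s else UNIV) \<inter> (if s \<in> S' then B' s else UNIV)" for s
    have "a \<inter> b = Cyl (S \<union> S') B''" unfolding *(4,8) by (auto simp: Cyl_def B''_def)
    moreover have "range B'' \<subseteq> sets borel" using *(3,7) by (auto simp: B''_def)
    ultimately show "a \<inter> b \<in> ?P" using * by (intro CollectI exI[of _ "S \<union> S'"] exI[of _ B'']) auto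
  qed
  ultimately have "indep_set (sigma_sets (space M) ?P) (sigma_sets (space M) ?F)"
    using Int_stable_vimage by (rule indep_set_sigma_sets)
  then show ?thesis
  proof (rule indep_set_mono)
    have "X s -` B \<inter> space M \<in> ?P" if "0 \<le> s" "s \<le> q" "B \<in> sets borel" for s B
    proof -
      have "X s -` B \<inter> space M = Cyl {s} (\<lambda>_. B)" by (auto simp: Cyl_def)
      then show ?thesis using that by (intro CollectI exI[of _ "{s}"] exI[of _ "\<lambda>_. B"]) auto
    qed
    then show "sigma_sets (space M) ?G \<subseteq> sigma_sets (space M) ?P" by (intro sigma_sets_subseteq) auto
  qed (auto intro: sigma_sets.Basic)
qed

text \<open>Independence freezes the past. \<open>P\<close> is an event of the future and
  \<open>c\<close> its probability: a trivial \<open>P\<close> gives the Markov property of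
  \<open>X\<close>, and a jump of the clock in a prescribed cell the one for the pair.\<close>

lemma indep_markov:
  assumes H: "sets H \<subseteq> events" "space H = space M" and A: "A \<in> sets H" and Xq: "X q \<in> borel_measurable H"
    and "0 \<le> q" "0 \<le> h" and [measurable]: "Measurable.pred M P"
    and ind: "indep_set (sets H) {(\<lambda>\<omega>. (P \<omega>, X (q + h) \<omega> - X q \<omega>)) -` E \<inter> space M | E. E \<in> sets (count_space UNIV \<Otimes>\<^sub>M borel)}"
    and c: "\<And>y. expectation (\<lambda>\<omega>. of_bool (P \<omega>) * g (y + (X (q + h) \<omega> - X q \<omega>))) = c * transition h g y"
    and g: "bounded_continuous g"
  shows "expectation (\<lambda>\<omega>. of_bool (\<omega> \<in> A) * (of_bool (P \<omega>) * g (x + X (q + h) \<omega>))) =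
         c * expectation (\<lambda>\<omega>. of_bool (\<omega> \<in> A) * transition h g (x + X q \<omega>))"
proof -
  obtain C where C: "0 \<le> C" "\<And>y. \<bar>g y\<bar> \<le> C" using g bounded_continuousE by blast
  note [measurable] = bounded_continuous_measurable[OF g]
  have [measurable]: "X q \<in> borel_measurable M" "X (q + h) \<in> borel_measurable M"
    using \<open>0 \<le> q\<close> \<open>0 \<le> h\<close> by (auto intro!: measurable_X)
  define \<Psi> where "\<Psi> u v = (case u of (b, a) \<Rightarrow> case v of (p, z) \<Rightarrow> of_bool b * (of_bool p * g (x + a + z)))"
    for u v :: "bool \<times> real"
  have U: "(\<lambda>\<omega>. (\<omega> \<in> A, X q \<omega>)) \<in> measurable H (count_space UNIV \<Otimes>\<^sub>M borel)"
    using A Xq by measurable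
  have UM[measurable]: "(\<lambda>\<omega>. (\<omega> \<in> A, X q \<omega>)) \<in> measurable M (count_space UNIV \<Otimes>\<^sub>M borel)"
  proof -
    have [measurable]: "A \<in> events" using A H(1) by auto
    show ?thesis by measurable
  qed
  have "expectation (\<lambda>\<omega>. \<Psi> (\<omega> \<in> A, X q \<omega>) (P \<omega>, X (q + h) \<omega> - X q \<omega>)) =
        expectation (\<lambda>\<omega>. expectation (\<lambda>\<omega>'. \<Psi> (\<omega> \<in> A, X q \<omega>) (P \<omega>', X (q + h) \<omega>' - X q \<omega>')))"
  proof (rule indep_set_expectation[OF ind UM])
    show "(\<lambda>\<omega>. (\<omega> \<in> A, X q \<omega>)) -` E \<inter> space M \<in> sets H" if "E \<in> sets (count_space UNIV \<Otimes>\<^sub>M borel)" for E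
      using measurable_sets[OF U that] H by simp
    show "\<bar>\<Psi> u v\<bar> \<le> C" for u v using C by (auto simp: \<Psi>_def split: prod.splits)
    show "case_prod \<Psi> \<in> borel_measurable ((count_space UNIV \<Otimes>\<^sub>M borel) \<Otimes>\<^sub>M (count_space UNIV \<Otimes>\<^sub>M borel))"
      unfolding \<Psi>_def case_prod_beta by measurable
    show "(\<lambda>\<omega>. (P \<omega>, X (q + h) \<omega> - X q \<omega>)) \<in> measurable M (count_space UNIV \<Otimes>\<^sub>M borel)" by measurable
  qed auto
  also have "\<dots> = expectation (\<lambda>\<omega>. of_bool (\<omega> \<in> A) * (c * transition h g (x + X q \<omega>)))"
    by (simp add: \<Psi>_def c)
  finally show ?thesis by (simp add: \<Psi>_def algebra_simps)
qed

lemma markov: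
  assumes A: "A \<in> sets (completed_history M borel X (ennreal q))" and "0 \<le> q" "0 \<le> h" and g: "bounded_continuous g"
  shows "expectation (\<lambda>\<omega>. of_bool (\<omega> \<in> A) * g (x + X (q + h) \<omega>)) =
         expectation (\<lambda>\<omega>. of_bool (\<omega> \<in> A) * transition h g (x + X q \<omega>))"
proof -
  let ?G = "{X s -` B \<inter> space M | s B. 0 \<le> s \<and> s \<le> q \<and> B \<in> sets borel}"
  have G: "{X s -` B \<inter> space M | s B. 0 \<le> s \<and> ennreal s \<le> ennreal q \<and> B \<in> sets borel} = ?G"
    using \<open>0 \<le> q\<close> by auto
  have "indep_set (sets (completed_history M borel X (ennreal q)))
     {(\<lambda>\<omega>. (X (q + h) \<omega> - X q \<omega>, X (q + h) \<omega> - X (q + h) \<omega>)) -` E \<inter> space M | E. E \<in> sets (borel \<Otimes>\<^sub>M borel)}"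
    unfolding sets_completed_history G
    by (intro indep_set_add_null_sets future_indep_past assms Int_stable_vimage) auto
  \<comment> \<open>The case \<open>p = p' = h\<close>, whose second increment is 0; the constant
    \<open>True\<close> takes the place of the event \<open>P\<close>.\<close>
  then have ind: "indep_set (sets (completed_history M borel X (ennreal q)))
     {(\<lambda>\<omega>. (True, X (q + h) \<omega> - X q \<omega>)) -` E \<inter> space M | E. E \<in> sets (count_space UNIV \<Otimes>\<^sub>M borel)}"
  proof (rule indep_set_mono)
    show "{(\<lambda>\<omega>. (True, X (q + h) \<omega> - X q \<omega>)) -` E \<inter> space M | E. E \<in> sets (count_space UNIV \<Otimes>\<^sub>M borel)} \<subseteq>
      {(\<lambda>\<omega>. (X (q + h) \<omega> - X q \<omega>, X (q + h) \<omega> - X (q + h) \<omega>)) -` E \<inter> space M | E. E \<in> sets (borel \<Otimes>\<^sub>M borel)}"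
    proof safe
      fix E :: "(bool \<times> real) set" assume [measurable]: "E \<in> sets (count_space UNIV \<Otimes>\<^sub>M borel)"
      have "{z :: real \<times> real. (True, fst z) \<in> E} \<in> sets (borel \<Otimes>\<^sub>M borel)"
        using measurable_sets[of "\<lambda>z. (True, fst z)" "borel \<Otimes>\<^sub>M borel :: (real \<times> real) measure" "count_space UNIV \<Otimes>\<^sub>M borel" E]
        by (simp add: vimage_def space_pair_measure)
      then show "\<exists>E'. (\<lambda>\<omega>. (True, X (q + h) \<omega> - X q \<omega>)) -` E \<inter> space M =
          (\<lambda>\<omega>. (X (q + h) \<omega> - X q \<omega>, X (q + h) \<omega> - X (q + h) \<omega>)) -` E' \<inter> space M \<and> E' \<in> sets (borel \<Otimes>\<^sub>M borel)"
        by (intro exI[of _ "{z. (True, fst z) \<in> E}"]) auto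
    qed
  qed auto
  have sub: "sets (completed_history M borel X (ennreal q)) \<subseteq> events"
    by (intro sets_completed_history_subset measurable_X)
  have "expectation (\<lambda>\<omega>. of_bool (\<omega> \<in> A) * (of_bool True * g (x + X (q + h) \<omega>))) =
         1 * expectation (\<lambda>\<omega>. of_bool (\<omega> \<in> A) * transition h g (x + X q \<omega>))"
    by (rule indep_markov[OF sub _ A])
       (use assms ind transition_increment[OF g] in \<open>auto intro!: measurable_completed_history measurable_X\<close>)
  then show ?thesis by simp
qed

text \<open>Chapman-Kolmogorov, from the Markov property on the sure event.\<close>

lemma transition_add:
  assumes "0 \<le> s" "0 \<le> t" "bounded_continuous g"
  shows "transition (s + t) g y = transition s (transition t g) y"
proof -
  have "space M \<in> sets (completed_history M borel X (ennreal s))"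
    using sets.top[of "completed_history M borel X (ennreal s)"] by simp
  from markov[OF this assms, of y] have "expectation (\<lambda>\<omega>. g (y + X (s + t) \<omega>)) = expectation (\<lambda>\<omega>. transition t g (y + X s \<omega>))"
    by (simp cong: Bochner_Integration.integral_cong)
  then show ?thesis using assms by (simp add: transition_def[of "s + t"] transition_def[of s "transition t g"])
qed

end

subsection \<open>Poisson processes\<close>

text \<open>Markov's inequality for \<open>exp (\<theta> * real k - a)\<close>. A negative
  \<open>\<theta>\<close> gives the lower tail, a positive one the upper.\<close>

lemma poisson_pmf_chernoff:
  assumes "0 < \<mu>"
  shows "measure_pmf.prob (poisson_pmf \<mu>) {k. a \<le> \<theta> * real k} \<le> exp (\<mu> * (exp \<theta> - 1) - a)"
proof -
  have "(\<lambda>k. exp (- \<mu> - a) * (inverse (fact k) *\<^sub>R (\<mu> * exp \<theta>) ^ k)) sums (exp (- \<mu> - a) * exp (\<mu> * exp \<theta>))"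
    by (intro sums_mult exp_converges)
  moreover have "exp (- \<mu> - a) * (inverse (fact k) *\<^sub>R (\<mu> * exp \<theta>) ^ k) = \<mu> ^ k / fact k * exp (- \<mu>) * exp (\<theta> * real k - a)" for k
    by (simp add: exp_diff power_mult_distrib exp_minus exp_of_nat2_mult field_simps)
  ultimately have s: "(\<lambda>k. \<mu> ^ k / fact k * exp (- \<mu>) * exp (\<theta> * real k - a)) sums exp (\<mu> * (exp \<theta> - 1) - a)"
    by (simp add: exp_add[symmetric] algebra_simps)
  have "emeasure (measure_pmf (poisson_pmf \<mu>)) {k. a \<le> \<theta> * real k} = (\<integral>\<^sup>+k. indicator {k. a \<le> \<theta> * real k} k \<partial>measure_pmf (poisson_pmf \<mu>))"
    by simp
  also have "\<dots> \<le> (\<integral>\<^sup>+k. ennreal (exp (\<theta> * real k - a)) \<partial>measure_pmf (poisson_pmf \<mu>))"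
    by (intro nn_integral_mono) (auto simp: indicator_def)
  also have "\<dots> = (\<Sum>k. ennreal (\<mu> ^ k / fact k * exp (- \<mu>) * exp (\<theta> * real k - a)))"
    using assms by (simp add: nn_integral_measure_pmf nn_integral_count_space_nat pmf_poisson[OF assms] ennreal_mult'[symmetric])
  also have "\<dots> = ennreal (exp (\<mu> * (exp \<theta> - 1) - a))"
    using assms s by (intro suminf_ennreal_eq) auto
  finally show ?thesis by (simp add: measure_pmf.emeasure_eq_measure)
qed

locale complete_poisson_process = poisson_process M lam N + complete_prob_space M
  for M :: "'a measure" and lam N

sublocale complete_poisson_process \<subseteq> complete_levy_process M "\<lambda>t \<omega>. real (N t \<omega>)"
  by unfold_locales

context complete_poisson_process
begin

lemma measurable_N:
  assumes "0 \<le> t"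
  shows "N t \<in> measurable M (count_space UNIV)"
proof -
  have [measurable]: "(\<lambda>\<omega>. real (N t \<omega>)) \<in> borel_measurable M" by (rule measurable_X[OF assms])
  have "(\<lambda>\<omega>. nat \<lfloor>real (N t \<omega>)\<rfloor>) \<in> measurable M (count_space UNIV)" by measurable
  then show ?thesis by simp
qed

lemma sets_N:
  assumes "0 \<le> s" "0 \<le> t"
  shows "{\<omega>\<in>space M. P (N s \<omega>) (N t \<omega>)} \<in> events"
proof -
  note [measurable] = measurable_N[OF assms(1)] measurable_N[OF assms(2)]
  have "Measurable.pred M (\<lambda>\<omega>. P (N s \<omega>) (N t \<omega>))"
    by (rule measurable_compose_countable[where f="\<lambda>i \<omega>. P i (N t \<omega>)" and g="N s"]) measurable
  then show ?thesis by (simp add: pred_def)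
qed

lemma prob_N:
  assumes "0 < t"
  shows "prob {\<omega>\<in>space M. P (N t \<omega>)} = measure_pmf.prob (poisson_pmf (lam * t)) {k. P k}"
proof -
  have "prob {\<omega>\<in>space M. P (N t \<omega>)} = measure (distr M (count_space UNIV) (N t)) {k. P k}"
    using measurable_N[of t] assms by (subst measure_distr) (auto simp: vimage_def Int_def conj_commute)
  then show ?thesis using poisson_marginals[OF assms] by simp
qed

lemma prob_increment:
  assumes "0 \<le> s" "s \<le> t" and [measurable]: "Measurable.pred borel P"
  shows "prob {\<omega>\<in>space M. P (real (N t \<omega>) - real (N s \<omega>))} = prob {\<omega>\<in>space M. P (real (N (t - s) \<omega>))}"
proof -
  note [measurable] = measurable_N
  have "prob {\<omega>\<in>space M. P (real (N t \<omega>) - real (N s \<omega>))} = measure (distr M borel (\<lambda>\<omega>. real (N t \<omega>) - real (N s \<omega>))) {z. P z}"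
    using assms by (subst measure_distr) (auto simp: vimage_def Int_def conj_commute intro!: borel_measurable_diff measurable_X)
  also have "\<dots> = measure (distr M borel (\<lambda>\<omega>. real (N (t - s) \<omega>))) {z. P z}"
    using stationary_increments[OF assms(1,2)] by simp
  also have "\<dots> = prob {\<omega>\<in>space M. P (real (N (t - s) \<omega>))}"
    using assms by (subst measure_distr) (auto simp: vimage_def Int_def conj_commute intro!: measurable_X)
  finally show ?thesis .
qed

lemma prob_no_jump:
  assumes "0 \<le> s" "s \<le> t"
  shows "prob {\<omega>\<in>space M. N t \<omega> = N s \<omega>} = exp (- lam * (t - s))"
proof (cases "s = t")
  case False
  with assms have st: "0 < t - s" by simp
  have "prob {\<omega>\<in>space M. N t \<omega> = N s \<omega>} = prob {\<omega>\<in>space M. real (N t \<omega>) - real (N s \<omega>) = 0}" by simp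
  also have "\<dots> = prob {\<omega>\<in>space M. real (N (t - s) \<omega>) = 0}" by (rule prob_increment[OF assms]) simp
  also have "\<dots> = measure_pmf.prob (poisson_pmf (lam * (t - s))) {k. real k = 0}" by (rule prob_N[OF st])
  also have "{k. real k = 0} = {0}" by auto
  also have "measure_pmf.prob (poisson_pmf (lam * (t - s))) {0} = exp (- lam * (t - s))"
    using st rate_pos by (simp add: measure_pmf_single)
  finally show ?thesis .
qed (simp add: prob_space)

text \<open>Quadratic in the length of the interval, so that the sum over the cells of a mesh tends
  to 0.\<close>

lemma prob_two_jumps_le:
  assumes "0 \<le> s" "s < t"
  shows "prob {\<omega>\<in>space M. N s \<omega> + 2 \<le> N t \<omega>} \<le> (lam * (t - s))\<^sup>2"
proof -
  let ?\<mu> = "lam * (t - s)"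
  have \<mu>: "0 < ?\<mu>" using assms rate_pos by simp
  have "prob {\<omega>\<in>space M. N s \<omega> + 2 \<le> N t \<omega>} = prob {\<omega>\<in>space M. 2 \<le> real (N t \<omega>) - real (N s \<omega>)}"
    by (rule arg_cong[where f=prob]) auto
  also have "\<dots> = prob {\<omega>\<in>space M. 2 \<le> real (N (t - s) \<omega>)}" using assms by (intro prob_increment) auto
  also have "\<dots> = measure_pmf.prob (poisson_pmf ?\<mu>) {k. 2 \<le> real k}" using assms by (intro prob_N) auto
  also have "{k. 2 \<le> real k} = UNIV - {0, 1}" by auto
  also have "measure_pmf.prob (poisson_pmf ?\<mu>) (UNIV - {0, 1}) = 1 - measure_pmf.prob (poisson_pmf ?\<mu>) {0, 1}"
    using measure_pmf.prob_compl[of "{0, 1}" "poisson_pmf ?\<mu>"] by simp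
  also have "measure_pmf.prob (poisson_pmf ?\<mu>) {0, 1} = (1 + ?\<mu>) * exp (- ?\<mu>)"
    using \<mu> by (subst measure_measure_pmf_finite) (auto simp: algebra_simps)
  also have "1 - (1 + ?\<mu>) * exp (- ?\<mu>) \<le> ?\<mu>\<^sup>2"
  proof -
    have "(1 + ?\<mu>) * (1 - ?\<mu>) \<le> (1 + ?\<mu>) * exp (- ?\<mu>)"
      using exp_ge_add_one_self[of "- ?\<mu>"] \<mu> by (intro mult_left_mono) auto
    then show ?thesis by (simp add: algebra_simps power2_eq_square)
  qed
  finally show ?thesis .
qed

lemma chernoff:
  assumes "0 < t"
  shows "prob {\<omega>\<in>space M. a \<le> \<theta> * real (N t \<omega>)} \<le> exp (lam * t * (exp \<theta> - 1) - a)"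
  using prob_N[OF assms, of "\<lambda>k. a \<le> \<theta> * real k"] poisson_pmf_chernoff[of "lam * t" a \<theta>] assms rate_pos by simp

section \<open>Almost sure regularity of counting paths and jump times\<close>

lemma N_right_constant:
  assumes "\<omega> \<in> space M" "0 \<le> t"
  obtains e where "0 < e" "\<And>u. t \<le> u \<Longrightarrow> u < t + e \<Longrightarrow> N u \<omega> = N t \<omega>"
proof -
  have "((\<lambda>s. real (N s \<omega>)) \<longlongrightarrow> real (N t \<omega>)) (at_right t)"
    using cadlag_paths[OF assms(1)] assms(2) by (auto simp: cadlag_def)
  then have "eventually (\<lambda>s. dist (real (N s \<omega>)) (real (N t \<omega>)) < 1) (at_right t)"
    by (rule tendstoD) simp
  then obtain b where b: "t < b" "\<And>s. t < s \<Longrightarrow> s < b \<Longrightarrow> dist (real (N s \<omega>)) (real (N t \<omega>)) < 1"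
    unfolding eventually_at_right_field by auto
  have *: "N u \<omega> = N t \<omega>" if "t \<le> u" "u < t + (b - t)" for u
    using b(2)[of u] that by (cases "u = t") (auto simp: dist_real_def)
  show ?thesis by (rule that[of "b - t", OF _ *]) (use b(1) in auto)
qed

text \<open>For two fixed times the increment has the law of \<open>N (t - s)\<close>, which is
  nonnegative. Rational times suffice, since an integer-valued right-continuous path stays constant
  for a while after each time.\<close>

lemma AE_mono: "AE \<omega> in M. \<forall>s t. 0 \<le> s \<longrightarrow> s \<le> t \<longrightarrow> N s \<omega> \<le> N t \<omega>"
proof -
  have "AE \<omega> in M. N s \<omega> \<le> N t \<omega>" if "0 \<le> s" "s \<le> t" for s t
  proof -
    have "prob {\<omega>\<in>space M. real (N t \<omega>) - real (N s \<omega>) < 0} = prob {\<omega>\<in>space M. real (N (t - s) \<omega>) < 0}"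
      using that by (intro prob_increment) auto
    then have "prob {\<omega>\<in>space M. N t \<omega> < N s \<omega>} = 0" by simp
    moreover have "{\<omega>\<in>space M. N t \<omega> < N s \<omega>} \<in> events"
      using that by (intro sets_N) auto
    ultimately have "AE \<omega> in M. \<not> N t \<omega> < N s \<omega>" by (intro AE_I[where N="{\<omega>\<in>space M. N t \<omega> < N s \<omega>}"]) (auto simp: emeasure_eq_measure)
    then show ?thesis by eventually_elim simp
  qed
  then have "AE \<omega> in M. \<forall>s\<in>\<rat> \<inter> {0..}. \<forall>t\<in>\<rat> \<inter> {s..}. N s \<omega> \<le> N t \<omega>"
    by (intro AE_ball_countable' countable_Int1 countable_rat) auto
  then show ?thesis using AE_space
  proof eventually_elim
    case (elim \<omega>)
    have "N s \<omega> \<le> N t \<omega>" if "0 \<le> s" "s < t" for s t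
    proof -
      have "0 \<le> t" using that by simp
      obtain e where e: "0 < e" "\<And>u. s \<le> u \<Longrightarrow> u < s + e \<Longrightarrow> N u \<omega> = N s \<omega>"
        using N_right_constant[OF elim(2) \<open>0 \<le> s\<close>] by blast
      obtain e' where e': "0 < e'" "\<And>u. t \<le> u \<Longrightarrow> u < t + e' \<Longrightarrow> N u \<omega> = N t \<omega>"
        using N_right_constant[OF elim(2) \<open>0 \<le> t\<close>] by blast
      have "s < min t (s + e)" using that e by simp
      from Rats_dense_in_real[OF this] obtain p where p: "p \<in> \<rat>" "s < p" "p < min t (s + e)" by blast
      obtain p' where p': "p' \<in> \<rat>" "t < p'" "p' < t + e'" using Rats_dense_in_real[of t "t + e'"] e' by auto
      have "N p \<omega> \<le> N p' \<omega>" using elim(1) p p' that by auto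
      then show ?thesis using e(2)[of p] e'(2)[of p'] p p' by auto
    qed
    then show ?case by (metis order_le_less order_refl)
  qed
qed

text \<open>For a fixed level, the Chernoff bound with \<open>\<theta> = - 1\<close> tends to 0
  along the integer times.\<close>

lemma AE_unbounded: "AE \<omega> in M. \<forall>k. \<exists>t\<ge>0. k \<le> N t \<omega>"
proof -
  have "AE \<omega> in M. \<exists>t\<ge>0. k \<le> N t \<omega>" for k
  proof -
    let ?A = "\<Inter>m. {\<omega>\<in>space M. N (real (Suc m)) \<omega> < k}"
    have [measurable]: "{\<omega>\<in>space M. N (real (Suc m)) \<omega> < k} \<in> events" for m
      using measurable_N[of "real (Suc m)"] by measurable
    have "prob ?A \<le> exp (lam * real (Suc m) * (exp (- 1) - 1) - (- real k))" for m
    proof -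
      have "prob ?A \<le> prob {\<omega>\<in>space M. - real k \<le> - 1 * real (N (real (Suc m)) \<omega>)}"
        by (intro finite_measure_mono sets_N[of "real (Suc m)" "real (Suc m)" "\<lambda>_ i. - real k \<le> - 1 * real i"])
          (auto simp del: of_nat_Suc intro: less_imp_le)
      also have "\<dots> \<le> exp (lam * real (Suc m) * (exp (- 1) - 1) - (- real k))" by (rule chernoff) simp
      finally show ?thesis .
    qed
    moreover have "(\<lambda>m. exp (lam * real (Suc m) * (exp (- 1) - 1) - (- real k))) \<longlonglongrightarrow> 0"
    proof (rule filterlim_compose[OF exp_at_bot])
      have "filterlim (\<lambda>m. real (Suc m) * (lam * (exp (- 1) - 1))) at_bot sequentially"
        unfolding mult.commute[of "real (Suc _)"]
        using rate_pos by (intro filterlim_tendsto_neg_mult_at_bot[OF tendsto_const]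
            filterlim_compose[OF filterlim_real_sequentially filterlim_Suc]) (auto simp: mult_pos_neg)
      then have "filterlim (\<lambda>m. - (real (Suc m) * (lam * (exp (- 1) - 1)))) at_top sequentially"
        by (simp add: filterlim_uminus_at_bot)
      then have "filterlim (\<lambda>m. - real k + - (real (Suc m) * (lam * (exp (- 1) - 1)))) at_top sequentially"
        by (intro filterlim_tendsto_add_at_top[OF tendsto_const])
      then have "filterlim (\<lambda>m. - (- real k + - (real (Suc m) * (lam * (exp (- 1) - 1))))) at_bot sequentially"
        by (simp only: filterlim_uminus_at_top minus_minus)
      then show "filterlim (\<lambda>m. lam * real (Suc m) * (exp (- 1) - 1) - (- real k)) at_bot sequentially"
        by (simp add: algebra_simps)
    qed
    ultimately have "prob ?A \<le> 0" by (intro LIMSEQ_le_const) auto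
    then have "prob ?A = 0" by (simp add: measure_le_0_iff)
    moreover have "?A \<in> events" by measurable
    ultimately have "AE \<omega> in M. \<omega> \<notin> ?A" by (intro AE_not_in null_setsI) (auto simp: emeasure_eq_measure)
    then show ?thesis using AE_space
    proof eventually_elim
      case (elim \<omega>)
      then obtain m where "k \<le> N (real (Suc m)) \<omega>" by (auto simp: not_less)
      then show ?case by (intro exI[of _ "real (Suc m)"]) auto
    qed
  qed
  then show ?thesis by (simp add: AE_all_countable)
qed

text \<open>The infimum is attained because the path stays constant just after \<open>t\<close>: a
  level missed at \<open>t\<close> is missed up to some \<open>t + e\<close>.\<close>

lemma jump_time_le_iff:
  assumes "\<omega> \<in> space M" and mono: "\<And>s t. 0 \<le> s \<Longrightarrow> s \<le> t \<Longrightarrow> N s \<omega> \<le> N t \<omega>" and "0 \<le> t"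
  shows "jump_time N k \<omega> \<le> ennreal t \<longleftrightarrow> k \<le> N t \<omega>"
proof (cases "k = 0")
  case False
  let ?S = "{ennreal t | t. 0 \<le> t \<and> N t \<omega> \<ge> k}"
  have J: "jump_time N k \<omega> = Inf ?S" using False by (simp add: jump_time_def)
  show ?thesis
  proof
    assume "k \<le> N t \<omega>" then show "jump_time N k \<omega> \<le> ennreal t" unfolding J using \<open>0 \<le> t\<close> by (intro Inf_lower) auto
  next
    assume le: "jump_time N k \<omega> \<le> ennreal t"
    show "k \<le> N t \<omega>"
    proof (rule ccontr)
      assume "\<not> k \<le> N t \<omega>"
      obtain e where e: "0 < e" "\<And>u. t \<le> u \<Longrightarrow> u < t + e \<Longrightarrow> N u \<omega> = N t \<omega>"
        using N_right_constant[OF assms(1,3)] by auto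
      have "t + e \<le> s" if "0 \<le> s" "k \<le> N s \<omega>" for s
      proof (rule ccontr)
        assume "\<not> t + e \<le> s"
        then have "N s \<omega> \<le> N t \<omega>" using e(2)[of s] mono[of s t] that by (cases "s \<le> t") auto
        then show False using that \<open>\<not> k \<le> N t \<omega>\<close> by simp
      qed
      then have "ennreal (t + e) \<le> jump_time N k \<omega>"
        unfolding J by (intro Inf_greatest) (auto intro!: ennreal_leI)
      from order_trans[OF this le] have "ennreal (t + e) \<le> ennreal t" .
      then show False using e(1) \<open>0 \<le> t\<close> by simp
    qed
  qed
qed (simp add: jump_time_def)

text \<open>
  A simultaneous double jump forces, for every mesh, an increment of at least \<open>2\<close> over some cell
  of the mesh, an event whose probability is of the order of the mesh size.
\<close>

lemma AE_jump_time_less_Suc: "AE \<omega> in M. \<forall>i. jump_time N i \<omega> < jump_time N (Suc i) \<omega>"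
proof -
  define D where "D m = 1 / real (Suc m)" for m
  have D: "0 < D m" for m by (simp add: D_def)
  \<comment> \<open>\<open>L\<close> bounds the times considered and \<open>D m\<close> is the mesh;
    on \<open>E L m\<close> some cell has an increment of at least 2.\<close>
  define E where "E L m = (\<Union>a<L * Suc m. {\<omega>\<in>space M. N (real a * D m) \<omega> + 2 \<le> N (real (Suc a) * D m) \<omega>})" for L m :: nat
  have ev: "{\<omega>\<in>space M. N (real a * D m) \<omega> + 2 \<le> N (real (Suc a) * D m) \<omega>} \<in> events" for a m
    using D[of m] by (intro sets_N) auto
  have [measurable]: "E L m \<in> events" for L m unfolding E_def using ev by auto
  have E_le: "prob (E L m) \<le> real L * lam\<^sup>2 / real (Suc m)" for L m
  proof -
    have "prob (E L m) \<le> (\<Sum>a<L * Suc m. prob {\<omega>\<in>space M. N (real a * D m) \<omega> + 2 \<le> N (real (Suc a) * D m) \<omega>})"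
      unfolding E_def using ev by (intro finite_measure_subadditive_finite) auto
    also have "\<dots> \<le> (\<Sum>a<L * Suc m. (lam * D m)\<^sup>2)"
    proof (rule sum_mono)
      fix a
      show "prob {\<omega>\<in>space M. N (real a * D m) \<omega> + 2 \<le> N (real (Suc a) * D m) \<omega>} \<le> (lam * D m)\<^sup>2"
        using prob_two_jumps_le[of "real a * D m" "real (Suc a) * D m"] D[of m] by (simp add: algebra_simps)
    qed
    also have "\<dots> = real L * real (Suc m) * (lam * (1 / real (Suc m)))\<^sup>2"
      by (simp only: sum_constant card_lessThan of_nat_mult D_def)
    also have "\<dots> = real L * lam\<^sup>2 / real (Suc m)" by (simp add: power2_eq_square field_simps del: of_nat_Suc)
    finally show ?thesis .
  qed
  have "AE \<omega> in M. \<exists>m. \<omega> \<notin> E L m" for L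
  proof -
    have "prob (\<Inter>m. E L m) \<le> real L * lam\<^sup>2 / real (Suc m)" for m
      by (rule order_trans[OF finite_measure_mono E_le]) auto
    moreover have "(\<lambda>m. real L * lam\<^sup>2 / real (Suc m)) \<longlonglongrightarrow> 0"
      by (intro real_tendsto_divide_at_top[OF tendsto_const] filterlim_compose[OF filterlim_real_sequentially filterlim_Suc])
    ultimately have "prob (\<Inter>m. E L m) \<le> 0" by (intro LIMSEQ_le_const) auto
    then have "AE \<omega> in M. \<omega> \<notin> (\<Inter>m. E L m)"
      by (intro AE_not_in) (auto simp: null_sets_def emeasure_eq_measure measure_le_0_iff)
    then show ?thesis by eventually_elim auto
  qed
  then have "AE \<omega> in M. \<forall>L. \<exists>m. \<omega> \<notin> E L m" by (simp add: AE_all_countable)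
  with AE_mono AE_unbounded start AE_space show ?thesis
  proof eventually_elim
    case (elim \<omega>)
    have le_iff: "jump_time N k \<omega> \<le> ennreal t \<longleftrightarrow> k \<le> N t \<omega>" if "0 \<le> t" for k t
    by (rule jump_time_le_iff) (use elim that in auto)
    show ?case
    proof
      fix i
      have le: "jump_time N i \<omega> \<le> jump_time N (Suc i) \<omega>"
        by (auto simp: jump_time_def intro!: Inf_superset_mono)
      have "jump_time N i \<omega> \<noteq> jump_time N (Suc i) \<omega>"
      proof
        assume eq: "jump_time N i \<omega> = jump_time N (Suc i) \<omega>"
        obtain t where t: "0 \<le> t" "Suc i \<le> N t \<omega>" using elim(2) by blast
        obtain L where "t \<le> real L" using real_arch_simple by blast
        then have L: "Suc i \<le> N (real L) \<omega>" using t elim(1) by (meson order_trans)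
        obtain m where m: "\<omega> \<notin> E L m" using elim(5) by blast
        \<comment> \<open>The first grid point at level \<open>i + 1\<close>. If the two jump times
          agree, the grid point before it has not even reached level \<open>i\<close>, so the
          increment between them is at least 2.\<close>
        define c where "c = (LEAST c. Suc i \<le> N (real c * D m) \<omega>)"
        have Lm: "real (L * Suc m) * D m = real L" by (simp add: D_def field_simps)
        have c: "Suc i \<le> N (real c * D m) \<omega>" unfolding c_def by (rule LeastI[of _ "L * Suc m"]) (use L Lm in simp)
        have cle: "c \<le> L * Suc m" unfolding c_def by (rule Least_le) (use L Lm in simp)
        have "c \<noteq> 0" using c elim(3) by (intro notI) simp
        then obtain a where a: "c = Suc a" by (cases c) auto
        have "\<not> Suc i \<le> N (real a * D m) \<omega>"
          using not_less_Least[of a "\<lambda>c. Suc i \<le> N (real c * D m) \<omega>"] a by (simp add: c_def)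
        then have "\<not> i \<le> N (real a * D m) \<omega>"
          using le_iff[of "real a * D m" i] le_iff[of "real a * D m" "Suc i"] eq D[of m] by simp
        then have "N (real a * D m) \<omega> + 2 \<le> N (real (Suc a) * D m) \<omega>" using c a by simp
        then have "\<omega> \<in> E L m" using a cle elim(4) unfolding E_def by auto
        then show False using m by simp
      qed
      then show "jump_time N i \<omega> < jump_time N (Suc i) \<omega>" using le by simp
    qed
  qed
qed

text \<open>The \<open>k\<close>-th jump time as a real number; junk value \<open>0\<close> if it is infinite.\<close>

definition T :: "nat \<Rightarrow> 'a \<Rightarrow> real" where "T k \<omega> = enn2real (jump_time N k \<omega>)"

text \<open>The almost sure path properties used from here on, gathered into one event: finite,
  strictly increasing jump times that are inverse to the counts.\<close>

definition regular :: "'a \<Rightarrow> bool" where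
  "regular \<omega> \<longleftrightarrow> \<omega> \<in> space M \<and> (\<forall>k. jump_time N k \<omega> = ennreal (T k \<omega>)) \<and>
     (\<forall>k t. 0 \<le> t \<longrightarrow> (T k \<omega> \<le> t \<longleftrightarrow> k \<le> N t \<omega>)) \<and> (\<forall>k. T k \<omega> < T (Suc k) \<omega>)"

lemma AE_regular: "AE \<omega> in M. regular \<omega>"
  using AE_mono AE_unbounded AE_jump_time_less_Suc AE_space
proof eventually_elim
  case (elim \<omega>)
  have le_iff: "jump_time N k \<omega> \<le> ennreal t \<longleftrightarrow> k \<le> N t \<omega>" if "0 \<le> t" for k t
    by (rule jump_time_le_iff) (use elim that in auto)
  have J: "jump_time N k \<omega> = ennreal (T k \<omega>)" for k
  proof -
    obtain t where "0 \<le> t" "k \<le> N t \<omega>" using elim(2) by blast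
    then have "jump_time N k \<omega> \<le> ennreal t" using le_iff by simp
    then show ?thesis unfolding T_def by (metis ennreal_enn2real ennreal_less_top le_less_trans)
  qed
  have "T k \<omega> < T (Suc k) \<omega>" for k
    using elim(3) unfolding J by (metis T_def enn2real_nonneg ennreal_less_iff)
  moreover have "T k \<omega> \<le> t \<longleftrightarrow> k \<le> N t \<omega>" if "0 \<le> t" for k t
    using le_iff[OF that, of k] that unfolding J by simp
  ultimately show ?case using J elim(4) by (simp add: regular_def)
qed

lemma T_nonneg: "0 \<le> T k \<omega>" by (simp add: T_def)

lemma T_0: "T 0 \<omega> = 0" by (simp add: T_def jump_time_def)

lemma regularD:
  assumes "regular \<omega>"
  shows "\<omega> \<in> space M" "jump_time N k \<omega> = ennreal (T k \<omega>)" "0 \<le> t \<Longrightarrow> T k \<omega> \<le> t \<longleftrightarrow> k \<le> N t \<omega>"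
    "T k \<omega> < T (Suc k) \<omega>" "strict_mono (\<lambda>k. T k \<omega>)" "N (T k \<omega>) \<omega> = k"
proof -
  show *: "\<omega> \<in> space M" "jump_time N k \<omega> = ennreal (T k \<omega>)" "0 \<le> t \<Longrightarrow> T k \<omega> \<le> t \<longleftrightarrow> k \<le> N t \<omega>" "T k \<omega> < T (Suc k) \<omega>" for k t
    using assms by (auto simp: regular_def)
  show "strict_mono (\<lambda>k. T k \<omega>)" by (simp add: strict_mono_Suc_iff *)
  show "N (T k \<omega>) \<omega> = k"
    using *(3)[OF T_nonneg, of k k \<omega>] *(3)[OF T_nonneg, of "Suc k" k \<omega>] *(4)[of k] by simp
qed

lemma regular_N_mono: "regular \<omega> \<Longrightarrow> 0 \<le> s \<Longrightarrow> s \<le> t \<Longrightarrow> N s \<omega> \<le> N t \<omega>"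
  using regularD(3)[of \<omega> s "N s \<omega>"] regularD(3)[of \<omega> t "N s \<omega>"] by simp

end

text \<open>The product \<open>(1 - z + z\<^sup>2) * (1 + z)\<close> is \<open>1 + z ^ 3\<close>,
  hence at least 1, and \<open>exp (- z)\<close> is at most \<open>1 / (1 + z)\<close>.\<close>

lemma exp_minus_upper:
  assumes "0 \<le> (z :: real)"
  shows "exp (- z) \<le> 1 - z + z\<^sup>2"
proof -
  have "1 \<le> (1 - z + z\<^sup>2) * (1 + z)" using assms by (simp add: algebra_simps power2_eq_square)
  then have "1 / (1 + z) \<le> 1 - z + z\<^sup>2" using assms by (simp add: divide_le_eq)
  moreover have "exp (- z) \<le> 1 / (1 + z)"
    using exp_ge_add_one_self[of z] assms by (simp add: exp_minus inverse_eq_divide frac_le)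
  ultimately show ?thesis by simp
qed

lemma jump_time_LLN:
  fixes N :: "nat \<Rightarrow> real \<Rightarrow> 'a \<Rightarrow> nat"
  assumes P: "\<And>n. 1 \<le> n \<Longrightarrow> complete_poisson_process M (real n) (N n)"
    and k: "(\<lambda>n. real (k n) / real n) \<longlonglongrightarrow> \<tau>" and "0 \<le> \<tau>"
  shows "AE \<omega> in M. (\<lambda>n. complete_poisson_process.T (N n) (k n) \<omega>) \<longlonglongrightarrow> \<tau>"
proof -
  interpret P1: complete_poisson_process M "real 1" "N 1" by (rule P) simp
  let ?T = "\<lambda>n. complete_poisson_process.T (N n)"
  have reg: "AE \<omega> in M. \<forall>n. complete_poisson_process.regular M (N (Suc n)) \<omega>"
    using complete_poisson_process.AE_regular[OF P[of "Suc n" for n]] by (simp add: AE_all_countable)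
  have tail: "AE \<omega> in M. eventually (\<lambda>n. \<bar>?T (Suc n) (k (Suc n)) \<omega> - \<tau>\<bar> \<le> \<epsilon>) sequentially" if "0 < \<epsilon>" for \<epsilon>
  proof -
    \<comment> \<open>This \<open>\<eta>\<close> makes the quadratic error
      \<open>(\<tau> + \<epsilon>) * \<eta>\<^sup>2\<close> equal to
      \<open>\<eta> * \<epsilon> / 4\<close>. As \<open>k\<close> is eventually within
      \<open>n * \<epsilon> / 2\<close> of \<open>n * \<tau>\<close>, the exponent keeps a decay of
      \<open>\<eta> * \<epsilon> / 4\<close> per unit of \<open>n\<close>.\<close>
    define \<eta> where "\<eta> = \<epsilon> / (4 * (\<tau> + \<epsilon>))"
    have \<eta>: "0 < \<eta>" "\<eta> \<le> 1" "(\<tau> + \<epsilon>) * \<eta> = \<epsilon> / 4" using that \<open>0 \<le> \<tau>\<close> by (auto simp: \<eta>_def field_simps)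
    \<comment> \<open>\<open>A\<close> contains the paths whose \<open>k\<close>-th jump comes after
      \<open>\<tau> + \<epsilon>\<close>, \<open>B\<close> those that have it by
      \<open>\<tau> - \<epsilon>\<close>; both are scaled by \<open>\<eta>\<close> to fit the
      Chernoff bound. For \<open>\<tau> \<le> \<epsilon>\<close> the lower estimate is trivial since
      jump times are nonnegative.\<close>
    define A where "A n = {\<omega>\<in>space M. - \<eta> * real (k (Suc n)) \<le> - \<eta> * real (N (Suc n) (\<tau> + \<epsilon>) \<omega>)}" for n
    define B where "B n = (if \<tau> \<le> \<epsilon> then {} else {\<omega>\<in>space M. \<eta> * real (k (Suc n)) \<le> \<eta> * real (N (Suc n) (\<tau> - \<epsilon>) \<omega>)})" for n
    have Aev: "A n \<in> P1.events" for n
      unfolding A_def using \<open>0 \<le> \<tau>\<close> that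
      by (intro complete_poisson_process.sets_N[OF P, of "Suc n" "\<tau> + \<epsilon>" "\<tau> + \<epsilon>" "\<lambda>_ i. - \<eta> * real (k (Suc n)) \<le> - \<eta> * real i"]) auto
    have Bev: "B n \<in> P1.events" for n
    proof (cases "\<tau> \<le> \<epsilon>")
      case False
      then show ?thesis unfolding B_def if_not_P[OF False]
        by (intro complete_poisson_process.sets_N[OF P, of "Suc n" "\<tau> - \<epsilon>" "\<tau> - \<epsilon>" "\<lambda>_ i. \<eta> * real (k (Suc n)) \<le> \<eta> * real i"]) auto
    qed (simp add: B_def)
    define q where "q = exp (- (\<eta> * \<epsilon> / 4))"
    have q: "0 \<le> q" "q < 1" using \<eta> that by (auto simp: q_def)
    have k': "(\<lambda>n. real (k (Suc n)) / real (Suc n)) \<longlonglongrightarrow> \<tau>" using k by (rule LIMSEQ_Suc)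
    have qpow: "exp (real (Suc n) * (- (\<eta> * \<epsilon> / 4))) \<le> q ^ n" for n
    proof -
      have "exp (real (Suc n) * (- (\<eta> * \<epsilon> / 4))) = q ^ Suc n" unfolding q_def by (simp only: exp_of_nat_mult)
      then show ?thesis using q by (simp add: mult_left_le_one_le)
    qed
    have expup: "exp (- \<eta>) - 1 \<le> - \<eta> + \<eta>\<^sup>2"
      using exp_minus_upper[of \<eta>] \<eta>(1) by simp
    have exup: "exp \<eta> - 1 \<le> \<eta> + \<eta>\<^sup>2" using exp_bound[of \<eta>] \<eta> by simp
    have evA: "eventually (\<lambda>n. P1.prob (A n) \<le> q ^ n) sequentially"
    proof -
      have "eventually (\<lambda>n. real (k (Suc n)) / real (Suc n) < \<tau> + \<epsilon> / 2) sequentially"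
        using k' that by (intro order_tendstoD) auto
      then show ?thesis
      proof eventually_elim
        case (elim n)
        then have kn: "real (k (Suc n)) \<le> real (Suc n) * (\<tau> + \<epsilon> / 2)" by (simp add: field_simps)
        have "P1.prob (A n) \<le> exp (real (Suc n) * (\<tau> + \<epsilon>) * (exp (- \<eta>) - 1) - (- \<eta> * real (k (Suc n))))"
          unfolding A_def using \<open>0 \<le> \<tau>\<close> that by (intro complete_poisson_process.chernoff P) auto
        also have "\<dots> \<le> exp (real (Suc n) * (- (\<eta> * \<epsilon> / 4)))"
        proof -
          have "real (Suc n) * (\<tau> + \<epsilon>) * (exp (- \<eta>) - 1) \<le> real (Suc n) * (\<tau> + \<epsilon>) * (- \<eta> + \<eta>\<^sup>2)"
            using expup \<open>0 \<le> \<tau>\<close> that by (intro mult_left_mono) auto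
          also have "(\<tau> + \<epsilon>) * (- \<eta> + \<eta>\<^sup>2) = - \<eta> * (\<tau> + \<epsilon>) + \<eta> * ((\<tau> + \<epsilon>) * \<eta>)" by (simp add: algebra_simps power2_eq_square)
          then have "real (Suc n) * (\<tau> + \<epsilon>) * (- \<eta> + \<eta>\<^sup>2) = real (Suc n) * (- \<eta> * (\<tau> + \<epsilon>) + \<eta> * (\<epsilon> / 4))"
            unfolding \<eta>(3) by (simp add: mult.assoc)
          finally have "real (Suc n) * (\<tau> + \<epsilon>) * (exp (- \<eta>) - 1) \<le> real (Suc n) * (- \<eta> * (\<tau> + \<epsilon>) + \<eta> * (\<epsilon> / 4))" .
          moreover have "\<eta> * real (k (Suc n)) \<le> \<eta> * (real (Suc n) * (\<tau> + \<epsilon> / 2))" using kn \<eta> by (intro mult_left_mono) auto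
          moreover have "real (Suc n) * (- \<eta> * (\<tau> + \<epsilon>) + \<eta> * (\<epsilon> / 4)) + \<eta> * (real (Suc n) * (\<tau> + \<epsilon> / 2)) = real (Suc n) * (- (\<eta> * \<epsilon> / 4))"
            by (simp add: field_simps del: of_nat_Suc)
          ultimately show ?thesis unfolding exp_le_cancel_iff by linarith
        qed
        also have "\<dots> \<le> q ^ n" by (rule qpow)
        finally show ?case .
      qed
    qed
    have evB: "eventually (\<lambda>n. P1.prob (B n) \<le> q ^ n) sequentially"
    proof (cases "\<tau> \<le> \<epsilon>")
      case False
      have "eventually (\<lambda>n. \<tau> - \<epsilon> / 2 < real (k (Suc n)) / real (Suc n)) sequentially"
        using k' that by (intro order_tendstoD) auto
      then show ?thesis
      proof eventually_elim
        case (elim n)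
        then have kn: "real (Suc n) * (\<tau> - \<epsilon> / 2) \<le> real (k (Suc n))" by (simp add: field_simps)
        have "P1.prob (B n) \<le> exp (real (Suc n) * (\<tau> - \<epsilon>) * (exp \<eta> - 1) - \<eta> * real (k (Suc n)))"
          unfolding B_def using False by (auto intro!: complete_poisson_process.chernoff P simp del: of_nat_Suc)
        also have "\<dots> \<le> exp (real (Suc n) * (- (\<eta> * \<epsilon> / 4)))"
        proof -
          have "real (Suc n) * (\<tau> - \<epsilon>) * (exp \<eta> - 1) \<le> real (Suc n) * (\<tau> - \<epsilon>) * (\<eta> + \<eta>\<^sup>2)"
            using exup False by (intro mult_left_mono) auto
          also have "(\<tau> - \<epsilon>) * (\<eta> + \<eta>\<^sup>2) \<le> \<eta> * (\<tau> - \<epsilon>) + \<eta> * ((\<tau> + \<epsilon>) * \<eta>)" using that by (simp add: algebra_simps power2_eq_square)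
          then have "real (Suc n) * (\<tau> - \<epsilon>) * (\<eta> + \<eta>\<^sup>2) \<le> real (Suc n) * (\<eta> * (\<tau> - \<epsilon>) + \<eta> * (\<epsilon> / 4))"
            unfolding \<eta>(3) mult.assoc by (intro mult_left_mono) auto
          finally have "real (Suc n) * (\<tau> - \<epsilon>) * (exp \<eta> - 1) \<le> real (Suc n) * (\<eta> * (\<tau> - \<epsilon>) + \<eta> * (\<epsilon> / 4))" .
          moreover have "\<eta> * (real (Suc n) * (\<tau> - \<epsilon> / 2)) \<le> \<eta> * real (k (Suc n))" using kn \<eta> by (intro mult_left_mono) auto
          moreover have "real (Suc n) * (\<eta> * (\<tau> - \<epsilon>) + \<eta> * (\<epsilon> / 4)) - \<eta> * (real (Suc n) * (\<tau> - \<epsilon> / 2)) = real (Suc n) * (- (\<eta> * \<epsilon> / 4))"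
            by (simp add: field_simps del: of_nat_Suc)
          ultimately show ?thesis unfolding exp_le_cancel_iff by linarith
        qed
        also have "\<dots> \<le> q ^ n" by (rule qpow)
        finally show ?case .
      qed
    qed (simp add: B_def q)
    have summ: "summable (\<lambda>n. P1.prob (C n))" if "eventually (\<lambda>n. P1.prob (C n) \<le> q ^ n) sequentially" for C
      by (rule summable_comparison_test_ev[of _ "\<lambda>n. q ^ n"]) (use that q in \<open>auto intro: summable_geometric\<close>)
    have "AE \<omega> in M. eventually (\<lambda>n. \<omega> \<in> space M - A n) sequentially"
      by (rule borel_cantelli_AE1[OF Aev]) (auto intro: summ evA simp: P1.emeasure_eq_measure)
    moreover have "AE \<omega> in M. eventually (\<lambda>n. \<omega> \<in> space M - B n) sequentially"
      by (rule borel_cantelli_AE1[OF Bev]) (auto intro: summ evB simp: P1.emeasure_eq_measure)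
    ultimately show ?thesis using reg
    proof eventually_elim
      case (elim \<omega>)
      from elim(1,2) show ?case
      proof eventually_elim
        case (elim n)
        have reg: "complete_poisson_process.regular M (N (Suc n)) \<omega>" using \<open>\<forall>n. complete_poisson_process.regular M (N (Suc n)) \<omega>\<close> by blast
        have le: "?T (Suc n) (k (Suc n)) \<omega> \<le> t \<longleftrightarrow> k (Suc n) \<le> N (Suc n) t \<omega>" if "0 \<le> t" for t
          using complete_poisson_process.regularD(3)[OF P reg that] by simp
        have "?T (Suc n) (k (Suc n)) \<omega> \<le> \<tau> + \<epsilon>"
          using elim(1) \<eta>(1) \<open>0 \<le> \<tau>\<close> that by (subst le) (auto simp: A_def)
        moreover have "\<tau> - \<epsilon> \<le> ?T (Suc n) (k (Suc n)) \<omega>"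
        proof (cases "\<tau> \<le> \<epsilon>")
          case True
          then have "\<tau> - \<epsilon> \<le> 0" by simp
          also have "0 \<le> ?T (Suc n) (k (Suc n)) \<omega>" by (rule complete_poisson_process.T_nonneg[OF P]) simp
          finally show ?thesis .
        next
          case False
          then have "\<not> k (Suc n) \<le> N (Suc n) (\<tau> - \<epsilon>) \<omega>" using elim(2) \<eta>(1) by (auto simp: B_def)
          then show ?thesis using le[of "\<tau> - \<epsilon>"] False by auto
        qed
        ultimately show ?case by linarith
      qed
    qed
  qed
  have "AE \<omega> in M. \<forall>j. eventually (\<lambda>n. \<bar>?T (Suc n) (k (Suc n)) \<omega> - \<tau>\<bar> \<le> 1 / real (Suc j)) sequentially"
    unfolding AE_all_countable by (intro allI tail) simp
  then show ?thesis
  proof eventually_elim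
    case (elim \<omega>)
    have "(\<lambda>n. ?T (Suc n) (k (Suc n)) \<omega>) \<longlonglongrightarrow> \<tau>"
    proof (rule tendstoI)
      fix e :: real assume "0 < e"
      then obtain j where "1 / real (Suc j) < e" using nat_approx_posE by blast
      with elim[rule_format, of j] show "eventually (\<lambda>n. dist (?T (Suc n) (k (Suc n)) \<omega>) \<tau> < e) sequentially"
        by (auto simp: dist_real_def elim: eventually_mono)
    qed
    then show ?case by (rule LIMSEQ_imp_Suc)
  qed
qed

subsection \<open>Evaluation at exponential times\<close>

lemma (in prob_space) exponential_cell:
  assumes D: "distributed M lborel \<xi> (exponential_density l)" and "0 < l" "0 \<le> a" "a \<le> b"
  shows "prob {\<omega>\<in>space M. a < \<xi> \<omega> \<and> \<xi> \<omega> \<le> b} = exp (- l * a) - exp (- l * b)"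
proof -
  have [measurable]: "\<xi> \<in> borel_measurable M" using distributed_measurable[OF D] by simp
  have "{\<omega>\<in>space M. \<xi> \<omega> \<le> b} \<in> events" "{\<omega>\<in>space M. \<xi> \<omega> \<le> a} \<in> events" by measurable
  then have "prob ({\<omega>\<in>space M. \<xi> \<omega> \<le> b} - {\<omega>\<in>space M. \<xi> \<omega> \<le> a}) = prob {\<omega>\<in>space M. \<xi> \<omega> \<le> b} - prob {\<omega>\<in>space M. \<xi> \<omega> \<le> a}"
    using \<open>a \<le> b\<close> by (intro finite_measure_Diff) auto
  moreover have "{\<omega>\<in>space M. \<xi> \<omega> \<le> b} - {\<omega>\<in>space M. \<xi> \<omega> \<le> a} = {\<omega>\<in>space M. a < \<xi> \<omega> \<and> \<xi> \<omega> \<le> b}" by auto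
  ultimately have "prob {\<omega>\<in>space M. a < \<xi> \<omega> \<and> \<xi> \<omega> \<le> b} = prob {\<omega>\<in>space M. \<xi> \<omega> \<le> b} - prob {\<omega>\<in>space M. \<xi> \<omega> \<le> a}"
    by simp
  then show ?thesis
    using exponential_distributedD_le[OF D, of a] exponential_distributedD_le[OF D, of b] assms by (simp add: mult.commute)
qed

lemma distributed_ident: "0 < l \<Longrightarrow> distributed (density lborel (exponential_density l)) lborel (\<lambda>s. s) (exponential_density l)"
  unfolding distributed_def by (auto simp: distr_id2)

lemma exponential_AE_pos: "AE s in density lborel (exponential_density l). 0 < s"
proof -
  have "AE s in lborel. s \<noteq> (0 :: real)" by (rule AE_lborel_singleton)
  then show ?thesis by (subst AE_density) (auto simp: exponential_density_def elim!: eventually_mono)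
qed

lemma (in prob_space) exponential_distributed_AE_pos:
  assumes D: "distributed M lborel \<xi> (exponential_density l)"
  shows "AE \<omega> in M. 0 < \<xi> \<omega>"
proof -
  have m: "\<xi> \<in> measurable M lborel" using distributed_measurable[OF D] .
  have "AE s in distr M lborel \<xi>. 0 < s"
    by (subst distributed_distr_eq_density[OF D]) (rule exponential_AE_pos)
  then show ?thesis using m by (subst (asm) AE_distr_iff) auto
qed

text \<open>Rounding up to the right end of a left-open cell never gives an earlier time, as
  right-continuous paths require.\<close>

lemma ceiling_cell:
  assumes "0 < \<delta>" "0 < s"
  shows "nat (\<lceil>s / \<delta>\<rceil> - 1) = j \<longleftrightarrow> real j * \<delta> < s \<and> s \<le> (real j + 1) * \<delta>"
    and "(real (nat (\<lceil>s / \<delta>\<rceil> - 1)) + 1) * \<delta> = \<delta> * of_int \<lceil>s / \<delta>\<rceil>"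
proof -
  have "0 < s / \<delta>" using assms by simp
  then have c: "1 \<le> \<lceil>s / \<delta>\<rceil>" by simp
  have "nat (\<lceil>s / \<delta>\<rceil> - 1) = j \<longleftrightarrow> \<lceil>s / \<delta>\<rceil> = int j + 1" using c by auto
  also have "\<dots> \<longleftrightarrow> real j < s / \<delta> \<and> s / \<delta> \<le> real j + 1"
    by (simp add: ceiling_eq_iff)
  also have "\<dots> \<longleftrightarrow> real j * \<delta> < s \<and> s \<le> (real j + 1) * \<delta>"
    using assms by (simp add: pos_less_divide_eq pos_divide_le_eq)
  finally show "nat (\<lceil>s / \<delta>\<rceil> - 1) = j \<longleftrightarrow> real j * \<delta> < s \<and> s \<le> (real j + 1) * \<delta>" .
  have "real (nat (\<lceil>s / \<delta>\<rceil> - 1)) = of_int \<lceil>s / \<delta>\<rceil> - 1" using c by simp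
  then show "(real (nat (\<lceil>s / \<delta>\<rceil> - 1)) + 1) * \<delta> = \<delta> * of_int \<lceil>s / \<delta>\<rceil>" by simp
qed

lemma ceiling_grid_bounds:
  assumes "0 < (\<delta> :: real)"
  shows "s \<le> \<delta> * of_int \<lceil>s / \<delta>\<rceil>" "\<delta> * of_int \<lceil>s / \<delta>\<rceil> \<le> s + \<delta>"
proof -
  have "s / \<delta> \<le> of_int \<lceil>s / \<delta>\<rceil>" "of_int \<lceil>s / \<delta>\<rceil> \<le> s / \<delta> + 1" by linarith+
  then have "\<delta> * (s / \<delta>) \<le> \<delta> * of_int \<lceil>s / \<delta>\<rceil>" "\<delta> * of_int \<lceil>s / \<delta>\<rceil> \<le> \<delta> * (s / \<delta> + 1)"
    using assms by (blast intro: mult_left_mono less_imp_le)+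
  moreover have "\<delta> * (s / \<delta>) = s" using assms by simp
  ultimately show "s \<le> \<delta> * of_int \<lceil>s / \<delta>\<rceil>" "\<delta> * of_int \<lceil>s / \<delta>\<rceil> \<le> s + \<delta>"
    unfolding distrib_left by linarith+
qed

lemma ceiling_grid_tendsto:
  fixes \<delta> :: "nat \<Rightarrow> real"
  assumes "\<delta> \<longlonglongrightarrow> 0" "\<And>m. 0 < \<delta> m"
  shows "(\<lambda>m. \<delta> m * of_int \<lceil>s / \<delta> m\<rceil>) \<longlonglongrightarrow> s"
proof (rule real_tendsto_sandwich[of "\<lambda>_. s" _ _ "\<lambda>m. s + \<delta> m"])
  show "\<forall>\<^sub>F m in sequentially. s \<le> \<delta> m * of_int \<lceil>s / \<delta> m\<rceil>" "\<forall>\<^sub>F m in sequentially. \<delta> m * of_int \<lceil>s / \<delta> m\<rceil> \<le> s + \<delta> m"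
    by (auto intro!: always_eventually ceiling_grid_bounds assms(2))
  show "(\<lambda>m. s + \<delta> m) \<longlonglongrightarrow> s" using tendsto_add[OF tendsto_const[of s] assms(1)] by simp
qed simp

context complete_levy_process
begin

text \<open>\<open>l\<close> times the resolvent of the semigroup at \<open>l\<close>. Defined by a
  density, so that the operator refers to no exponential variable on \<open>M\<close>.\<close>

definition expo :: "real \<Rightarrow> (real \<Rightarrow> real) \<Rightarrow> real \<Rightarrow> real" where
  "expo l g y = (\<integral>s. transition s g y \<partial>density lborel (exponential_density l))"

text \<open>The same operator with the exponential time rounded up to mesh \<open>\<delta>\<close>:
  a countable mixture of transition operators, which can be matched cell by cell.\<close>

definition grid_expo :: "real \<Rightarrow> real \<Rightarrow> (real \<Rightarrow> real) \<Rightarrow> real \<Rightarrow> real" where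
  "grid_expo l \<delta> g y = (\<integral>s. transition (\<delta> * of_int \<lceil>s / \<delta>\<rceil>) g y \<partial>density lborel (exponential_density l))"

lemma measurable_transition_time:
  assumes "bounded_continuous g"
  shows "(\<lambda>s. transition s g y) \<in> borel_measurable borel"
  using measurable_compose[OF measurable_Pair[OF measurable_ident_sets measurable_const[of y borel]] measurable_transition[OF assms]]
  by simp

lemma expo_tendsto:
  assumes "0 < l" and g: "bounded_continuous g" and "y \<longlonglongrightarrow> z"
  shows "(\<lambda>m. expo l g (y m)) \<longlonglongrightarrow> expo l g z"
proof -
  interpret E: prob_space "density lborel (exponential_density l)" using assms(1) by (rule prob_space_exponential_density)
  obtain C where "\<And>y. \<bar>g y\<bar> \<le> C" using g bounded_continuousE by blast
  then show ?thesis unfolding expo_def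
    by (intro E.bounded_convergence[where C=C] AE_I2 transition_tendsto g assms tendsto_const transition_abs_le)
       (auto simp: measurable_transition_time[OF g])
qed

lemma expo_abs_le:
  assumes "0 < l" "\<And>y. \<bar>g y\<bar> \<le> C"
  shows "\<bar>expo l g y\<bar> \<le> C"
proof -
  interpret E: prob_space "density lborel (exponential_density l)" using assms(1) by (rule prob_space_exponential_density)
  show ?thesis unfolding expo_def
    using order_trans[OF abs_ge_zero assms(2)] by (intro E.abs_expectation_le AE_I2 transition_abs_le assms(2)) auto
qed

lemma bounded_continuous_expo:
  assumes "0 < l" "bounded_continuous g"
  shows "bounded_continuous (expo l g)"
proof -
  obtain C where C: "\<And>y. \<bar>g y\<bar> \<le> C" using assms(2) bounded_continuousE by blast
  show ?thesis by (rule bounded_continuousI[OF expo_tendsto[OF assms] expo_abs_le[OF assms(1) C]])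
qed

lemma expo_mono:
  assumes "0 < l" "bounded_continuous g" "bounded_continuous h" "\<And>y. g y \<le> h y"
  shows "expo l g y \<le> expo l h y"
proof -
  interpret E: prob_space "density lborel (exponential_density l)" using assms(1) by (rule prob_space_exponential_density)
  obtain C where C: "\<And>y. \<bar>g y\<bar> \<le> C" using assms(2) bounded_continuousE by blast
  obtain D where D: "\<And>y. \<bar>h y\<bar> \<le> D" using assms(3) bounded_continuousE by blast
  show ?thesis unfolding expo_def
    using measurable_transition_time[OF assms(2)] measurable_transition_time[OF assms(3)] transition_abs_le[OF C] transition_abs_le[OF D]
    by (intro integral_mono E.integrable_bounded[where C=C] E.integrable_bounded[where C=D] transition_mono assms) auto
qed

text \<open>Mesh and starting point move together, because the position of \<open>X\<close> at the
  rounded jump time depends on the mesh as well.\<close>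

lemma grid_expo_tendsto:
  assumes "0 < l" and g: "bounded_continuous g" and "y \<longlonglongrightarrow> z" "\<delta> \<longlonglongrightarrow> 0" "\<And>m. 0 < \<delta> m"
  shows "(\<lambda>m. grid_expo l (\<delta> m) g (y m)) \<longlonglongrightarrow> expo l g z"
proof -
  interpret E: prob_space "density lborel (exponential_density l)" using assms(1) by (rule prob_space_exponential_density)
  obtain C where "\<And>y. \<bar>g y\<bar> \<le> C" using g bounded_continuousE by blast
  moreover note [measurable] = measurable_transition_time[OF g]
  ultimately show ?thesis unfolding expo_def grid_expo_def
    by (intro E.bounded_convergence[where C=C] AE_I2 transition_tendsto g assms ceiling_grid_tendsto transition_abs_le)
       (auto intro!: measurable_compose[OF _ measurable_transition_time[OF g]])
qed

lemma grid_expo_abs_le: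
  assumes "0 < l" "\<And>y. \<bar>g y\<bar> \<le> C"
  shows "\<bar>grid_expo l \<delta> g y\<bar> \<le> C"
proof -
  interpret E: prob_space "density lborel (exponential_density l)" using assms(1) by (rule prob_space_exponential_density)
  show ?thesis unfolding grid_expo_def
    using order_trans[OF abs_ge_zero assms(2)] by (intro E.abs_expectation_le AE_I2 transition_abs_le assms(2)) auto
qed

text \<open>The weights are the exponential masses of the cells. They reappear in
  \<open>prob_cell\<close> as the probabilities that the next jump of the clock falls into a given
  cell.\<close>

lemma grid_expo_sums:
  assumes "0 < l" and g: "bounded_continuous g" and \<delta>: "0 < \<delta>"
  shows "(\<lambda>j. (exp (- l * (real j * \<delta>)) - exp (- l * ((real j + 1) * \<delta>))) * transition ((real j + 1) * \<delta>) g y)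
     sums grid_expo l \<delta> g y"
proof -
  let ?E = "density lborel (exponential_density l)"
  interpret E: prob_space ?E using assms(1) by (rule prob_space_exponential_density)
  obtain C where C: "\<And>y. \<bar>g y\<bar> \<le> C" using g bounded_continuousE by blast
  note [measurable] = measurable_transition_time[OF g]
  have "(\<lambda>j. \<integral>s. of_bool (nat (\<lceil>s / \<delta>\<rceil> - 1) = j) * transition (\<delta> * of_int \<lceil>s / \<delta>\<rceil>) g y \<partial>?E) sums grid_expo l \<delta> g y"
    unfolding grid_expo_def
    by (rule E.expectation_partition_sums[where C=C])
       (auto intro!: transition_abs_le C measurable_compose[OF _ measurable_transition_time[OF g]])
  also have "(\<lambda>j. \<integral>s. of_bool (nat (\<lceil>s / \<delta>\<rceil> - 1) = j) * transition (\<delta> * of_int \<lceil>s / \<delta>\<rceil>) g y \<partial>?E) =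
     (\<lambda>j. (exp (- l * (real j * \<delta>)) - exp (- l * ((real j + 1) * \<delta>))) * transition ((real j + 1) * \<delta>) g y)"
  proof (rule ext)
    fix j
    have "(\<integral>s. of_bool (nat (\<lceil>s / \<delta>\<rceil> - 1) = j) * transition (\<delta> * of_int \<lceil>s / \<delta>\<rceil>) g y \<partial>?E) =
      (\<integral>s. indicator {s\<in>space ?E. real j * \<delta> < s \<and> s \<le> (real j + 1) * \<delta>} s * transition ((real j + 1) * \<delta>) g y \<partial>?E)"
    proof (rule integral_cong_AE)
      show "AE s in ?E. of_bool (nat (\<lceil>s / \<delta>\<rceil> - 1) = j) * transition (\<delta> * of_int \<lceil>s / \<delta>\<rceil>) g y =
          indicator {s\<in>space ?E. real j * \<delta> < s \<and> s \<le> (real j + 1) * \<delta>} s * transition ((real j + 1) * \<delta>) g y"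
        using exponential_AE_pos
      proof eventually_elim
        case (elim s)
        then show ?case using ceiling_cell(1)[OF \<delta> elim, of j] ceiling_cell(2)[OF \<delta> elim] by (auto simp: indicator_def mult.commute[of \<delta>])
      qed
    qed (auto intro!: measurable_compose[OF _ measurable_transition_time[OF g]])
    also have "\<dots> = E.prob {s\<in>space ?E. real j * \<delta> < s \<and> s \<le> (real j + 1) * \<delta>} * transition ((real j + 1) * \<delta>) g y"
      by (subst integral_mult_left_zero) auto
    also have "E.prob {s\<in>space ?E. real j * \<delta> < s \<and> s \<le> (real j + 1) * \<delta>} = exp (- l * (real j * \<delta>)) - exp (- l * ((real j + 1) * \<delta>))"
      using assms by (intro E.exponential_cell distributed_ident) (auto simp: algebra_simps)
    finally show "(\<integral>s. of_bool (nat (\<lceil>s / \<delta>\<rceil> - 1) = j) * transition (\<delta> * of_int \<lceil>s / \<delta>\<rceil>) g y \<partial>?E) =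
       (exp (- l * (real j * \<delta>)) - exp (- l * ((real j + 1) * \<delta>))) * transition ((real j + 1) * \<delta>) g y" .
  qed
  finally show ?thesis .
qed

lemma process_events_vimage:
  "0 \<le> s \<Longrightarrow> B \<in> sets S \<Longrightarrow> Y s -` B \<inter> space M \<in> process_events M S Y"
  unfolding process_events_def by (intro sigma_sets.Basic) blast

lemma sigma_algebra_process_events: "sigma_algebra (space M) (process_events M S Y)"
  unfolding process_events_def by (rule sigma_algebra_sigma_sets) auto

text \<open>Independence is applied with \<open>X\<close> at deterministic times:
  \<open>\<xi>\<close> is rounded up to a grid, each cell contributes its exponential mass, and the
  mesh tends to 0.\<close>

lemma expectation_at_exponential_time:
  assumes "0 < l" and D: "distributed M lborel \<xi> (exponential_density l)"
    and ind: "indep_set (process_events M borel X) (sets (vimage_algebra (space M) \<xi> borel))"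
    and g: "bounded_continuous g"
  shows "expectation (\<lambda>\<omega>. g (y + X (\<xi> \<omega>) \<omega>)) = expo l g y"
proof -
  obtain C where C: "0 \<le> C" "\<And>y. \<bar>g y\<bar> \<le> C" using g bounded_continuousE by blast
  have [measurable]: "\<xi> \<in> borel_measurable M" using distributed_measurable[OF D] by simp
  have [measurable]: "g \<in> borel_measurable borel" by (rule bounded_continuous_measurable[OF g])
  have XJ: "(\<lambda>\<omega>. X ((real (J \<omega>) + 1) * \<delta>) \<omega>) \<in> borel_measurable M" if "J \<in> measurable M (count_space UNIV)" "0 < \<delta>" for J \<delta>
    by (rule measurable_compose_countable[OF _ that(1)]) (use that in \<open>auto intro!: measurable_X\<close>)
  have grid: "expectation (\<lambda>\<omega>. g (y + X ((real (nat (\<lceil>\<xi> \<omega> / \<delta>\<rceil> - 1)) + 1) * \<delta>) \<omega>)) = grid_expo l \<delta> g y" if \<delta>: "0 < \<delta>" for \<delta>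
  proof -
    let ?J = "\<lambda>\<omega>. nat (\<lceil>\<xi> \<omega> / \<delta>\<rceil> - 1)"
    have J[measurable]: "?J \<in> measurable M (count_space UNIV)" by measurable
    note [measurable] = XJ[OF J \<delta>]
    have "(\<lambda>j. expectation (\<lambda>\<omega>. of_bool (?J \<omega> = j) * g (y + X ((real (?J \<omega>) + 1) * \<delta>) \<omega>))) sums
       expectation (\<lambda>\<omega>. g (y + X ((real (?J \<omega>) + 1) * \<delta>) \<omega>))"
      by (rule expectation_partition_sums[where C=C]) (auto simp: C)
    moreover have "expectation (\<lambda>\<omega>. of_bool (?J \<omega> = j) * g (y + X ((real (?J \<omega>) + 1) * \<delta>) \<omega>)) =
      (exp (- l * (real j * \<delta>)) - exp (- l * ((real j + 1) * \<delta>))) * transition ((real j + 1) * \<delta>) g y" for j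
    proof -
      have [measurable]: "X ((real j + 1) * \<delta>) \<in> borel_measurable M" using \<delta> by (intro measurable_X) simp
      have pred: "Measurable.pred borel (\<lambda>s. real j * \<delta> < s \<and> s \<le> (real j + 1) * \<delta>)" by measurable
      have "expectation (\<lambda>\<omega>. of_bool (?J \<omega> = j) * g (y + X ((real (?J \<omega>) + 1) * \<delta>) \<omega>)) =
         expectation (\<lambda>\<omega>. of_bool (real j * \<delta> < \<xi> \<omega> \<and> \<xi> \<omega> \<le> (real j + 1) * \<delta>) * g (y + X ((real j + 1) * \<delta>) \<omega>))"
      proof (rule integral_cong_AE)
        show "AE \<omega> in M. of_bool (?J \<omega> = j) * g (y + X ((real (?J \<omega>) + 1) * \<delta>) \<omega>) =
            of_bool (real j * \<delta> < \<xi> \<omega> \<and> \<xi> \<omega> \<le> (real j + 1) * \<delta>) * g (y + X ((real j + 1) * \<delta>) \<omega>)"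
          using exponential_distributed_AE_pos[OF D]
        proof eventually_elim
          case (elim \<omega>)
          show ?case using ceiling_cell(1)[OF \<delta> elim, of j] by auto
        qed
      qed measurable
      also have "\<dots> = expectation (\<lambda>\<omega>. expectation (\<lambda>\<omega>'. of_bool (real j * \<delta> < \<xi> \<omega>' \<and> \<xi> \<omega>' \<le> (real j + 1) * \<delta>) * g (y + X ((real j + 1) * \<delta>) \<omega>)))"
      proof (rule indep_set_expectation[OF ind, where U="X ((real j + 1) * \<delta>)" and V=\<xi> and S=borel and T=borel and C=C
            and \<Psi>="\<lambda>z s. of_bool (real j * \<delta> < s \<and> s \<le> (real j + 1) * \<delta>) * g (y + z)"])
        show "X ((real j + 1) * \<delta>) -` A \<inter> space M \<in> process_events M borel X" if "A \<in> sets borel" for A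
          using that \<delta> by (intro process_events_vimage) auto
        show "\<xi> -` A \<inter> space M \<in> sets (vimage_algebra (space M) \<xi> borel)" if "A \<in> sets borel" for A
          using that by (rule in_vimage_algebra)
        show "\<bar>of_bool (real j * \<delta> < s \<and> s \<le> (real j + 1) * \<delta>) * g (y + z)\<bar> \<le> C" for z s using C by auto
      qed measurable
      also have "\<dots> = expectation (\<lambda>\<omega>. prob {\<omega>\<in>space M. real j * \<delta> < \<xi> \<omega> \<and> \<xi> \<omega> \<le> (real j + 1) * \<delta>} * g (y + X ((real j + 1) * \<delta>) \<omega>))"
      proof -
        have "expectation (\<lambda>\<omega>'. of_bool (real j * \<delta> < \<xi> \<omega>' \<and> \<xi> \<omega>' \<le> (real j + 1) * \<delta>)) =
            expectation (indicator {\<omega>\<in>space M. real j * \<delta> < \<xi> \<omega> \<and> \<xi> \<omega> \<le> (real j + 1) * \<delta>})"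
          by (intro Bochner_Integration.integral_cong) (auto simp: indicator_def)
        also have "\<dots> = prob ({\<omega>\<in>space M. real j * \<delta> < \<xi> \<omega> \<and> \<xi> \<omega> \<le> (real j + 1) * \<delta>} \<inter> space M)"
          by (rule Bochner_Integration.integral_indicator)
        also have "{\<omega>\<in>space M. real j * \<delta> < \<xi> \<omega> \<and> \<xi> \<omega> \<le> (real j + 1) * \<delta>} \<inter> space M = {\<omega>\<in>space M. real j * \<delta> < \<xi> \<omega> \<and> \<xi> \<omega> \<le> (real j + 1) * \<delta>}"
          by auto
        finally show ?thesis by simp
      qed
      also have "\<dots> = (exp (- l * (real j * \<delta>)) - exp (- l * ((real j + 1) * \<delta>))) * transition ((real j + 1) * \<delta>) g y"
      proof -
        have c: "prob {\<omega>\<in>space M. real j * \<delta> < \<xi> \<omega> \<and> \<xi> \<omega> \<le> (real j + 1) * \<delta>} = exp (- l * (real j * \<delta>)) - exp (- l * ((real j + 1) * \<delta>))"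
          using \<delta> by (intro exponential_cell[OF D assms(1)]) (auto simp: algebra_simps)
        show ?thesis unfolding c using \<delta> by (simp add: transition_def max_def)
      qed
      finally show ?thesis .
    qed
    ultimately show ?thesis using grid_expo_sums[OF assms(1) g \<delta>, of y] sums_unique2 by auto
  qed
  define \<delta> where "\<delta> m = 1 / real (Suc m)" for m
  have \<delta>: "0 < \<delta> m" for m by (simp add: \<delta>_def)
  have \<delta>0: "\<delta> \<longlonglongrightarrow> 0" unfolding \<delta>_def by (rule lim_1_over_n[THEN LIMSEQ_Suc])
  have J[measurable]: "(\<lambda>\<omega>. nat (\<lceil>\<xi> \<omega> / \<delta> m\<rceil> - 1)) \<in> measurable M (count_space UNIV)" for m by measurable
  have "(\<lambda>m. expectation (\<lambda>\<omega>. g (y + X ((real (nat (\<lceil>\<xi> \<omega> / \<delta> m\<rceil> - 1)) + 1) * \<delta> m) \<omega>))) \<longlonglongrightarrow> expectation (\<lambda>\<omega>. g (y + X (\<xi> \<omega>) \<omega>))"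
  proof (rule bounded_convergence_complete[where C=C])
    show "AE \<omega> in M. (\<lambda>m. g (y + X ((real (nat (\<lceil>\<xi> \<omega> / \<delta> m\<rceil> - 1)) + 1) * \<delta> m) \<omega>)) \<longlonglongrightarrow> g (y + X (\<xi> \<omega>) \<omega>)"
      using exponential_distributed_AE_pos[OF D] AE_space
    proof eventually_elim
      case (elim \<omega>)
      have "\<xi> \<omega> \<le> \<delta> m * of_int \<lceil>\<xi> \<omega> / \<delta> m\<rceil>" for m
        by (rule ceiling_grid_bounds(1)[OF \<delta>])
      then have "(\<lambda>m. X (\<delta> m * of_int \<lceil>\<xi> \<omega> / \<delta> m\<rceil>) \<omega>) \<longlonglongrightarrow> X (\<xi> \<omega>) \<omega>"
        using elim \<delta> by (intro right_continuous ceiling_grid_tendsto \<delta>0) auto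
      then have "(\<lambda>m. X ((real (nat (\<lceil>\<xi> \<omega> / \<delta> m\<rceil> - 1)) + 1) * \<delta> m) \<omega>) \<longlonglongrightarrow> X (\<xi> \<omega>) \<omega>"
        by (simp only: ceiling_cell(2)[OF \<delta> elim(1)])
      then show ?case by (intro bounded_continuous_tendsto[OF g] tendsto_add tendsto_const)
    qed
    show "(\<lambda>\<omega>. g (y + X ((real (nat (\<lceil>\<xi> \<omega> / \<delta> m\<rceil> - 1)) + 1) * \<delta> m) \<omega>)) \<in> borel_measurable M" for m
      using XJ[OF J \<delta>] by measurable
  qed (rule C)
  moreover have "(\<lambda>m. expectation (\<lambda>\<omega>. g (y + X ((real (nat (\<lceil>\<xi> \<omega> / \<delta> m\<rceil> - 1)) + 1) * \<delta> m) \<omega>))) \<longlonglongrightarrow> expo l g y"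
    unfolding grid[OF \<delta>] by (rule grid_expo_tendsto[OF assms(1) g tendsto_const \<delta>0 \<delta>])
  ultimately show ?thesis by (rule LIMSEQ_unique)
qed

end

lemma pred_countable2:
  fixes f :: "'b \<Rightarrow> 'c::countable"
  assumes "f \<in> measurable A (count_space UNIV)" "g \<in> measurable A (count_space UNIV)"
  shows "Measurable.pred A (\<lambda>\<omega>. R (f \<omega>) (g \<omega>))"
  by (rule measurable_compose_countable[where f="\<lambda>i \<omega>. R i (g \<omega>)", OF _ assms(1)])
     (rule measurable_compose[OF assms(2)], simp)

section \<open>Independence of the joint past from the joint future, and one step on a grid\<close>

locale levy_poisson = complete_levy_process M X + P: complete_poisson_process M lam N
  for M :: "'a measure" and X lam N +
  assumes independent: "indep_set (process_events M borel X) (process_events M (count_space UNIV) N)"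
begin

abbreviation history :: "ennreal \<Rightarrow> 'a measure" where
  "history t \<equiv> completed_history M (borel \<Otimes>\<^sub>M count_space UNIV) (\<lambda>t \<omega>. (X t \<omega>, N t \<omega>)) t"

text \<open>On monotone counting paths: the first jump after \<open>q\<close> comes later than
  \<open>q + p\<close> and no later than \<open>q + p'\<close>.\<close>

definition cell :: "real \<Rightarrow> real \<Rightarrow> real \<Rightarrow> 'a \<Rightarrow> bool" where
  "cell q p p' \<omega> \<longleftrightarrow> N (q + p) \<omega> = N q \<omega> \<and> N q \<omega> < N (q + p') \<omega>"

lemma measurable_cell:
  assumes "N q \<in> measurable A (count_space UNIV)" "N (q + p) \<in> measurable A (count_space UNIV)"
    "N (q + p') \<in> measurable A (count_space UNIV)"
  shows "Measurable.pred A (cell q p p')"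
proof -
  have "Measurable.pred A (\<lambda>\<omega>. N (q + p) \<omega> = N q \<omega>)" "Measurable.pred A (\<lambda>\<omega>. N q \<omega> < N (q + p') \<omega>)"
    using pred_countable2[OF assms(2,1), of "(=)"] pred_countable2[OF assms(1,3), of "(<)"] by simp_all
  then show ?thesis unfolding cell_def by (rule pred_intros_logic)
qed

lemma sets_history_subset: "sets (history t) \<subseteq> events"
  by (intro sets_completed_history_subset measurable_Pair measurable_X P.measurable_N)

lemma measurable_history:
  assumes "0 \<le> s" "ennreal s \<le> t"
  shows "X s \<in> borel_measurable (history t)" "N s \<in> measurable (history t) (count_space UNIV)"
proof -
  have "(\<lambda>\<omega>. (X s \<omega>, N s \<omega>)) \<in> measurable (history t) (borel \<Otimes>\<^sub>M count_space UNIV)"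
    using assms by (intro measurable_completed_history measurable_Pair measurable_X P.measurable_N) auto
  from measurable_compose[OF this measurable_fst] measurable_compose[OF this measurable_snd]
  show "X s \<in> borel_measurable (history t)" "N s \<in> measurable (history t) (count_space UNIV)" by auto
qed

lemma measurable_process_events:
  assumes "0 \<le> s" "Y s \<in> measurable M S"
  shows "Y s \<in> measurable (sigma (space M) (process_events M S Y)) S"
proof (rule measurableI)
  fix A assume "A \<in> sets S"
  then have "Y s -` A \<inter> space M \<in> process_events M S Y" using assms(1) by (intro process_events_vimage)
  then show "Y s -` A \<inter> space (sigma (space M) (process_events M S Y)) \<in> sets (sigma (space M) (process_events M S Y))"
    using sigma_algebra.sigma_sets_eq[OF sigma_algebra_process_events[of S Y]]
    by (subst sets_measure_of) (auto simp: space_measure_of_conv process_events_def dest: sigma_sets_into_sp[rotated])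
qed (use measurable_space[OF assms(2)] in \<open>simp add: space_measure_of_conv\<close>)

lemma sets_sigma_process_events: "sets (sigma (space M) (process_events M S Y)) = process_events M S Y"
proof -
  interpret sigma_algebra "space M" "process_events M S Y" by (rule sigma_algebra_process_events)
  show ?thesis using space_closed by (subst sets_measure_of) (auto simp: sigma_sets_eq)
qed

text \<open>The pasts and futures of \<open>X\<close> and of \<open>N\<close> are four independent
  families: independence of the processes separates \<open>X\<close> from \<open>N\<close>, then
  independent increments separate each past from its future. Intersections of one event from each
  process are intersection-stable generators of the joint past and of the joint future.\<close>

lemma history_indep_future:
  assumes "0 \<le> q" "0 \<le> h" "0 \<le> p" "p \<le> p'"
  shows "indep_set (sets (history (ennreal q)))
    {(\<lambda>\<omega>. (cell q p p' \<omega>, X (q + h) \<omega> - X q \<omega>)) -` E \<inter> space M | E. E \<in> sets (count_space UNIV \<Otimes>\<^sub>M borel)}"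
    (is "indep_set _ ?F")
proof -
  let ?PX = "process_events M borel X" and ?PN = "process_events M (count_space UNIV) N"
  interpret PX: sigma_algebra "space M" ?PX by (rule sigma_algebra_process_events)
  interpret PN: sigma_algebra "space M" ?PN by (rule sigma_algebra_process_events)
  define GX where "GX = sigma_sets (space M) {X s -` B \<inter> space M | s B. 0 \<le> s \<and> s \<le> q \<and> B \<in> sets borel}"
  define GN where "GN = sigma_sets (space M) {(\<lambda>\<omega>. real (N s \<omega>)) -` B \<inter> space M | s B. 0 \<le> s \<and> s \<le> q \<and> B \<in> sets borel}"
  interpret GX: sigma_algebra "space M" GX unfolding GX_def by (rule sigma_algebra_sigma_sets) auto
  interpret GN: sigma_algebra "space M" GN unfolding GN_def by (rule sigma_algebra_sigma_sets) auto
  define ZX where "ZX \<omega> = (X (q + h) \<omega> - X q \<omega>, X (q + h) \<omega> - X (q + h) \<omega>)" for \<omega>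
  define ZN where "ZN \<omega> = (real (N (q + p) \<omega>) - real (N q \<omega>), real (N (q + p') \<omega>) - real (N (q + p) \<omega>))" for \<omega>
  define FX where "FX = {ZX -` E \<inter> space M | E. E \<in> sets (borel \<Otimes>\<^sub>M borel)}"
  define FN where "FN = {ZN -` E \<inter> space M | E. E \<in> sets (borel \<Otimes>\<^sub>M borel)}"
  have iX: "indep_set GX FX" unfolding GX_def FX_def ZX_def by (rule future_indep_past) (use assms in auto)
  have iN: "indep_set GN FN" unfolding GN_def FN_def ZN_def by (rule P.future_indep_past) (use assms in auto)
  have GX: "GX \<subseteq> ?PX" unfolding GX_def by (intro PX.sigma_sets_subset) (auto intro!: process_events_vimage)
  have GN: "GN \<subseteq> ?PN" unfolding GN_def
  proof (intro PN.sigma_sets_subset, safe)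
    fix s :: real and B :: "real set" assume "0 \<le> s"
    then have "N s -` (real -` B) \<inter> space M \<in> ?PN" by (intro process_events_vimage) auto
    then show "(\<lambda>\<omega>. real (N s \<omega>)) -` B \<inter> space M \<in> ?PN" by (simp add: vimage_def)
  qed
  have FX: "FX \<subseteq> ?PX"
  proof -
    have [measurable]: "X q \<in> borel_measurable (sigma (space M) ?PX)" "X (q + h) \<in> borel_measurable (sigma (space M) ?PX)"
      using assms by (auto intro!: measurable_process_events measurable_X)
    have "ZX \<in> measurable (sigma (space M) ?PX) (borel \<Otimes>\<^sub>M borel)" unfolding ZX_def by measurable
    from measurable_sets[OF this] show ?thesis by (auto simp: FX_def sets_sigma_process_events space_measure_of_conv)
  qed
  have FN: "FN \<subseteq> ?PN"
  proof -
    have [measurable]: "N q \<in> measurable (sigma (space M) ?PN) (count_space UNIV)"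
      "N (q + p) \<in> measurable (sigma (space M) ?PN) (count_space UNIV)" "N (q + p') \<in> measurable (sigma (space M) ?PN) (count_space UNIV)"
      using assms by (auto intro!: measurable_process_events P.measurable_N)
    have "ZN \<in> measurable (sigma (space M) ?PN) (borel \<Otimes>\<^sub>M borel)" unfolding ZN_def by measurable
    from measurable_sets[OF this] show ?thesis by (auto simp: FN_def sets_sigma_process_events space_measure_of_conv)
  qed
  have ev: "GX \<subseteq> events" "FX \<subseteq> events" "GN \<subseteq> events" "FN \<subseteq> events" using iX iN by (auto simp: indep_sets2_eq)
  have spF: "space M \<in> FX" "space M \<in> FN" unfolding FX_def FN_def by (auto intro!: exI[of _ UNIV] simp: space_pair_measure[symmetric, of borel borel, simplified])
  define GG where "GG = {a \<inter> b | a b. a \<in> GX \<and> b \<in> GN}"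
  define FF where "FF = {c \<inter> d | c d. c \<in> FX \<and> d \<in> FN}"
  have four: "prob ((a \<inter> b) \<inter> (c \<inter> d)) = (prob a * prob b) * (prob c * prob d)"
    if "a \<in> GX" "b \<in> GN" "c \<in> FX" "d \<in> FN" for a b c d
  proof -
    have "a \<inter> c \<in> ?PX" "b \<inter> d \<in> ?PN" using that GX GN FX FN by auto
    then have "prob ((a \<inter> c) \<inter> (b \<inter> d)) = prob (a \<inter> c) * prob (b \<inter> d)" by (rule indep_setD[OF independent])
    also have "\<dots> = (prob a * prob c) * (prob b * prob d)" using that indep_setD[OF iX] indep_setD[OF iN] by simp
    finally show ?thesis by (simp add: Int_ac mult_ac)
  qed
  have two: "prob (a \<inter> b) = prob a * prob b" if "a \<in> GX \<union> FX" "b \<in> GN \<union> FN" for a b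
    using that GX GN FX FN by (intro indep_setD[OF independent]) auto
  have "indep_set GG FF"
  proof (rule indep_setI)
    fix e e' assume "e \<in> GG" "e' \<in> FF"
    then show "prob (e \<inter> e') = prob e * prob e'" unfolding GG_def FF_def using four two by auto
  qed (use ev in \<open>auto simp: GG_def FF_def\<close>)
  moreover have "Int_stable GG"
  proof (rule Int_stableI)
    fix e e' assume "e \<in> GG" "e' \<in> GG"
    then obtain a b a' b' where "e \<inter> e' = (a \<inter> a') \<inter> (b \<inter> b')" "a \<in> GX" "b \<in> GN" "a' \<in> GX" "b' \<in> GN"
      unfolding GG_def by auto
    then show "e \<inter> e' \<in> GG" unfolding GG_def by blast
  qed
  moreover have "Int_stable FF"
  proof (rule Int_stableI)
    fix e e' assume "e \<in> FF" "e' \<in> FF"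
    then obtain a b a' b' where *: "e \<inter> e' = (a \<inter> a') \<inter> (b \<inter> b')" "a \<in> FX" "b \<in> FN" "a' \<in> FX" "b' \<in> FN"
      unfolding FF_def by auto
    have "Int_stable FX" "Int_stable FN" unfolding FX_def FN_def by (rule Int_stable_vimage)+
    with * have "a \<inter> a' \<in> FX" "b \<inter> b' \<in> FN" by (auto dest: Int_stableD)
    then show "e \<inter> e' \<in> FF" using *(1) unfolding FF_def by blast
  qed
  ultimately have ind: "indep_set (sigma_sets (space M) GG) (sigma_sets (space M) FF)" by (rule indep_set_sigma_sets)
  have GGP: "GG \<subseteq> Pow (space M)" and FFP: "FF \<subseteq> Pow (space M)"
    using GX.sets_into_space GN.sets_into_space sets.sets_into_space[OF subsetD[OF ev(2)]] unfolding GG_def FF_def by blast+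
  have F: "?F \<subseteq> sigma_sets (space M) FF"
  proof -
    let ?S = "sigma (space M) FF"
    have sS: "sets ?S = sigma_sets (space M) FF" "space ?S = space M" using FFP by (auto simp: space_measure_of_conv)
    have sub: "FX \<subseteq> sets ?S" "FN \<subseteq> sets ?S"
    proof -
      have *: "c = c \<inter> space M" "c = space M \<inter> c" if "c \<in> FX \<union> FN" for c
        using that ev sets.sets_into_space[of c M] by auto
      have "FX \<subseteq> FF" unfolding FF_def using *(1) spF(2) by blast
      moreover have "FN \<subseteq> FF" unfolding FF_def using *(2) spF(1) by blast
      ultimately have "FX \<subseteq> FF" "FN \<subseteq> FF" .
      then show "FX \<subseteq> sets ?S" "FN \<subseteq> sets ?S" unfolding sS by (auto intro: sigma_sets.Basic)
    qed
    have "ZX -` A \<inter> space M \<in> FX" "ZN -` A \<inter> space M \<in> FN" if "A \<in> sets (borel \<Otimes>\<^sub>M borel)" for A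
      unfolding FX_def FN_def using that by blast+
    with sub have "ZX \<in> measurable ?S (borel \<Otimes>\<^sub>M borel)" "ZN \<in> measurable ?S (borel \<Otimes>\<^sub>M borel)"
      unfolding measurable_def by (auto simp: sS(2) space_pair_measure)
    note [measurable] = measurable_compose[OF this(1) measurable_fst] measurable_compose[OF this(2) measurable_fst] measurable_compose[OF this(2) measurable_snd]
    \<comment> \<open>The cell depends on the future increments of \<open>N\<close> alone: the first
      one is 0 and the sum of both is positive.\<close>
    have "(\<lambda>\<omega>. (fst (ZN \<omega>) = 0 \<and> 0 < fst (ZN \<omega>) + snd (ZN \<omega>), fst (ZX \<omega>))) \<in> measurable ?S (count_space UNIV \<Otimes>\<^sub>M borel)" by measurable
    also have "(\<lambda>\<omega>. (fst (ZN \<omega>) = 0 \<and> 0 < fst (ZN \<omega>) + snd (ZN \<omega>), fst (ZX \<omega>))) = (\<lambda>\<omega>. (cell q p p' \<omega>, X (q + h) \<omega> - X q \<omega>))"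
      by (auto simp: fun_eq_iff ZN_def ZX_def cell_def)
    finally show ?thesis using measurable_sets[of _ ?S] by (auto simp: sS)
  qed
  have G: "sigma_sets (space M) {(\<lambda>\<omega>. (X s \<omega>, N s \<omega>)) -` B \<inter> space M | s B. 0 \<le> s \<and> ennreal s \<le> ennreal q \<and> B \<in> sets (borel \<Otimes>\<^sub>M count_space UNIV)}
      \<subseteq> sigma_sets (space M) GG"
  proof -
    let ?S = "sigma (space M) GG"
    have sS: "sets ?S = sigma_sets (space M) GG" "space ?S = space M" using GGP by (auto simp: space_measure_of_conv)
    have sub: "GX \<subseteq> sets ?S" "GN \<subseteq> sets ?S"
    proof -
      have *: "c = c \<inter> space M" "c = space M \<inter> c" if "c \<in> GX \<union> GN" for c
        using that ev sets.sets_into_space[of c M] by auto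
      have "GX \<subseteq> GG" unfolding GG_def using *(1) GN.top by blast
      moreover have "GN \<subseteq> GG" unfolding GG_def using *(2) GX.top by blast
      ultimately have "GX \<subseteq> GG" "GN \<subseteq> GG" .
      then show "GX \<subseteq> sets ?S" "GN \<subseteq> sets ?S" unfolding sS by (auto intro: sigma_sets.Basic)
    qed
    have "(\<lambda>\<omega>. (X s \<omega>, N s \<omega>)) \<in> measurable ?S (borel \<Otimes>\<^sub>M count_space UNIV)" if "0 \<le> s" "s \<le> q" for s
    proof (rule measurable_Pair)
      show "X s \<in> borel_measurable ?S"
      proof (rule measurableI)
        fix B :: "real set" assume "B \<in> sets borel"
        then have "X s -` B \<inter> space M \<in> GX" unfolding GX_def using that by (intro sigma_sets.Basic) blast
        then show "X s -` B \<inter> space ?S \<in> sets ?S" using sub sS by auto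
      qed auto
      show "N s \<in> measurable ?S (count_space UNIV)"
      proof (rule measurableI)
        fix B :: "nat set"
        have "real ` B \<in> sets borel" by (rule sets.countable[OF _ countable_image[OF countableI_type]]) simp
        then have "(\<lambda>\<omega>. real (N s \<omega>)) -` (real ` B) \<inter> space M \<in> GN" unfolding GN_def using that by (intro sigma_sets.Basic) blast
        also have "(\<lambda>\<omega>. real (N s \<omega>)) -` (real ` B) \<inter> space M = N s -` B \<inter> space M" by auto
        finally show "N s -` B \<inter> space ?S \<in> sets ?S" using sub sS by auto
      qed auto
    qed
    from measurable_sets[OF this] have "{(\<lambda>\<omega>. (X s \<omega>, N s \<omega>)) -` B \<inter> space M | s B. 0 \<le> s \<and> ennreal s \<le> ennreal q \<and> B \<in> sets (borel \<Otimes>\<^sub>M count_space UNIV)} \<subseteq> sets ?S"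
      using assms(1) by (auto simp: sS)
    from sets.sigma_sets_subset[OF this] show ?thesis by (simp add: sS)
  qed
  have "indep_set (sigma_sets (space M) {(\<lambda>\<omega>. (X s \<omega>, N s \<omega>)) -` B \<inter> space M | s B. 0 \<le> s \<and> ennreal s \<le> ennreal q \<and> B \<in> sets (borel \<Otimes>\<^sub>M count_space UNIV)}) ?F"
    by (rule indep_set_mono[OF ind G F])
  then show ?thesis unfolding sets_completed_history
    by (intro indep_set_add_null_sets Int_stable_vimage) auto
qed

lemma pred_cell: "0 \<le> q \<Longrightarrow> 0 \<le> p \<Longrightarrow> 0 \<le> p' \<Longrightarrow> Measurable.pred M (cell q p p')"
  by (rule measurable_cell) (auto intro: P.measurable_N)

text \<open>Having no jump up to \<open>p\<close> splits, almost surely, into this cell and having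
  no jump up to \<open>p'\<close>.\<close>

lemma prob_cell:
  assumes "0 \<le> q" "0 \<le> p" "p \<le> p'"
  shows "prob {\<omega>\<in>space M. cell q p p' \<omega>} = exp (- lam * p) - exp (- lam * p')"
proof -
  have ev: "{\<omega>\<in>space M. N (q + p) \<omega> = N q \<omega>} \<in> events" "{\<omega>\<in>space M. N (q + p') \<omega> = N q \<omega>} \<in> events"
    using P.sets_N[of q "q + p" "\<lambda>a b. b = a"] P.sets_N[of q "q + p'" "\<lambda>a b. b = a"] assms by auto
  have "prob {\<omega>\<in>space M. N (q + p) \<omega> = N q \<omega>} = prob ({\<omega>\<in>space M. cell q p p' \<omega>} \<union> {\<omega>\<in>space M. N (q + p') \<omega> = N q \<omega>})"
  proof (rule finite_measure_eq_AE)
    show "AE \<omega> in M. \<omega> \<in> {\<omega>\<in>space M. N (q + p) \<omega> = N q \<omega>} \<longleftrightarrow> \<omega> \<in> {\<omega>\<in>space M. cell q p p' \<omega>} \<union> {\<omega>\<in>space M. N (q + p') \<omega> = N q \<omega>}"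
      using P.AE_mono
    proof eventually_elim
      case (elim \<omega>)
      have "N q \<omega> \<le> N (q + p) \<omega>" "N (q + p) \<omega> \<le> N (q + p') \<omega>" using elim assms by auto
      then show ?case by (auto simp: cell_def)
    qed
  qed (use ev pred_cell assms in \<open>auto simp: pred_def\<close>)
  also have "\<dots> = prob {\<omega>\<in>space M. cell q p p' \<omega>} + prob {\<omega>\<in>space M. N (q + p') \<omega> = N q \<omega>}"
    using ev pred_cell[of q p p'] assms by (intro finite_measure_Union) (auto simp: pred_def cell_def)
  finally show ?thesis
    using P.prob_no_jump[of q "q + p"] P.prob_no_jump[of q "q + p'"] assms by simp
qed

text \<open>\<open>X\<close> and \<open>N\<close> are independent, so the probability of the cell
  comes out as a factor.\<close>

lemma expectation_cell:
  assumes "0 \<le> q" "0 \<le> h" "0 \<le> p" "p \<le> p'" and g: "bounded_continuous g"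
  shows "expectation (\<lambda>\<omega>. of_bool (cell q p p' \<omega>) * g (y + (X (q + h) \<omega> - X q \<omega>))) =
    (exp (- lam * p) - exp (- lam * p')) * transition h g y"
proof -
  obtain C where C: "0 \<le> C" "\<And>y. \<bar>g y\<bar> \<le> C" using g bounded_continuousE by blast
  let ?PX = "process_events M borel X" and ?PN = "process_events M (count_space UNIV) N"
  have [measurable]: "g \<in> borel_measurable borel" by (rule bounded_continuous_measurable[OF g])
  have [measurable]: "X q \<in> borel_measurable M" "X (q + h) \<in> borel_measurable M" using assms by (auto intro!: measurable_X)
  have [measurable]: "X q \<in> borel_measurable (sigma (space M) ?PX)" "X (q + h) \<in> borel_measurable (sigma (space M) ?PX)"
    using assms by (auto intro!: measurable_process_events measurable_X)
  have [measurable]: "N q \<in> measurable (sigma (space M) ?PN) (count_space UNIV)"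
    "N (q + p) \<in> measurable (sigma (space M) ?PN) (count_space UNIV)" "N (q + p') \<in> measurable (sigma (space M) ?PN) (count_space UNIV)"
    using assms by (auto intro!: measurable_process_events P.measurable_N)
  have Zm: "(\<lambda>\<omega>. X (q + h) \<omega> - X q \<omega>) \<in> borel_measurable (sigma (space M) ?PX)" by measurable
  have Cm: "cell q p p' \<in> measurable (sigma (space M) ?PN) (count_space UNIV)"
    by (rule measurable_cell) measurable
  have [measurable]: "cell q p p' \<in> measurable M (count_space UNIV)" using pred_cell assms by simp
  have "expectation (\<lambda>\<omega>. of_bool (cell q p p' \<omega>) * g (y + (X (q + h) \<omega> - X q \<omega>))) =
    expectation (\<lambda>\<omega>. expectation (\<lambda>\<omega>'. of_bool (cell q p p' \<omega>') * g (y + (X (q + h) \<omega> - X q \<omega>))))"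
  proof (rule indep_set_expectation[OF independent, where U="\<lambda>\<omega>. X (q + h) \<omega> - X q \<omega>" and V="cell q p p'" and S=borel and T="count_space UNIV" and C=C
        and \<Psi>="\<lambda>z c. of_bool c * g (y + z)"])
    show "(\<lambda>\<omega>. X (q + h) \<omega> - X q \<omega>) -` A \<inter> space M \<in> ?PX" if "A \<in> sets borel" for A
      using measurable_sets[OF Zm that] by (simp add: sets_sigma_process_events space_measure_of_conv)
    show "cell q p p' -` A \<inter> space M \<in> ?PN" if "A \<in> sets (count_space UNIV)" for A
      using measurable_sets[OF Cm that] by (simp add: sets_sigma_process_events space_measure_of_conv)
    show "\<bar>of_bool c * g (y + z)\<bar> \<le> C" for z c using C by auto
  qed measurable
  also have "\<dots> = expectation (\<lambda>\<omega>. prob {\<omega>\<in>space M. cell q p p' \<omega>} * g (y + (X (q + h) \<omega> - X q \<omega>)))"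
  proof -
    have "expectation (\<lambda>\<omega>'. of_bool (cell q p p' \<omega>')) = expectation (indicator {\<omega>\<in>space M. cell q p p' \<omega>})"
      by (intro Bochner_Integration.integral_cong) (auto simp: indicator_def)
    also have "\<dots> = prob ({\<omega>\<in>space M. cell q p p' \<omega>} \<inter> space M)" by (rule Bochner_Integration.integral_indicator)
    also have "{\<omega>\<in>space M. cell q p p' \<omega>} \<inter> space M = {\<omega>\<in>space M. cell q p p' \<omega>}" by auto
    finally show ?thesis by simp
  qed
  also have "\<dots> = (exp (- lam * p) - exp (- lam * p')) * transition h g y"
    using prob_cell[OF assms(1,3,4)] transition_increment[OF g assms(1,2), of y] by simp
  finally show ?thesis .
qed

text \<open>The number of cells passed before the one with the next jump:
  \<open>q + (real (nxt \<delta> q \<omega>) + 1) * \<delta>\<close> is the time of the next jump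
  after \<open>q\<close>, rounded up along the grid that starts at \<open>q\<close>.\<close>

definition nxt :: "real \<Rightarrow> real \<Rightarrow> 'a \<Rightarrow> nat" where
  "nxt \<delta> q \<omega> = (LEAST l. N q \<omega> < N (q + (real l + 1) * \<delta>) \<omega>)"

lemma nxt_props:
  assumes "P.regular \<omega>" "0 < \<delta>" "0 \<le> q"
  shows "N q \<omega> < N (q + (real (nxt \<delta> q \<omega>) + 1) * \<delta>) \<omega>" "N (q + real (nxt \<delta> q \<omega>) * \<delta>) \<omega> = N q \<omega>"
    "nxt \<delta> q \<omega> = j \<longleftrightarrow> cell q (real j * \<delta>) ((real j + 1) * \<delta>) \<omega>"
proof -
  have mono: "N s \<omega> \<le> N t \<omega>" if "0 \<le> s" "s \<le> t" for s t using P.regular_N_mono[OF assms(1) that] .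
  obtain l :: nat where "P.T (Suc (N q \<omega>)) \<omega> / \<delta> \<le> real l" using real_arch_simple by blast
  then have "P.T (Suc (N q \<omega>)) \<omega> \<le> q + (real l + 1) * \<delta>"
    using assms(2,3) by (simp add: divide_le_eq algebra_simps)
  then have ex: "N q \<omega> < N (q + (real l + 1) * \<delta>) \<omega>"
    using P.regularD(3)[OF assms(1), of "q + (real l + 1) * \<delta>" "Suc (N q \<omega>)"] assms by simp
  show 1: "N q \<omega> < N (q + (real (nxt \<delta> q \<omega>) + 1) * \<delta>) \<omega>" unfolding nxt_def by (rule LeastI) (rule ex)
  show 2: "N (q + real (nxt \<delta> q \<omega>) * \<delta>) \<omega> = N q \<omega>"
  proof (cases "nxt \<delta> q \<omega>")
    case (Suc a)
    then have "\<not> N q \<omega> < N (q + (real a + 1) * \<delta>) \<omega>"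
      using not_less_Least[of a "\<lambda>l. N q \<omega> < N (q + (real l + 1) * \<delta>) \<omega>"] by (simp add: nxt_def)
    then show ?thesis using mono[of q "q + (real a + 1) * \<delta>"] assms Suc by (simp add: add.commute)
  qed simp
  show "nxt \<delta> q \<omega> = j \<longleftrightarrow> cell q (real j * \<delta>) ((real j + 1) * \<delta>) \<omega>"
  proof
    assume "nxt \<delta> q \<omega> = j" with 1 2 show "cell q (real j * \<delta>) ((real j + 1) * \<delta>) \<omega>" by (auto simp: cell_def)
  next
    assume c: "cell q (real j * \<delta>) ((real j + 1) * \<delta>) \<omega>"
    have "\<not> N q \<omega> < N (q + (real i + 1) * \<delta>) \<omega>" if "i < j" for i
    proof -
      have "real i + 1 \<le> real j" using that by simp
      then have "(real i + 1) * \<delta> \<le> real j * \<delta>" using assms(2) by (intro mult_right_mono) auto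
      then have "N (q + (real i + 1) * \<delta>) \<omega> \<le> N (q + real j * \<delta>) \<omega>" using assms by (intro mono) auto
      then show ?thesis using c by (auto simp: cell_def)
    qed
    then show "nxt \<delta> q \<omega> = j" unfolding nxt_def using c
      by (intro Least_equality) (auto simp: cell_def, metis not_le)
  qed
qed

lemma measurable_nxt:
  assumes "0 < \<delta>" "0 \<le> q"
  shows "nxt \<delta> q \<in> measurable M (count_space UNIV)"
proof -
  have "Measurable.pred M (\<lambda>\<omega>. N q \<omega> < N (q + (real l + 1) * \<delta>) \<omega>)" for l
    using P.sets_N[of q "q + (real l + 1) * \<delta>" "\<lambda>a b. a < b"] assms by (simp add: pred_def)
  then show ?thesis unfolding nxt_def by (intro measurable_Least)
qed

lemma measurable_X_countable:
  assumes "J \<in> measurable M (count_space (UNIV :: nat set))" "\<And>j. 0 \<le> u j"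
  shows "(\<lambda>\<omega>. X (u (J \<omega>)) \<omega>) \<in> borel_measurable M"
  by (rule measurable_compose_countable[OF _ assms(1)]) (auto intro!: measurable_X assms(2))

text \<open>Lack of memory: whatever happened up to the fixed time \<open>q\<close>, the rounded
  waiting time for the next jump is distributed as a rounded exponential time, independently of the
  past and of the increments of \<open>X\<close>.\<close>

lemma grid_markov:
  assumes B: "B \<in> sets (history (ennreal q))" and "0 \<le> q" "0 < \<delta>" and g: "bounded_continuous g"
  shows "expectation (\<lambda>\<omega>. of_bool (\<omega> \<in> B) * g (x + X (q + (real (nxt \<delta> q \<omega>) + 1) * \<delta>) \<omega>)) =
         expectation (\<lambda>\<omega>. of_bool (\<omega> \<in> B) * grid_expo lam \<delta> g (x + X q \<omega>))"
proof -
  obtain C where C: "0 \<le> C" "\<And>y. \<bar>g y\<bar> \<le> C" using g bounded_continuousE by blast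
  have [measurable]: "g \<in> borel_measurable borel" by (rule bounded_continuous_measurable[OF g])
  have [measurable]: "B \<in> events" using B sets_history_subset by auto
  have [measurable]: "X q \<in> borel_measurable M" using assms by (auto intro!: measurable_X)
  have J[measurable]: "nxt \<delta> q \<in> measurable M (count_space UNIV)" by (rule measurable_nxt) fact+
  have [measurable]: "(\<lambda>\<omega>. X (q + (real (nxt \<delta> q \<omega>) + 1) * \<delta>) \<omega>) \<in> borel_measurable M"
    by (rule measurable_X_countable[OF J]) (use assms in auto)
  define w where "w j = exp (- lam * (real j * \<delta>)) - exp (- lam * ((real j + 1) * \<delta>))" for j :: nat
  have w: "0 \<le> w j" for j using P.rate_pos \<open>0 < \<delta>\<close> by (simp add: w_def mult_left_mono)
  \<comment> \<open>The weights telescope to at most 1, so all partial sums of the mixture are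
    bounded by \<open>C\<close>.\<close>
  have sumw: "(\<Sum>j<n. w j) = 1 - exp (- lam * (real n * \<delta>))" for n
    by (induction n) (auto simp: w_def algebra_simps)
  have cell_term: "expectation (\<lambda>\<omega>. of_bool (nxt \<delta> q \<omega> = j) * (of_bool (\<omega> \<in> B) * g (x + X (q + (real (nxt \<delta> q \<omega>) + 1) * \<delta>) \<omega>))) =
      w j * expectation (\<lambda>\<omega>. of_bool (\<omega> \<in> B) * transition ((real j + 1) * \<delta>) g (x + X q \<omega>))" for j
  proof -
    let ?c = "cell q (real j * \<delta>) ((real j + 1) * \<delta>)"
    have [measurable]: "X (q + (real j + 1) * \<delta>) \<in> borel_measurable M" using assms by (auto intro!: measurable_X)
    have [measurable]: "Measurable.pred M ?c" using assms by (intro pred_cell) auto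
    have "expectation (\<lambda>\<omega>. of_bool (nxt \<delta> q \<omega> = j) * (of_bool (\<omega> \<in> B) * g (x + X (q + (real (nxt \<delta> q \<omega>) + 1) * \<delta>) \<omega>))) =
      expectation (\<lambda>\<omega>. of_bool (\<omega> \<in> B) * (of_bool (?c \<omega>) * g (x + X (q + (real j + 1) * \<delta>) \<omega>)))"
    proof (rule integral_cong_AE)
      show "AE \<omega> in M. of_bool (nxt \<delta> q \<omega> = j) * (of_bool (\<omega> \<in> B) * g (x + X (q + (real (nxt \<delta> q \<omega>) + 1) * \<delta>) \<omega>)) =
        of_bool (\<omega> \<in> B) * (of_bool (?c \<omega>) * g (x + X (q + (real j + 1) * \<delta>) \<omega>))"
        using P.AE_regular
      proof eventually_elim
        case (elim \<omega>)
        show ?case using nxt_props(3)[OF elim \<open>0 < \<delta>\<close> \<open>0 \<le> q\<close>, of j] by auto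
      qed
    qed measurable
    also have "\<dots> = w j * expectation (\<lambda>\<omega>. of_bool (\<omega> \<in> B) * transition ((real j + 1) * \<delta>) g (x + X q \<omega>))"
    proof (rule indep_markov[OF sets_history_subset _ B])
      show "indep_set (sets (history (ennreal q))) {(\<lambda>\<omega>. (?c \<omega>, X (q + (real j + 1) * \<delta>) \<omega> - X q \<omega>)) -` E \<inter> space M |E. E \<in> sets (count_space UNIV \<Otimes>\<^sub>M borel)}"
        using assms by (intro history_indep_future) (auto intro: mult_right_mono)
      show "expectation (\<lambda>\<omega>. of_bool (?c \<omega>) * g (y + (X (q + (real j + 1) * \<delta>) \<omega> - X q \<omega>))) = w j * transition ((real j + 1) * \<delta>) g y" for y
        unfolding w_def using assms by (intro expectation_cell) (auto intro: mult_right_mono)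
    qed (use assms in \<open>auto intro!: measurable_history\<close>)
    finally show ?thesis .
  qed
  have "(\<lambda>j. w j * expectation (\<lambda>\<omega>. of_bool (\<omega> \<in> B) * transition ((real j + 1) * \<delta>) g (x + X q \<omega>))) sums
      expectation (\<lambda>\<omega>. of_bool (\<omega> \<in> B) * g (x + X (q + (real (nxt \<delta> q \<omega>) + 1) * \<delta>) \<omega>))"
    unfolding cell_term[symmetric] by (rule expectation_partition_sums[OF J, where C=C]) (auto simp: C)
  then have lhs: "(\<lambda>n. \<Sum>j<n. w j * expectation (\<lambda>\<omega>. of_bool (\<omega> \<in> B) * transition ((real j + 1) * \<delta>) g (x + X q \<omega>))) \<longlonglongrightarrow>
      expectation (\<lambda>\<omega>. of_bool (\<omega> \<in> B) * g (x + X (q + (real (nxt \<delta> q \<omega>) + 1) * \<delta>) \<omega>))"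
    by (simp add: sums_def)
  have [measurable]: "transition t g \<in> borel_measurable borel" for t
    by (intro bounded_continuous_measurable bounded_continuous_transition g)
  have eq: "(\<Sum>j<n. w j * expectation (\<lambda>\<omega>. of_bool (\<omega> \<in> B) * transition ((real j + 1) * \<delta>) g (x + X q \<omega>))) =
     expectation (\<lambda>\<omega>. of_bool (\<omega> \<in> B) * (\<Sum>j<n. w j * transition ((real j + 1) * \<delta>) g (x + X q \<omega>)))" for n
  proof -
    have int: "integrable M (\<lambda>\<omega>. of_bool (\<omega> \<in> B) * transition ((real j + 1) * \<delta>) g (x + X q \<omega>))" for j
    proof (rule integrable_bounded[where C=C])
      show "\<bar>of_bool (\<omega> \<in> B) * transition ((real j + 1) * \<delta>) g (x + X q \<omega>)\<bar> \<le> C" for \<omega>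
        using transition_abs_le[OF C(2)] C(1) by auto
    qed measurable
    have "(\<Sum>j<n. w j * expectation (\<lambda>\<omega>. of_bool (\<omega> \<in> B) * transition ((real j + 1) * \<delta>) g (x + X q \<omega>))) =
       (\<Sum>j<n. expectation (\<lambda>\<omega>. w j * (of_bool (\<omega> \<in> B) * transition ((real j + 1) * \<delta>) g (x + X q \<omega>))))" by simp
    also have "\<dots> = expectation (\<lambda>\<omega>. \<Sum>j<n. w j * (of_bool (\<omega> \<in> B) * transition ((real j + 1) * \<delta>) g (x + X q \<omega>)))"
      using int by (intro Bochner_Integration.integral_sum[symmetric] integrable_mult_right)
    finally show ?thesis by (simp add: sum_distrib_left mult_ac)
  qed
  have "(\<lambda>n. expectation (\<lambda>\<omega>. of_bool (\<omega> \<in> B) * (\<Sum>j<n. w j * transition ((real j + 1) * \<delta>) g (x + X q \<omega>)))) \<longlonglongrightarrow>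
     expectation (\<lambda>\<omega>. of_bool (\<omega> \<in> B) * grid_expo lam \<delta> g (x + X q \<omega>))"
  proof (rule bounded_convergence_complete[where C=C])
    show "AE \<omega> in M. (\<lambda>n. of_bool (\<omega> \<in> B) * (\<Sum>j<n. w j * transition ((real j + 1) * \<delta>) g (x + X q \<omega>))) \<longlonglongrightarrow>
        of_bool (\<omega> \<in> B) * grid_expo lam \<delta> g (x + X q \<omega>)"
      using grid_expo_sums[OF P.rate_pos g \<open>0 < \<delta>\<close>] unfolding w_def sums_def
      by (intro AE_I2 tendsto_mult tendsto_const) auto
    fix n \<omega>
    have "\<bar>\<Sum>j<n. w j * transition ((real j + 1) * \<delta>) g (x + X q \<omega>)\<bar> \<le> (\<Sum>j<n. w j * C)"
      using w transition_abs_le[OF C(2)] by (intro sum_abs[THEN order_trans] sum_mono) (auto simp: abs_mult intro!: mult_left_mono)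
    also have "\<dots> = (1 - exp (- lam * (real n * \<delta>))) * C" by (simp only: sum_distrib_right[symmetric] sumw)
    also have "\<dots> \<le> C" using C(1) by (simp add: mult_left_le_one_le algebra_simps)
    finally show "\<bar>of_bool (\<omega> \<in> B) * (\<Sum>j<n. w j * transition ((real j + 1) * \<delta>) g (x + X q \<omega>))\<bar> \<le> C" using C(1) by auto
  qed measurable
  with lhs show ?thesis unfolding eq by (rule LIMSEQ_unique)
qed

end

subsection \<open>The strong Markov property at jump times\<close>

context levy_poisson
begin

text \<open>On regular paths the count at \<open>s\<close> decides the event, and the null sets in
  the history absorb the other paths.\<close>

lemma T_le_history:
  assumes "0 \<le> s" "ennreal s \<le> u"
  shows "{\<omega>\<in>space M. P.T i \<omega> \<le> s} \<in> sets (history u)"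
proof (rule completed_history_if_AE_eq)
  have "N s -` {i..} \<inter> space (history u) \<in> sets (history u)"
    using assms by (intro measurable_sets[OF measurable_history(2)]) auto
  then show "N s -` {i..} \<inter> space M \<in> sets (history u)" by simp
  show "AE \<omega> in M. \<omega> \<in> N s -` {i..} \<inter> space M \<longleftrightarrow> \<omega> \<in> {\<omega>\<in>space M. P.T i \<omega> \<le> s}"
    using P.AE_regular
  proof eventually_elim
    case (elim \<omega>)
    show ?case using P.regularD(3)[OF elim assms(1), of i] by auto
  qed
qed auto

lemma measurable_T: "P.T i \<in> borel_measurable M"
proof (rule borel_measurableI_le)
  fix s show "{\<omega>\<in>space M. P.T i \<omega> \<le> s} \<in> events"
  proof (cases "0 \<le> s")
    case True then show ?thesis using T_le_history[of s "ennreal s" i] sets_history_subset by auto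
  next
    case False
    then have "\<not> P.T i \<omega> \<le> s" for \<omega> using P.T_nonneg[of i \<omega>] by linarith
    then show ?thesis by simp
  qed
qed

lemma T_less_history: "{\<omega>\<in>space M. P.T i \<omega> < q} \<in> sets (history (ennreal q))"
proof -
  have "{\<omega>\<in>space M. P.T i \<omega> < q} = (\<Union>p\<in>\<rat> \<inter> {0..<q}. {\<omega>\<in>space M. P.T i \<omega> \<le> p})"
  proof safe
    fix \<omega> assume "P.T i \<omega> < q" "\<omega> \<in> space M"
    moreover obtain p where "p \<in> \<rat>" "P.T i \<omega> < p" "p < q" using Rats_dense_in_real[OF \<open>P.T i \<omega> < q\<close>] by blast
    ultimately show "\<omega> \<in> (\<Union>p\<in>\<rat> \<inter> {0..<q}. {\<omega>\<in>space M. P.T i \<omega> \<le> p})"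
      using P.T_nonneg[of i \<omega>] by (intro UN_I[of p]) auto
  qed auto
  also have "\<dots> \<in> sets (history (ennreal q))"
    by (intro sets.countable_UN'' countable_Int1 countable_rat T_le_history) (auto intro!: ennreal_leI)
  finally show ?thesis .
qed

text \<open>
  \<open>(grid_above \<delta> i + 1) * \<delta>\<close> is the first grid point strictly after the \<open>i\<close>-th jump. Strictness puts
  events of the right-continuous filtration at the jump into the plain history at the grid point.
\<close>

definition grid_above :: "real \<Rightarrow> nat \<Rightarrow> 'a \<Rightarrow> nat" where
  "grid_above \<delta> i \<omega> = nat \<lfloor>P.T i \<omega> / \<delta>\<rfloor>"

lemma grid_above_iff:
  assumes "0 < \<delta>"
  shows "grid_above \<delta> i \<omega> = j \<longleftrightarrow> real j * \<delta> \<le> P.T i \<omega> \<and> P.T i \<omega> < (real j + 1) * \<delta>"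
proof -
  have "0 \<le> P.T i \<omega> / \<delta>" using P.T_nonneg assms by simp
  then have "grid_above \<delta> i \<omega> = j \<longleftrightarrow> \<lfloor>P.T i \<omega> / \<delta>\<rfloor> = int j" unfolding grid_above_def by auto
  also have "\<dots> \<longleftrightarrow> real j \<le> P.T i \<omega> / \<delta> \<and> P.T i \<omega> / \<delta> < real j + 1" by (simp add: floor_eq_iff)
  finally show ?thesis using assms by (simp add: pos_le_divide_eq pos_divide_less_eq)
qed

lemma grid_above_bounds:
  assumes "0 < \<delta>"
  shows "P.T i \<omega> < (real (grid_above \<delta> i \<omega>) + 1) * \<delta>" "(real (grid_above \<delta> i \<omega>) + 1) * \<delta> \<le> P.T i \<omega> + \<delta>"
  using grid_above_iff[OF assms, of i \<omega> "grid_above \<delta> i \<omega>"] by (auto simp: distrib_right)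

lemma measurable_grid_above: "grid_above \<delta> i \<in> measurable M (count_space UNIV)"
  using measurable_T[of i] unfolding grid_above_def by measurable

text \<open>The hypothesis on \<open>A\<close>, with its strict inequality, says that
  \<open>A\<close> belongs to the right-continuous history at the \<open>i\<close>-th jump. Fixing
  the value of \<open>grid_above\<close> makes the starting time deterministic, so that
  \<open>grid_markov\<close> applies.\<close>

lemma grid_step:
  fixes i :: nat
  assumes A: "\<forall>q\<ge>0. A \<inter> {\<omega>\<in>space M. P.T i \<omega> < q} \<in> sets (history (ennreal q))" and Aev[measurable]: "A \<in> events"
    and "0 < \<delta>" and g: "bounded_continuous g"
  defines "Q \<equiv> \<lambda>\<omega>. (real (grid_above \<delta> i \<omega>) + 1) * \<delta>"
  shows "expectation (\<lambda>\<omega>. of_bool (\<omega> \<in> A) * g (x + X (Q \<omega> + (real (nxt \<delta> (Q \<omega>) \<omega>) + 1) * \<delta>) \<omega>)) =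
         expectation (\<lambda>\<omega>. of_bool (\<omega> \<in> A) * grid_expo lam \<delta> g (x + X (Q \<omega>) \<omega>))"
    and "(\<lambda>\<omega>. of_bool (\<omega> \<in> A) * g (x + X (Q \<omega> + (real (nxt \<delta> (Q \<omega>) \<omega>) + 1) * \<delta>) \<omega>)) \<in> borel_measurable M"
    and "(\<lambda>\<omega>. of_bool (\<omega> \<in> A) * grid_expo lam \<delta> g (x + X (Q \<omega>) \<omega>)) \<in> borel_measurable M"
proof -
  let ?l = "(\<lambda>\<omega>. of_bool (\<omega> \<in> A) * g (x + X (Q \<omega> + (real (nxt \<delta> (Q \<omega>) \<omega>) + 1) * \<delta>) \<omega>))" and ?r = "(\<lambda>\<omega>. of_bool (\<omega> \<in> A) * grid_expo lam \<delta> g (x + X (Q \<omega>) \<omega>))"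
  obtain C where C: "0 \<le> C" "\<And>y. \<bar>g y\<bar> \<le> C" using g bounded_continuousE by blast
  have [measurable]: "g \<in> borel_measurable borel" by (rule bounded_continuous_measurable[OF g])
  have K[measurable]: "grid_expo lam \<delta> g \<in> borel_measurable borel"
  proof (rule borel_measurable_LIMSEQ_real)
    show "(\<lambda>n. \<Sum>j<n. (exp (- lam * (real j * \<delta>)) - exp (- lam * ((real j + 1) * \<delta>))) * transition ((real j + 1) * \<delta>) g y) \<longlonglongrightarrow> grid_expo lam \<delta> g y" for y
      using grid_expo_sums[OF P.rate_pos g \<open>0 < \<delta>\<close>] by (simp add: sums_def)
    show "(\<lambda>y. \<Sum>j<n. (exp (- lam * (real j * \<delta>)) - exp (- lam * ((real j + 1) * \<delta>))) * transition ((real j + 1) * \<delta>) g y) \<in> borel_measurable borel" for n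
      using bounded_continuous_measurable[OF bounded_continuous_transition[OF g]] by measurable
  qed
  let ?J = "grid_above \<delta> i"
  have J[measurable]: "?J \<in> measurable M (count_space UNIV)" by (rule measurable_grid_above)
  have XR: "(\<lambda>\<omega>. X ((real j + 1) * \<delta> + (real (nxt \<delta> ((real j + 1) * \<delta>) \<omega>) + 1) * \<delta>) \<omega>) \<in> borel_measurable M" for j
    using \<open>0 < \<delta>\<close> by (intro measurable_X_countable measurable_nxt) auto
  have [measurable]: "(\<lambda>\<omega>. X (Q \<omega> + (real (nxt \<delta> (Q \<omega>) \<omega>) + 1) * \<delta>) \<omega>) \<in> borel_measurable M"
    unfolding Q_def by (rule measurable_compose_countable[OF XR J])
  have [measurable]: "(\<lambda>\<omega>. X (Q \<omega>) \<omega>) \<in> borel_measurable M"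
    unfolding Q_def using \<open>0 < \<delta>\<close> by (intro measurable_X_countable J) auto
  show l: "?l \<in> borel_measurable M" and r: "?r \<in> borel_measurable M" by measurable
  have "(\<lambda>j. expectation (\<lambda>\<omega>. of_bool (?J \<omega> = j) * ?l \<omega>)) sums expectation ?l"
    by (rule expectation_partition_sums[OF J l, where C=C]) (use C in auto)
  moreover have "(\<lambda>j. expectation (\<lambda>\<omega>. of_bool (?J \<omega> = j) * ?r \<omega>)) sums expectation ?r"
    by (rule expectation_partition_sums[OF J r, where C=C]) (use C grid_expo_abs_le[OF P.rate_pos C(2)] in auto)
  moreover have "expectation (\<lambda>\<omega>. of_bool (?J \<omega> = j) * ?l \<omega>) = expectation (\<lambda>\<omega>. of_bool (?J \<omega> = j) * ?r \<omega>)" for j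
  proof -
    define q where "q = (real j + 1) * \<delta>"
    \<comment> \<open>The part of \<open>A\<close> whose \<open>i\<close>-th jump lies in the
      \<open>j\<close>-th cell, which is closed on the left and open on the right.\<close>
    define B where "B = A \<inter> {\<omega>\<in>space M. P.T i \<omega> < q} - A \<inter> {\<omega>\<in>space M. P.T i \<omega> < real j * \<delta>}"
    have q: "0 \<le> q" "0 \<le> real j * \<delta>" "real j * \<delta> \<le> q" using \<open>0 < \<delta>\<close> by (auto simp: q_def)
    have B: "B \<in> sets (history (ennreal q))"
      unfolding B_def using A[rule_format, OF q(1)] A[rule_format, OF q(2)] completed_history_mono[OF ennreal_leI[OF q(3)]] by (intro sets.Diff) auto
    have iff: "\<omega> \<in> B \<longleftrightarrow> ?J \<omega> = j \<and> \<omega> \<in> A" if "\<omega> \<in> space M" for \<omega>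
      using that unfolding B_def grid_above_iff[OF \<open>0 < \<delta>\<close>] q_def by auto
    have "expectation (\<lambda>\<omega>. of_bool (?J \<omega> = j) * ?l \<omega>) =
        expectation (\<lambda>\<omega>. of_bool (\<omega> \<in> B) * g (x + X (q + (real (nxt \<delta> q \<omega>) + 1) * \<delta>) \<omega>))"
      by (intro Bochner_Integration.integral_cong refl) (auto simp: iff Q_def q_def)
    also have "\<dots> = expectation (\<lambda>\<omega>. of_bool (\<omega> \<in> B) * grid_expo lam \<delta> g (x + X q \<omega>))"
      by (rule grid_markov[OF B q(1) \<open>0 < \<delta>\<close> g])
    also have "\<dots> = expectation (\<lambda>\<omega>. of_bool (?J \<omega> = j) * ?r \<omega>)"
      by (intro Bochner_Integration.integral_cong refl) (auto simp: iff Q_def q_def)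
    finally show ?thesis .
  qed
  ultimately show "expectation ?l = expectation ?r" using sums_unique2 by auto
qed

lemma grid_time_tendsto:
  assumes "\<delta> \<longlonglongrightarrow> 0" "\<And>m. 0 < \<delta> m"
  shows "(\<lambda>m. (real (grid_above (\<delta> m) i \<omega>) + 1) * \<delta> m) \<longlonglongrightarrow> P.T i \<omega>"
proof (rule real_tendsto_sandwich[of "\<lambda>_. P.T i \<omega>" _ _ "\<lambda>m. P.T i \<omega> + \<delta> m"])
  show "(\<lambda>m. P.T i \<omega> + \<delta> m) \<longlonglongrightarrow> P.T i \<omega>" using tendsto_add[OF tendsto_const assms(1)] by simp
qed (auto intro!: always_eventually less_imp_le grid_above_bounds assms(2))

lemma X_grid_time_tendsto:
  assumes "\<delta> \<longlonglongrightarrow> 0" "\<And>m. 0 < \<delta> m" "\<omega> \<in> space M"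
  shows "(\<lambda>m. X ((real (grid_above (\<delta> m) i \<omega>) + 1) * \<delta> m) \<omega>) \<longlonglongrightarrow> X (P.T i \<omega>) \<omega>"
  by (intro right_continuous grid_time_tendsto assms P.T_nonneg less_imp_le grid_above_bounds)

text \<open>Once the mesh is below the gap between the two jumps, the grid point after jump
  \<open>i\<close> still precedes jump \<open>i + 1\<close>, so the next jump found from there is
  the right one.\<close>

lemma grid_next_time_tendsto:
  fixes i :: nat
  assumes reg: "P.regular \<omega>" and \<delta>: "\<delta> \<longlonglongrightarrow> 0" "\<And>m. 0 < \<delta> m"
  defines "Q \<equiv> \<lambda>m. (real (grid_above (\<delta> m) i \<omega>) + 1) * \<delta> m"
  shows "(\<lambda>m. X (Q m + (real (nxt (\<delta> m) (Q m) \<omega>) + 1) * \<delta> m) \<omega>) \<longlonglongrightarrow> X (P.T (Suc i) \<omega>) \<omega>"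
proof -
  let ?t = "P.T (Suc i) \<omega>"
  define R where "R m = Q m + (real (nxt (\<delta> m) (Q m) \<omega>) + 1) * \<delta> m" for m
  have lt: "P.T i \<omega> < ?t" by (rule P.regularD(4)[OF reg])
  have Q: "P.T i \<omega> < Q m" "Q m \<le> P.T i \<omega> + \<delta> m" for m unfolding Q_def by (rule grid_above_bounds[OF \<delta>(2)])+
  have Q0: "0 \<le> Q m" for m using Q(1)[of m] P.T_nonneg[of i \<omega>] by simp
  have "eventually (\<lambda>m. \<delta> m < ?t - P.T i \<omega>) sequentially" using \<delta>(1) lt by (intro order_tendstoD(2)) auto
  then have ev: "eventually (\<lambda>m. ?t \<le> R m \<and> R m \<le> ?t + \<delta> m) sequentially"
  proof eventually_elim
    case (elim m)
    have Qt: "Q m < ?t" using elim Q(2)[of m] by simp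
    have iff: "P.T k \<omega> \<le> s \<longleftrightarrow> k \<le> N s \<omega>" if "0 \<le> s" for k s by (rule P.regularD(3)[OF reg that])
    have NQ: "N (Q m) \<omega> = i" using iff[OF Q0, of i m] iff[OF Q0, of "Suc i" m] Qt Q(1)[of m] by simp
    have nn: "0 \<le> Q m + real (nxt (\<delta> m) (Q m) \<omega>) * \<delta> m" using Q0[of m] \<delta>(2)[of m] by simp
    have "i < N (R m) \<omega>" using nxt_props(1)[OF reg \<delta>(2) Q0, of m] NQ by (simp add: R_def)
    then have 1: "?t \<le> R m" using iff[of "R m" "Suc i"] Q0[of m] \<delta>(2)[of m] by (simp add: R_def)
    have "\<not> ?t \<le> Q m + real (nxt (\<delta> m) (Q m) \<omega>) * \<delta> m"
      using nxt_props(2)[OF reg \<delta>(2) Q0, of m] NQ iff[OF nn, of "Suc i"] by simp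
    then have "R m \<le> ?t + \<delta> m" by (simp add: R_def distrib_right)
    with 1 show ?case by simp
  qed
  \<comment> \<open>\<open>R m\<close> is at least \<open>?t\<close> only from some \<open>m\<close>
    on; the maximum makes this hold throughout, as \<open>right_continuous\<close> asks.\<close>
  have "(\<lambda>m. max ?t (R m)) \<longlonglongrightarrow> ?t"
  proof (rule real_tendsto_sandwich[of "\<lambda>_. ?t" _ _ "\<lambda>m. ?t + \<delta> m"])
    show "(\<lambda>m. ?t + \<delta> m) \<longlonglongrightarrow> ?t" using tendsto_add[OF tendsto_const \<delta>(1)] by simp
    show "\<forall>\<^sub>F m in sequentially. max ?t (R m) \<le> ?t + \<delta> m" using ev by eventually_elim auto
  qed auto
  then have "(\<lambda>m. X (max ?t (R m)) \<omega>) \<longlonglongrightarrow> X ?t \<omega>"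
    using P.regularD(1)[OF reg] by (intro right_continuous P.T_nonneg) auto
  then show ?thesis
  proof (rule Lim_transform_eventually)
    show "\<forall>\<^sub>F m in sequentially. X (max ?t (R m)) \<omega> = X (Q m + (real (nxt (\<delta> m) (Q m) \<omega>) + 1) * \<delta> m) \<omega>"
      using ev by eventually_elim (simp add: R_def max_def)
  qed
qed

lemma mesh_tendsto: "(\<lambda>m. 1 / real (Suc m)) \<longlonglongrightarrow> 0"
  by (rule lim_1_over_n[THEN LIMSEQ_Suc])

text \<open>The limit of \<open>grid_step\<close>: the left side converges by right continuity at
  jump \<open>i + 1\<close>, the right side because the rounded resolvent tends to
  \<open>expo\<close> while its argument converges.\<close>

lemma strong_markov:
  assumes A: "\<forall>q\<ge>0. A \<inter> {\<omega>\<in>space M. P.T i \<omega> < q} \<in> sets (history (ennreal q))" and "A \<in> events"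
    and g: "bounded_continuous g"
  shows "expectation (\<lambda>\<omega>. of_bool (\<omega> \<in> A) * g (x + X (P.T (Suc i) \<omega>) \<omega>)) =
         expectation (\<lambda>\<omega>. of_bool (\<omega> \<in> A) * expo lam g (x + X (P.T i \<omega>) \<omega>))"
proof -
  obtain C where C: "0 \<le> C" "\<And>y. \<bar>g y\<bar> \<le> C" using g bounded_continuousE by blast
  define \<delta> where "\<delta> m = 1 / real (Suc m)" for m
  have \<delta>: "\<delta> \<longlonglongrightarrow> 0" "\<And>m. 0 < \<delta> m" unfolding \<delta>_def using mesh_tendsto by simp_all
  let ?Q = "\<lambda>m \<omega>. (real (grid_above (\<delta> m) i \<omega>) + 1) * \<delta> m"
  note step = grid_step[OF A assms(2) \<delta>(2) g]
  have "(\<lambda>m. expectation (\<lambda>\<omega>. of_bool (\<omega> \<in> A) * g (x + X (?Q m \<omega> + (real (nxt (\<delta> m) (?Q m \<omega>) \<omega>) + 1) * \<delta> m) \<omega>))) \<longlonglongrightarrow>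
    expectation (\<lambda>\<omega>. of_bool (\<omega> \<in> A) * g (x + X (P.T (Suc i) \<omega>) \<omega>))"
  proof (rule bounded_convergence_complete[where C=C])
    show "AE \<omega> in M. (\<lambda>m. of_bool (\<omega> \<in> A) * g (x + X (?Q m \<omega> + (real (nxt (\<delta> m) (?Q m \<omega>) \<omega>) + 1) * \<delta> m) \<omega>)) \<longlonglongrightarrow>
        of_bool (\<omega> \<in> A) * g (x + X (P.T (Suc i) \<omega>) \<omega>)"
      using P.AE_regular
    proof eventually_elim
      case (elim \<omega>)
      show ?case by (intro tendsto_mult tendsto_const bounded_continuous_tendsto[OF g] tendsto_add grid_next_time_tendsto elim \<delta>)
    qed
  qed (use step(2) C in auto)
  moreover have "(\<lambda>m. expectation (\<lambda>\<omega>. of_bool (\<omega> \<in> A) * grid_expo lam (\<delta> m) g (x + X (?Q m \<omega>) \<omega>))) \<longlonglongrightarrow>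
    expectation (\<lambda>\<omega>. of_bool (\<omega> \<in> A) * expo lam g (x + X (P.T i \<omega>) \<omega>))"
  proof (rule bounded_convergence_complete[where C=C])
    show "AE \<omega> in M. (\<lambda>m. of_bool (\<omega> \<in> A) * grid_expo lam (\<delta> m) g (x + X (?Q m \<omega>) \<omega>)) \<longlonglongrightarrow>
        of_bool (\<omega> \<in> A) * expo lam g (x + X (P.T i \<omega>) \<omega>)"
      by (intro AE_I2 tendsto_mult tendsto_const grid_expo_tendsto P.rate_pos g \<delta> tendsto_add X_grid_time_tendsto)
  qed (use step(3) C grid_expo_abs_le[OF P.rate_pos C(2)] in auto)
  ultimately show ?thesis unfolding step(1) by (rule LIMSEQ_unique)
qed

lemma measurable_X_T: "(\<lambda>\<omega>. X (P.T i \<omega>) \<omega>) \<in> borel_measurable M"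
proof (rule borel_measurable_AE_limit)
  show "(\<lambda>\<omega>. X ((real (grid_above (1 / real (Suc m)) i \<omega>) + 1) * (1 / real (Suc m))) \<omega>) \<in> borel_measurable M" for m
    by (rule measurable_X_countable[OF measurable_grid_above]) simp
  show "AE \<omega> in M. (\<lambda>m. X ((real (grid_above (1 / real (Suc m)) i \<omega>) + 1) * (1 / real (Suc m))) \<omega>) \<longlonglongrightarrow> X (P.T i \<omega>) \<omega>"
    by (intro AE_I2 X_grid_time_tendsto[OF mesh_tendsto]) auto
qed

text \<open>The margin between \<open>t\<close> and \<open>u\<close> leaves room for rounding the
  jump time up: grid times capped at \<open>u\<close> stay inside the history of \<open>u\<close>
  and still converge to the jump from the right.\<close>

lemma X_T_history:
  assumes "0 \<le> t" "t < u" and D: "D \<in> sets borel"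
  shows "{\<omega>\<in>space M. P.T i \<omega> \<le> t \<and> X (P.T i \<omega>) \<omega> \<in> D} \<in> sets (history (ennreal u))"
proof -
  let ?H = "history (ennreal u)"
  have tu: "ennreal t \<le> ennreal u" using assms by (intro ennreal_leI) simp
  have le: "Measurable.pred ?H (\<lambda>\<omega>. P.T i \<omega> \<le> s)" if "0 \<le> s" "s \<le> t" for s
    using T_le_history[of s "ennreal u" i] that assms by (simp add: pred_def ennreal_leI)
  \<comment> \<open>Set to 0 for jumps after \<open>t\<close>, so that it is determined by the
    history up to \<open>u\<close>.\<close>
  define T' where "T' \<omega> = (if P.T i \<omega> \<le> t then P.T i \<omega> else 0)" for \<omega>
  have T'[measurable]: "T' \<in> borel_measurable ?H"
  proof (rule borel_measurableI_le)
    fix s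
    consider "s < 0" | "0 \<le> s" "s \<le> t" | "t < s" by linarith
    then show "{\<omega>\<in>space ?H. T' \<omega> \<le> s} \<in> sets ?H"
    proof cases
      case 1
      then have "\<not> T' \<omega> \<le> s" for \<omega> using P.T_nonneg[of i \<omega>] by (auto simp: T'_def)
      then show ?thesis by simp
    next
      case 2
      then have e: "{\<omega>\<in>space ?H. T' \<omega> \<le> s} = {\<omega>\<in>space ?H. P.T i \<omega> \<le> s} \<union> (space ?H - {\<omega>\<in>space ?H. P.T i \<omega> \<le> t})"
        by (auto simp: T'_def)
      have *: "{\<omega>\<in>space ?H. P.T i \<omega> \<le> s} \<in> sets ?H" "{\<omega>\<in>space ?H. P.T i \<omega> \<le> t} \<in> sets ?H"
        using le[of s] le[of t] 2 assms by (simp_all add: pred_def)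
      show ?thesis unfolding e by (intro sets.Un sets.compl_sets *)
    next
      case 3
      then have "{\<omega>\<in>space ?H. T' \<omega> \<le> s} = space ?H" using assms by (auto simp: T'_def)
      then show ?thesis using sets.top[of ?H] by simp
    qed
  qed
  define \<delta> where "\<delta> m = 1 / real (Suc m)" for m
  have \<delta>: "\<delta> \<longlonglongrightarrow> 0" "\<And>m. 0 < \<delta> m" unfolding \<delta>_def using mesh_tendsto by simp_all
  define a where "a m \<omega> = nat \<lfloor>T' \<omega> / \<delta> m\<rfloor>" for m \<omega>
  have [measurable]: "a m \<in> measurable ?H (count_space UNIV)" for m unfolding a_def by measurable
  have Xm: "X (min ((real j + 1) * \<delta> m) u) \<in> borel_measurable ?H" for j m
    using \<delta>(2)[of m] assms by (intro measurable_history ennreal_leI) auto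
  have Zm[measurable]: "(\<lambda>\<omega>. X (min ((real (a m \<omega>) + 1) * \<delta> m) u) \<omega>) \<in> borel_measurable ?H" for m
    by (rule measurable_compose_countable[OF Xm]) measurable
  have "(\<lambda>\<omega>. if P.T i \<omega> \<le> t then X (P.T i \<omega>) \<omega> else 0) \<in> borel_measurable ?H"
  proof (rule borel_measurable_LIMSEQ_real)
    show "(\<lambda>\<omega>. if P.T i \<omega> \<le> t then X (min ((real (a m \<omega>) + 1) * \<delta> m) u) \<omega> else 0) \<in> borel_measurable ?H" for m
      using le[of t] assms(1) by measurable
    fix \<omega> assume "\<omega> \<in> space ?H"
    then have \<omega>: "\<omega> \<in> space M" by simp
    show "(\<lambda>m. if P.T i \<omega> \<le> t then X (min ((real (a m \<omega>) + 1) * \<delta> m) u) \<omega> else 0) \<longlonglongrightarrow> (if P.T i \<omega> \<le> t then X (P.T i \<omega>) \<omega> else 0)"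
    proof (cases "P.T i \<omega> \<le> t")
      case True
      then have am: "a m \<omega> = grid_above (\<delta> m) i \<omega>" for m by (simp add: a_def grid_above_def T'_def)
      have "(\<lambda>m. min ((real (a m \<omega>) + 1) * \<delta> m) u) \<longlonglongrightarrow> min (P.T i \<omega>) u"
        unfolding am by (intro tendsto_min tendsto_const grid_time_tendsto \<delta>)
      moreover have "P.T i \<omega> \<le> min ((real (a m \<omega>) + 1) * \<delta> m) u" for m
        using grid_above_bounds(1)[OF \<delta>(2), of i \<omega> m] True assms(2) by (simp add: am)
      ultimately show ?thesis using True assms(2) \<omega> by (simp, intro right_continuous P.T_nonneg) (auto simp: min_def)
    qed simp
  qed
  note * = measurable_sets[OF this D]
  have "(\<lambda>\<omega>. if P.T i \<omega> \<le> t then X (P.T i \<omega>) \<omega> else 0) -` D \<inter> space ?H \<inter> {\<omega>\<in>space ?H. P.T i \<omega> \<le> t} \<in> sets ?H"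
    by (rule sets.Int[OF *]) (use le[of t] assms(1) in \<open>simp add: pred_def\<close>)
  also have "(\<lambda>\<omega>. if P.T i \<omega> \<le> t then X (P.T i \<omega>) \<omega> else 0) -` D \<inter> space ?H \<inter> {\<omega>\<in>space ?H. P.T i \<omega> \<le> t} =
      {\<omega>\<in>space M. P.T i \<omega> \<le> t \<and> X (P.T i \<omega>) \<omega> \<in> D}" by auto
  finally show ?thesis .
qed

end

subsection \<open>The randomized value is given by the recursion\<close>

context complete_prob_space
begin

lemma sets_nat_filtration:
  "sets (nat_filtration M S Y t) = (\<Inter>u\<in>insert \<infinity> {t<..}. sets (completed_history M S Y u))"
proof -
  let ?I = "\<Inter>u\<in>insert \<infinity> {t<..}. sets (completed_history M S Y u)"
  have "?I \<subseteq> Pow (space M)" using sets.sets_into_space[of _ "completed_history M S Y \<infinity>"] by auto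
  then have "sets (nat_filtration M S Y t) = sigma_sets (space M) ?I" unfolding nat_filtration_def by (rule sets_measure_of)
  moreover have "sigma_sets (space M) ?I \<subseteq> sets (completed_history M S Y u)" if "u \<in> insert \<infinity> {t<..}" for u
  proof -
    have "?I \<subseteq> sets (completed_history M S Y u)" using that by blast
    from sets.sigma_sets_subset[OF this] show ?thesis by simp
  qed
  ultimately show ?thesis by (auto intro: sigma_sets.Basic)
qed

lemma space_nat_filtration: "space (nat_filtration M S Y t) = space M"
  unfolding nat_filtration_def by (rule space_measure_of_conv)

lemma stopping_time_nat_filtration_iff:
  "stopping_time (nat_filtration M S Y) \<tau> \<longleftrightarrow>
     (\<forall>t. \<forall>u\<in>insert \<infinity> {t<..}. {\<omega>\<in>space M. \<tau> \<omega> \<le> t} \<in> sets (completed_history M S Y u))"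
  by (simp add: stopping_time_def pred_def sets_nat_filtration space_nat_filtration)

end

context complete_levy_process
begin

primrec rand_iter :: "real \<Rightarrow> real \<Rightarrow> (real \<Rightarrow> real) \<Rightarrow> nat \<Rightarrow> real \<Rightarrow> real" where
  "rand_iter l \<beta> f 0 = f"
| "rand_iter l \<beta> f (Suc k) = (\<lambda>y. max (f y) (\<beta> * expo l (rand_iter l \<beta> f k) y))"

lemma bounded_continuous_rand_iter:
  assumes "0 < l" "bounded_continuous f"
  shows "bounded_continuous (rand_iter l \<beta> f k)"
  by (induction k) (auto intro!: bounded_continuous_max bounded_continuous_expo assms)

end

context levy_poisson
begin

text \<open>Jump times are distinct on a regular path, so a single term of the discount series
  survives.\<close>

lemma payoff_at_jump:
  assumes reg: "P.regular \<omega>" and \<sigma>: "\<sigma> \<omega> = ennreal (P.T m \<omega>)"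
  shows "discount r n N \<sigma> \<omega> * f (x + at_time X \<sigma> \<omega>) = exp (- r / real n) ^ m * f (x + X (P.T m \<omega>) \<omega>)"
proof -
  have eq: "\<sigma> \<omega> = jump_time N i \<omega> \<longleftrightarrow> i = m" for i
    using P.regularD(2,5)[OF reg] strict_mono_eq[of "\<lambda>k. P.T k \<omega>"] by (auto simp: \<sigma> P.T_nonneg)
  have "discount r n N \<sigma> \<omega> = (\<Sum>i\<in>{m}. of_bool (\<sigma> \<omega> = jump_time N i \<omega>) * exp (- r * real i / real n))"
    unfolding discount_def by (rule suminf_finite) (auto simp: eq)
  also have "\<dots> = exp (- r / real n) ^ m" by (simp add: eq exp_of_nat_mult[symmetric] mult.commute)
  finally show ?thesis by (simp add: at_time_def \<sigma> P.T_nonneg)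
qed

text \<open>Arbitrary off the regular paths, where the jump times need not be distinct.\<close>

definition jump_index :: "('a \<Rightarrow> ennreal) \<Rightarrow> 'a \<Rightarrow> nat" where
  "jump_index \<tau> \<omega> = (LEAST i. \<tau> \<omega> = jump_time N i \<omega>)"

lemma jump_index_unique: "P.regular \<omega> \<Longrightarrow> \<tau> \<omega> = jump_time N i \<omega> \<Longrightarrow> jump_index \<tau> \<omega> = i"
  unfolding jump_index_def
  by (rule Least_equality) (auto simp: P.regularD(2) P.T_nonneg strict_mono_eq[OF P.regularD(5)])

lemma jump_index:
  assumes "\<tau> \<in> jump_stopping_times M X N" "P.regular \<omega>"
  shows "\<tau> \<omega> = ennreal (P.T (jump_index \<tau> \<omega>) \<omega>)"
proof -
  obtain i where "\<tau> \<omega> = jump_time N i \<omega>"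
    using assms P.regularD(1)[OF assms(2)] unfolding jump_stopping_times_def by auto
  then show ?thesis using jump_index_unique[of \<omega> \<tau> i] P.regularD(2)[OF assms(2)] assms(2) by simp
qed

lemma min_jump_time:
  assumes "\<tau> \<in> jump_stopping_times M X N" "P.regular \<omega>"
  shows "min (\<tau> \<omega>) (jump_time N k \<omega>) = ennreal (P.T (min (jump_index \<tau> \<omega>) k) \<omega>)"
  using strict_mono_less_eq[OF P.regularD(5)[OF assms(2)], of "jump_index \<tau> \<omega>" k]
  unfolding jump_index[OF assms] P.regularD(2)[OF assms(2)]
  by (auto simp: min_def P.T_nonneg)

lemma jump_stopping_time_history:
  assumes "\<tau> \<in> jump_stopping_times M X N" "t < u"
  shows "{\<omega>\<in>space M. \<tau> \<omega> \<le> t} \<in> sets (history u)"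
  using assms unfolding jump_stopping_times_def stopping_time_nat_filtration_iff by auto

lemma measurable_jump_index:
  assumes \<tau>: "\<tau> \<in> jump_stopping_times M X N"
  shows "jump_index \<tau> \<in> measurable M (count_space UNIV)"
proof -
  have [measurable]: "\<tau> \<in> borel_measurable M"
  proof (rule borel_measurableI_le)
    fix t
    show "{\<omega>\<in>space M. \<tau> \<omega> \<le> t} \<in> events"
      using \<tau> sets_history_subset[of \<infinity>] unfolding jump_stopping_times_def stopping_time_nat_filtration_iff by auto
  qed
  have [measurable]: "jump_time N i \<in> borel_measurable M" for i
  proof (rule measurable_if_AE_eq)
    show "(\<lambda>\<omega>. ennreal (P.T i \<omega>)) \<in> borel_measurable M" using measurable_T by measurable
    show "AE \<omega> in M. ennreal (P.T i \<omega>) = jump_time N i \<omega>"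
      using P.AE_regular by eventually_elim (simp add: P.regularD(2))
  qed auto
  show ?thesis unfolding jump_index_def by measurable
qed

text \<open>Not having exercised by jump \<open>i\<close> means that \<open>\<tau>\<close> exceeds
  that jump time. A rational between the two and below \<open>q\<close> expresses this through the
  history of \<open>q\<close>, in the form that \<open>strong_markov\<close> takes.\<close>

lemma jump_index_history:
  assumes \<tau>: "\<tau> \<in> jump_stopping_times M X N"
  shows "\<forall>q\<ge>0. {\<omega>\<in>space M. i < jump_index \<tau> \<omega>} \<inter> {\<omega>\<in>space M. P.T i \<omega> < q} \<in> sets (history (ennreal q))"
proof (intro allI impI)
  fix q :: real assume q: "0 \<le> q"
  let ?U = "\<Union>p\<in>\<rat> \<inter> {0..<q}. {\<omega>\<in>space M. P.T i \<omega> \<le> p} - {\<omega>\<in>space M. \<tau> \<omega> \<le> ennreal p}"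
  show "{\<omega>\<in>space M. i < jump_index \<tau> \<omega>} \<inter> {\<omega>\<in>space M. P.T i \<omega> < q} \<in> sets (history (ennreal q))"
  proof (rule completed_history_if_AE_eq)
    show "?U \<in> sets (history (ennreal q))"
      by (intro sets.countable_UN'' countable_Int1 countable_rat sets.Diff T_le_history jump_stopping_time_history[OF \<tau>])
         (auto intro!: ennreal_leI ennreal_lessI)
    show "AE \<omega> in M. \<omega> \<in> ?U \<longleftrightarrow> \<omega> \<in> {\<omega>\<in>space M. i < jump_index \<tau> \<omega>} \<inter> {\<omega>\<in>space M. P.T i \<omega> < q}"
      using P.AE_regular
    proof eventually_elim
      case (elim \<omega>)
      let ?t = "P.T (jump_index \<tau> \<omega>) \<omega>"
      have "\<omega> \<in> ?U \<longleftrightarrow> (\<exists>p\<in>\<rat>. 0 \<le> p \<and> p < q \<and> P.T i \<omega> \<le> p \<and> p < ?t)"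
        using P.regularD(1)[OF elim] by (auto simp: jump_index[OF \<tau> elim] not_le P.T_nonneg ennreal_less_iff)
      also have "\<dots> \<longleftrightarrow> P.T i \<omega> < q \<and> P.T i \<omega> < ?t"
      proof
        assume *: "P.T i \<omega> < q \<and> P.T i \<omega> < ?t"
        then obtain p where "p \<in> \<rat>" "P.T i \<omega> < p" "p < min q ?t" using Rats_dense_in_real[of "P.T i \<omega>" "min q ?t"] by auto
        then show "\<exists>p\<in>\<rat>. 0 \<le> p \<and> p < q \<and> P.T i \<omega> \<le> p \<and> p < ?t" using P.T_nonneg[of i \<omega>] by (intro bexI[of _ p]) auto
      qed auto
      also have "\<dots> \<longleftrightarrow> \<omega> \<in> {\<omega>\<in>space M. i < jump_index \<tau> \<omega>} \<inter> {\<omega>\<in>space M. P.T i \<omega> < q}"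
        using P.regularD(1)[OF elim] strict_mono_less[OF P.regularD(5)[OF elim]] by auto
      finally show ?case .
    qed
  qed auto
qed

context
  fixes f :: "real \<Rightarrow> real" and r x :: real and n :: nat
  assumes f: "bounded_continuous f"
begin

definition payoff :: "nat \<Rightarrow> ('a \<Rightarrow> ennreal) \<Rightarrow> real" where
  "payoff k \<tau> = (let \<sigma> = (\<lambda>\<omega>. min (\<tau> \<omega>) (jump_time N k \<omega>)) in
        (\<integral>\<omega>. discount r n N \<sigma> \<omega> * f (x + at_time X \<sigma> \<omega>) \<partial>completion M))"

text \<open>Both integrands agree on regular paths; completeness transfers measurability from the
  right one to the left one.\<close>

lemma payoff_eq:
  assumes \<tau>: "\<tau> \<in> jump_stopping_times M X N"
  shows "payoff k \<tau> = expectation (\<lambda>\<omega>. exp (- r / real n) ^ min (jump_index \<tau> \<omega>) k * f (x + X (P.T (min (jump_index \<tau> \<omega>) k) \<omega>) \<omega>))"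
proof -
  let ?\<sigma> = "\<lambda>\<omega>. min (\<tau> \<omega>) (jump_time N k \<omega>)"
  let ?l = "\<lambda>\<omega>. discount r n N ?\<sigma> \<omega> * f (x + at_time X ?\<sigma> \<omega>)"
  let ?r = "\<lambda>\<omega>. exp (- r / real n) ^ min (jump_index \<tau> \<omega>) k * f (x + X (P.T (min (jump_index \<tau> \<omega>) k) \<omega>) \<omega>)"
  have [measurable]: "f \<in> borel_measurable borel" by (rule bounded_continuous_measurable[OF f])
  have J[measurable]: "jump_index \<tau> \<in> measurable M (count_space UNIV)" by (rule measurable_jump_index[OF \<tau>])
  have "(\<lambda>\<omega>. X (P.T (min (jump_index \<tau> \<omega>) k) \<omega>) \<omega>) \<in> borel_measurable M"
    by (rule measurable_compose_countable[where f="\<lambda>i \<omega>. X (P.T (min i k) \<omega>) \<omega>", OF measurable_X_T J])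
  then have r: "?r \<in> borel_measurable M" by measurable
  have ae: "AE \<omega> in M. ?l \<omega> = ?r \<omega>"
    using P.AE_regular
  proof eventually_elim
    case (elim \<omega>)
    show ?case by (rule payoff_at_jump[where \<sigma>="?\<sigma>", OF elim]) (rule min_jump_time[OF \<tau> elim])
  qed
  then have "AE \<omega> in M. ?r \<omega> = ?l \<omega>" by eventually_elim simp
  then have "?l \<in> borel_measurable M" using r by (intro measurable_if_AE_eq[OF r]) auto
  then show ?thesis unfolding payoff_def Let_def complete using r ae by (intro integral_cong_AE)
qed

lemma expectation_rand_iter_start:
  "expectation (\<lambda>\<omega>. rand_iter lam \<beta> f k (x + X (P.T 0 \<omega>) \<omega>)) = rand_iter lam \<beta> f k x"
  unfolding P.T_0
  by (intro expectation_start bounded_continuous_measurable bounded_continuous_rand_iter f P.rate_pos)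

lemma jump_index_step:
  assumes \<tau>: "\<tau> \<in> jump_stopping_times M X N" and g: "bounded_continuous g"
  shows "expectation (\<lambda>\<omega>. of_bool (i < jump_index \<tau> \<omega>) * g (x + X (P.T (Suc i) \<omega>) \<omega>)) =
         expectation (\<lambda>\<omega>. of_bool (i < jump_index \<tau> \<omega>) * expo lam g (x + X (P.T i \<omega>) \<omega>))"
proof -
  have "{\<omega>\<in>space M. i < jump_index \<tau> \<omega>} \<in> events" using measurable_jump_index[OF \<tau>] by measurable
  note sm = strong_markov[OF jump_index_history[OF \<tau>] this g, of x]
  have "expectation (\<lambda>\<omega>. of_bool (i < jump_index \<tau> \<omega>) * h \<omega>) =
     expectation (\<lambda>\<omega>. of_bool (\<omega> \<in> {\<omega>\<in>space M. i < jump_index \<tau> \<omega>}) * h \<omega>)" for h :: "'a \<Rightarrow> real"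
    by (intro Bochner_Integration.integral_cong) auto
  then show ?thesis using sm by simp
qed

text \<open>Optimal stopping of the chain formed by \<open>X\<close> at the jumps; the strong Markov
  property supplies its one-step operator.\<close>

lemma payoff_le:
  assumes \<tau>: "\<tau> \<in> jump_stopping_times M X N"
  shows "payoff k \<tau> \<le> rand_iter lam (exp (- r / real n)) f k x"
    and "(AE \<omega> in M. jump_index \<tau> \<omega> = (LEAST i. rand_iter lam (exp (- r / real n)) f (k - i) (x + X (P.T i \<omega>) \<omega>) \<le> f (x + X (P.T i \<omega>) \<omega>))) \<Longrightarrow>
       payoff k \<tau> = rand_iter lam (exp (- r / real n)) f k x"
proof -
  let ?w = "rand_iter lam (exp (- r / real n)) f"
  note bc = bounded_continuous_rand_iter[OF P.rate_pos f]
  note os = optimal_stopping_le[of "\<lambda>i \<omega>. x + X (P.T i \<omega>) \<omega>" "jump_index \<tau>" ?w "\<lambda>j. expo lam (?w j)" "exp (- r / real n)" f k,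
    OF borel_measurable_add[OF borel_measurable_const measurable_X_T] measurable_jump_index[OF \<tau>] bc bounded_continuous_expo[OF P.rate_pos bc] _ _ _
      jump_index_step[OF \<tau> bc], unfolded expectation_rand_iter_start, folded payoff_eq[OF \<tau>]]
  show "payoff k \<tau> \<le> ?w k x" by (rule os(1)) auto
  show "payoff k \<tau> = ?w k x" if "AE \<omega> in M. jump_index \<tau> \<omega> = (LEAST i. ?w (k - i) (x + X (P.T i \<omega>) \<omega>) \<le> f (x + X (P.T i \<omega>) \<omega>))"
    by (rule os(2)) (use that in auto)
qed

definition first_exercise :: "nat \<Rightarrow> 'a \<Rightarrow> nat" where
  "first_exercise k \<omega> = (LEAST i. rand_iter lam (exp (- r / real n)) f (k - i) (x + X (P.T i \<omega>) \<omega>) \<le> f (x + X (P.T i \<omega>) \<omega>))"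

text \<open>Exercise by time \<open>s\<close> means that some jump \<open>i \<le> k\<close> has come
  by \<open>s\<close>, with its position in the exercise region and all earlier positions outside
  theirs. Such positions are known at every time after \<open>s\<close>, which is what the
  right-continuous filtration asks.\<close>

lemma first_exercise_stopping: "(\<lambda>\<omega>. jump_time N (first_exercise k \<omega>) \<omega>) \<in> jump_stopping_times M X N"
proof -
  let ?w = "rand_iter lam (exp (- r / real n)) f"
  let ?\<tau> = "\<lambda>\<omega>. jump_time N (first_exercise k \<omega>) \<omega>"
  define D where "D i = {z. ?w (k - i) (x + z) \<le> f (x + z)}" for i
  have [measurable]: "?w j \<in> borel_measurable borel" "f \<in> borel_measurable borel" for j
    using bounded_continuous_rand_iter[OF P.rate_pos f] f by (auto intro: bounded_continuous_measurable)
  have D: "D i \<in> sets borel" "- D i \<in> sets borel" for i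
  proof -
    have "{z \<in> space borel. ?w (k - i) (x + z) \<le> f (x + z)} \<in> sets borel" by measurable
    then show "D i \<in> sets borel" by (simp add: D_def)
    then show "- D i \<in> sets borel" by (rule borel_comp)
  qed
  have fe: "first_exercise k \<omega> = (LEAST i. X (P.T i \<omega>) \<omega> \<in> D i)" for \<omega> by (simp add: first_exercise_def D_def)
  \<comment> \<open>With no steps left the recursion equals \<open>f\<close>, so the region with
    index \<open>k\<close> is everything and exercise comes at jump \<open>k\<close> at the
    latest.\<close>
  have Dk: "z \<in> D k" for z by (simp add: D_def)
  have fe_iff: "first_exercise k \<omega> = i \<longleftrightarrow> X (P.T i \<omega>) \<omega> \<in> D i \<and> (\<forall>j<i. X (P.T j \<omega>) \<omega> \<notin> D j)" for \<omega> i
  proof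
    have "X (P.T (first_exercise k \<omega>) \<omega>) \<omega> \<in> D (first_exercise k \<omega>)" unfolding fe by (rule LeastI[of _ k]) (rule Dk)
    moreover have "X (P.T j \<omega>) \<omega> \<notin> D j" if "j < first_exercise k \<omega>" for j
      using that not_less_Least[of j "\<lambda>i. X (P.T i \<omega>) \<omega> \<in> D i"] unfolding fe by simp
    moreover assume "first_exercise k \<omega> = i"
    ultimately show "X (P.T i \<omega>) \<omega> \<in> D i \<and> (\<forall>j<i. X (P.T j \<omega>) \<omega> \<notin> D j)" by blast
  next
    assume *: "X (P.T i \<omega>) \<omega> \<in> D i \<and> (\<forall>j<i. X (P.T j \<omega>) \<omega> \<notin> D j)"
    then have "i \<le> j" if "X (P.T j \<omega>) \<omega> \<in> D j" for j using that leI by blast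
    with * show "first_exercise k \<omega> = i" unfolding fe by (intro Least_equality) auto
  qed
  have fe_le: "first_exercise k \<omega> \<le> k" for \<omega> unfolding fe using Dk by (intro Least_le)
  have "stopping_time (nat_filtration M (borel \<Otimes>\<^sub>M count_space UNIV) (\<lambda>t \<omega>. (X t \<omega>, N t \<omega>))) ?\<tau>"
    unfolding stopping_time_nat_filtration_iff
  proof (intro allI ballI)
    fix t u :: ennreal assume u: "u \<in> insert \<infinity> {t<..}"
    show "{\<omega>\<in>space M. ?\<tau> \<omega> \<le> t} \<in> sets (history u)"
    proof (cases t rule: ennreal_cases)
      case top
      then show ?thesis using sets.top[of "history u"] by simp
    next
      case (real s)
      \<comment> \<open>A finite time strictly after \<open>s\<close> and within \<open>u\<close>;
        for infinite \<open>u\<close> any later time serves.\<close>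
      obtain s' where s': "s < s'" "ennreal s' \<le> u"
      proof (cases u rule: ennreal_cases)
        case top then show ?thesis using that[of "s + 1"] by simp
      next
        case (real z)
        then show ?thesis using that[of z] u \<open>t = ennreal s\<close> \<open>0 \<le> s\<close> by (auto simp: ennreal_less_iff)
      qed
      \<comment> \<open>The clause \<open>P.T j \<omega> \<le> s\<close> for earlier jumps follows
        from \<open>P.T i \<omega> \<le> s\<close>; it puts their positions into the form of
        \<open>X_T_history\<close>.\<close>
      define E where "E i = {\<omega>\<in>space M. P.T i \<omega> \<le> s \<and> X (P.T i \<omega>) \<omega> \<in> D i} \<inter>
         (space M \<inter> (\<Inter>j\<in>{..<i}. {\<omega>\<in>space M. P.T j \<omega> \<le> s \<and> X (P.T j \<omega>) \<omega> \<in> - D j}))" for i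
      have "E i \<in> sets (history (ennreal s'))" for i
      proof -
        have "space M \<inter> (\<Inter>j\<in>{..<i}. {\<omega>\<in>space M. P.T j \<omega> \<le> s \<and> X (P.T j \<omega>) \<omega> \<in> - D j}) \<in> sets (history (ennreal s'))"
        proof (cases i)
          case 0
          then show ?thesis using sets.top[of "history (ennreal s')"] by simp
        next
          case (Suc m)
          have "(\<Inter>j\<in>{..<i}. {\<omega>\<in>space M. P.T j \<omega> \<le> s \<and> X (P.T j \<omega>) \<omega> \<in> - D j}) \<in> sets (history (ennreal s'))"
            using real s' D Suc by (intro sets.finite_INT X_T_history) auto
          from sets.Int[OF sets.top[of "history (ennreal s')"] this] show ?thesis by simp
        qed
        then show ?thesis unfolding E_def by (intro sets.Int[OF X_T_history[OF real(1) s'(1) D(1)]])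
      qed
      then have U: "(\<Union>i\<in>{..k}. E i) \<in> sets (history u)"
        using completed_history_mono[OF s'(2)] by (intro sets.finite_UN) auto
      show ?thesis
      proof (rule completed_history_if_AE_eq[OF U])
        show "AE \<omega> in M. \<omega> \<in> (\<Union>i\<in>{..k}. E i) \<longleftrightarrow> \<omega> \<in> {\<omega>\<in>space M. ?\<tau> \<omega> \<le> t}"
          using P.AE_regular
        proof eventually_elim
          case (elim \<omega>)
          note \<omega> = P.regularD(1)[OF elim]
          have mono: "P.T j \<omega> \<le> P.T i \<omega>" if "j < i" for i j
            using strict_mono_less[OF P.regularD(5)[OF elim], of j i] that by simp
          have "\<omega> \<in> E i \<longleftrightarrow> P.T i \<omega> \<le> s \<and> first_exercise k \<omega> = i" for i
            unfolding fe_iff E_def using \<omega> mono[of _ i] by (auto intro: order_trans)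
          then have "\<omega> \<in> (\<Union>i\<in>{..k}. E i) \<longleftrightarrow> P.T (first_exercise k \<omega>) \<omega> \<le> s"
            using fe_le[of \<omega>] by auto
          also have "\<dots> \<longleftrightarrow> \<omega> \<in> {\<omega>\<in>space M. ?\<tau> \<omega> \<le> t}"
            using \<omega> real by (simp add: P.regularD(2)[OF elim])
          finally show ?case .
        qed
      qed auto
    qed
  qed
  then show ?thesis unfolding jump_stopping_times_def by auto
qed

text \<open>The first-exercise rule attains the bound of \<open>payoff_le\<close>, so the supremum
  is a maximum.\<close>

lemma rand_value_eq: "rand_value M X N r f n k x = rand_iter lam (exp (- r / real n)) f k x"
proof -
  let ?\<tau> = "\<lambda>\<omega>. jump_time N (first_exercise k \<omega>) \<omega>"
  have "AE \<omega> in M. jump_index ?\<tau> \<omega> = first_exercise k \<omega>"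
    using P.AE_regular by eventually_elim (rule jump_index_unique, auto)
  then have "payoff k ?\<tau> = rand_iter lam (exp (- r / real n)) f k x"
    by (intro payoff_le(2)[OF first_exercise_stopping]) (simp add: first_exercise_def)
  then have "rand_iter lam (exp (- r / real n)) f k x \<in> payoff k ` jump_stopping_times M X N"
    using first_exercise_stopping[of k] by (intro image_eqI[where x="?\<tau>"]) simp_all
  then have "Sup (payoff k ` jump_stopping_times M X N) = rand_iter lam (exp (- r / real n)) f k x"
    by (rule cSup_eq_maximum) (blast intro: payoff_le(1))
  then show ?thesis unfolding rand_value_def payoff_def by simp
qed

end

end

subsection \<open>Bermudan approximation of the value function\<close>

lemma abs_exp_minus_diff_le:
  assumes "0 \<le> a" "0 \<le> (b :: real)"
  shows "\<bar>exp (- a) - exp (- b)\<bar> \<le> \<bar>a - b\<bar>"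
proof -
  have *: "exp (- a) - exp (- b) \<le> b - a" if "0 \<le> a" "a \<le> b" for a b :: real
  proof -
    have "exp (- a) - exp (- b) = exp (- a) * (1 - exp (a - b))" by (simp add: algebra_simps exp_diff exp_minus field_simps)
    also have "1 - exp (a - b) \<le> b - a" using exp_ge_add_one_self[of "a - b"] by linarith
    then have "exp (- a) * (1 - exp (a - b)) \<le> 1 * (b - a)" using that by (intro mult_mono) auto
    finally show ?thesis by simp
  qed
  show ?thesis using *[of a b] *[of b a] assms by (cases "a \<le> b") auto
qed

context complete_levy_process
begin

primrec bermudan :: "real \<Rightarrow> real \<Rightarrow> (real \<Rightarrow> real) \<Rightarrow> nat \<Rightarrow> real \<Rightarrow> real" where
  "bermudan \<beta> h f 0 = f"
| "bermudan \<beta> h f (Suc k) = (\<lambda>y. max (f y) (\<beta> * transition h (bermudan \<beta> h f k) y))"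

lemma bounded_continuous_bermudan: "bounded_continuous f \<Longrightarrow> bounded_continuous (bermudan \<beta> h f k)"
  by (induction k) (auto intro!: bounded_continuous_max bounded_continuous_transition)

lemma bermudan_abs_le:
  assumes "\<And>y. \<bar>f y\<bar> \<le> C" "0 \<le> \<beta>" "\<beta> \<le> 1"
  shows "\<bar>bermudan \<beta> h f k y\<bar> \<le> C"
proof (induction k arbitrary: y)
  case (Suc k)
  have "\<bar>\<beta> * transition h (bermudan \<beta> h f k) y\<bar> \<le> 1 * C"
    unfolding abs_mult using assms order_trans[OF abs_ge_zero assms(1)] by (intro mult_mono transition_abs_le Suc) auto
  then show ?case using assms(1)[of y] by (auto simp: max_def)
qed (simp add: assms)

abbreviation "hist t \<equiv> completed_history M borel X t"

lemma sets_hist_subset: "sets (hist t) \<subseteq> events"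
  by (intro sets_completed_history_subset measurable_X)

definition stopped_payoff :: "real \<Rightarrow> (real \<Rightarrow> real) \<Rightarrow> real \<Rightarrow> real \<Rightarrow> ('a \<Rightarrow> ennreal) \<Rightarrow> 'a \<Rightarrow> real" where
  "stopped_payoff r f T x \<tau> \<omega> =
     exp (- r * enn2real (min (\<tau> \<omega>) (ennreal T))) * f (x + X (enn2real (min (\<tau> \<omega>) (ennreal T))) \<omega>)"

lemma opt_value_eq: "opt_value M X r f T x = (SUP \<tau>\<in>stopping_times M X. expectation (stopped_payoff r f T x \<tau>))"
  unfolding opt_value_def Let_def complete at_time_def stopped_payoff_def[abs_def] ..

lemma stopped_payoff_abs_le:
  assumes "\<And>y. \<bar>f y\<bar> \<le> C" "0 \<le> r"
  shows "\<bar>stopped_payoff r f T x \<tau> \<omega>\<bar> \<le> C"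
proof -
  have "\<bar>stopped_payoff r f T x \<tau> \<omega>\<bar> \<le> 1 * C"
    unfolding stopped_payoff_def abs_mult using assms order_trans[OF abs_ge_zero assms(1)]
    by (intro mult_mono) auto
  then show ?thesis by simp
qed

lemma expectation_stopped_payoff_abs_le:
  assumes "\<And>y. \<bar>f y\<bar> \<le> C" "0 \<le> r"
  shows "\<bar>expectation (stopped_payoff r f T x \<tau>)\<bar> \<le> C"
  using stopped_payoff_abs_le[OF assms] order_trans[OF abs_ge_zero assms(1)] by (intro abs_expectation_le) auto

lemma stopped_payoff_le_opt_value:
  assumes "\<And>y. \<bar>f y\<bar> \<le> C" "0 \<le> r" "\<tau> \<in> stopping_times M X"
  shows "expectation (stopped_payoff r f T x \<tau>) \<le> opt_value M X r f T x"
  unfolding opt_value_eq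
proof (rule cSUP_upper[OF assms(3)])
  have "expectation (stopped_payoff r f T x \<tau>') \<le> C" for \<tau>'
    using expectation_stopped_payoff_abs_le[of f C r T x \<tau>', OF assms(1,2)] by linarith
  then show "bdd_above ((\<lambda>\<tau>. expectation (stopped_payoff r f T x \<tau>)) ` stopping_times M X)" by (intro bdd_aboveI2)
qed

lemma stopping_times_nonempty: "stopping_times M X \<noteq> {}"
proof -
  have "(\<lambda>_. 0) \<in> stopping_times M X" unfolding stopping_times_def by (simp add: stopping_time_const)
  then show ?thesis by blast
qed

lemma stopping_time_hist:
  assumes "\<tau> \<in> stopping_times M X" "t < u"
  shows "{\<omega>\<in>space M. \<tau> \<omega> \<le> t} \<in> sets (hist u)"
  using assms unfolding stopping_times_def stopping_time_nat_filtration_iff by auto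

lemma measurable_stopping_times:
  assumes "\<tau> \<in> stopping_times M X"
  shows "\<tau> \<in> borel_measurable M"
proof (rule borel_measurableI_le)
  fix t show "{\<omega>\<in>space M. \<tau> \<omega> \<le> t} \<in> events"
    using assms sets_hist_subset[of \<infinity>] unfolding stopping_times_def stopping_time_nat_filtration_iff by auto
qed

text \<open>Adaptedness refers to the plain history at each grid point rather than to its
  right-continuous version; the rounding of general stopping times in
  \<open>stopped_payoff_approx\<close> is chosen to meet this.\<close>

lemma grid_stopping:
  fixes \<kappa> :: "'a \<Rightarrow> nat"
  assumes f: "bounded_continuous f" and "0 \<le> h" and \<kappa>: "\<kappa> \<in> measurable M (count_space UNIV)"
    and A: "\<And>i. i < J \<Longrightarrow> {\<omega>\<in>space M. i < \<kappa> \<omega>} \<in> sets (hist (ennreal (real i * h)))" and "0 \<le> \<beta>"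
  shows "expectation (\<lambda>\<omega>. \<beta> ^ min (\<kappa> \<omega>) J * f (x + X (real (min (\<kappa> \<omega>) J) * h) \<omega>)) \<le> bermudan \<beta> h f J x"
    and "(AE \<omega> in M. \<kappa> \<omega> = (LEAST i. bermudan \<beta> h f (J - i) (x + X (real i * h) \<omega>) \<le> f (x + X (real i * h) \<omega>))) \<Longrightarrow>
       expectation (\<lambda>\<omega>. \<beta> ^ min (\<kappa> \<omega>) J * f (x + X (real (min (\<kappa> \<omega>) J) * h) \<omega>)) = bermudan \<beta> h f J x"
proof -
  let ?w = "bermudan \<beta> h f"
  note bc = bounded_continuous_bermudan[OF f]
  have m: "(\<lambda>\<omega>. x + X (real i * h) \<omega>) \<in> borel_measurable M" for i
    using measurable_X[of "real i * h"] \<open>0 \<le> h\<close> by simp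
  have step: "expectation (\<lambda>\<omega>. of_bool (i < \<kappa> \<omega>) * ?w (J - Suc i) (x + X (real (Suc i) * h) \<omega>)) =
      expectation (\<lambda>\<omega>. of_bool (i < \<kappa> \<omega>) * transition h (?w (J - Suc i)) (x + X (real i * h) \<omega>))" if "i < J" for i
  proof -
    have "expectation (\<lambda>\<omega>. of_bool (i < \<kappa> \<omega>) * k \<omega>) =
      expectation (\<lambda>\<omega>. of_bool (\<omega> \<in> {\<omega>\<in>space M. i < \<kappa> \<omega>}) * k \<omega>)" for k :: "'a \<Rightarrow> real"
      by (intro Bochner_Integration.integral_cong) auto
    then show ?thesis
      using markov[OF A[OF that] _ \<open>0 \<le> h\<close> bounded_continuous_bermudan[OF f, of \<beta> h "J - Suc i"], of x] \<open>0 \<le> h\<close> by (simp add: distrib_right add.commute)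
  qed
  have s: "expectation (\<lambda>\<omega>. ?w J (x + X (real 0 * h) \<omega>)) = ?w J x"
    using expectation_start[OF bounded_continuous_measurable[OF bc]] by simp
  note os = optimal_stopping_le[of "\<lambda>i \<omega>. x + X (real i * h) \<omega>" \<kappa> ?w "\<lambda>j. transition h (?w j)" \<beta> f J,
    OF m \<kappa> bc bounded_continuous_transition[OF bc] \<open>0 \<le> \<beta>\<close> _ _ step, unfolded s]
  show "expectation (\<lambda>\<omega>. \<beta> ^ min (\<kappa> \<omega>) J * f (x + X (real (min (\<kappa> \<omega>) J) * h) \<omega>)) \<le> ?w J x" by (rule os(1)) auto
  show "expectation (\<lambda>\<omega>. \<beta> ^ min (\<kappa> \<omega>) J * f (x + X (real (min (\<kappa> \<omega>) J) * h) \<omega>)) = ?w J x"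
    if "AE \<omega> in M. \<kappa> \<omega> = (LEAST i. ?w (J - i) (x + X (real i * h) \<omega>) \<le> f (x + X (real i * h) \<omega>))"
    by (rule os(2)) (use that in auto)
qed

text \<open>The optimal Bermudan rule, the first grid point at which the recursion does not exceed
  \<open>f\<close>, is also admissible in continuous time and stops by \<open>t\<close>.\<close>

lemma bermudan_le_opt_value:
  assumes f: "bounded_continuous f" and "0 \<le> h" "real J * h \<le> t" "0 \<le> r"
  shows "bermudan (exp (- r * h)) h f J x \<le> opt_value M X r f t x"
proof -
  obtain C where C: "\<And>y. \<bar>f y\<bar> \<le> C" using f bounded_continuousE by blast
  let ?\<beta> = "exp (- r * h)"
  let ?w = "bermudan ?\<beta> h f"
  have [measurable]: "?w j \<in> borel_measurable borel" "f \<in> borel_measurable borel" for j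
    using bounded_continuous_bermudan[OF f] f by (auto intro: bounded_continuous_measurable)
  define \<kappa> where "\<kappa> \<omega> = (LEAST i. ?w (J - i) (x + X (real i * h) \<omega>) \<le> f (x + X (real i * h) \<omega>))" for \<omega>
  have ex: "?w (J - J) (x + X (real J * h) \<omega>) \<le> f (x + X (real J * h) \<omega>)" for \<omega> by simp
  have \<kappa>J: "\<kappa> \<omega> \<le> J" for \<omega> unfolding \<kappa>_def by (rule Least_le[of _ J]) (rule ex)
  have gt: "i < \<kappa> \<omega> \<longleftrightarrow> (\<forall>j\<in>{..i}. f (x + X (real j * h) \<omega>) < ?w (J - j) (x + X (real j * h) \<omega>))" for i \<omega>
  proof
    assume "i < \<kappa> \<omega>"
    then show "\<forall>j\<in>{..i}. f (x + X (real j * h) \<omega>) < ?w (J - j) (x + X (real j * h) \<omega>)"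
      using not_less_Least[of _ "\<lambda>i. ?w (J - i) (x + X (real i * h) \<omega>) \<le> f (x + X (real i * h) \<omega>)"]
      unfolding \<kappa>_def by (auto simp: not_le)
  next
    assume *: "\<forall>j\<in>{..i}. f (x + X (real j * h) \<omega>) < ?w (J - j) (x + X (real j * h) \<omega>)"
    have "?w (J - \<kappa> \<omega>) (x + X (real (\<kappa> \<omega>) * h) \<omega>) \<le> f (x + X (real (\<kappa> \<omega>) * h) \<omega>)"
      unfolding \<kappa>_def by (rule LeastI[of _ J]) (rule ex)
    then show "i < \<kappa> \<omega>" using * by (metis atMost_iff leI not_le)
  qed
  have A: "{\<omega>\<in>space M. i < \<kappa> \<omega>} \<in> sets (hist (ennreal (real i * h)))" for i
  proof -
    let ?H = "hist (ennreal (real i * h))"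
    have "{\<omega>\<in>space ?H. f (x + X (real j * h) \<omega>) < ?w (J - j) (x + X (real j * h) \<omega>)} \<in> sets ?H" if "j \<in> {..i}" for j
    proof -
      have [measurable]: "X (real j * h) \<in> borel_measurable ?H"
        using that \<open>0 \<le> h\<close> by (intro measurable_completed_history measurable_X ennreal_leI mult_right_mono) auto
      show ?thesis by measurable
    qed
    then have "{\<omega>\<in>space ?H. \<forall>j\<in>{..i}. f (x + X (real j * h) \<omega>) < ?w (J - j) (x + X (real j * h) \<omega>)} \<in> sets ?H"
      by (intro sets.sets_Collect_finite_All) auto
    then show ?thesis unfolding gt by simp
  qed
  have \<kappa>m: "\<kappa> \<in> measurable M (count_space UNIV)"
  proof -
    have [measurable]: "X (real i * h) \<in> borel_measurable M" for i using \<open>0 \<le> h\<close> by (intro measurable_X) simp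
    show ?thesis unfolding \<kappa>_def by measurable
  qed
  define \<tau> where "\<tau> \<omega> = ennreal (real (\<kappa> \<omega>) * h)" for \<omega>
  have "\<tau> \<in> stopping_times M X"
    unfolding stopping_times_def stopping_time_nat_filtration_iff
  proof (intro CollectI allI ballI)
    fix s u :: ennreal assume u: "u \<in> insert \<infinity> {s<..}"
    have "{\<omega>\<in>space M. \<tau> \<omega> \<le> s} = (\<Union>i\<in>{i\<in>{..J}. ennreal (real i * h) \<le> s}. {\<omega>\<in>space M. \<kappa> \<omega> = i})"
      using \<kappa>J by (auto simp: \<tau>_def)
    also have "\<dots> \<in> sets (hist u)"
    proof (intro sets.finite_UN)
      fix i assume i: "i \<in> {i\<in>{..J}. ennreal (real i * h) \<le> s}"
      have mono: "sets (hist (ennreal (real j * h))) \<subseteq> sets (hist u)" if "j \<le> i" for j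
      proof (rule completed_history_mono)
        have "ennreal (real j * h) \<le> ennreal (real i * h)" using that \<open>0 \<le> h\<close> by (intro ennreal_leI mult_right_mono) auto
        also have "\<dots> \<le> s" using i by simp
        also have "s \<le> u" using u by auto
        finally show "ennreal (real j * h) \<le> u" .
      qed
      have "{\<omega>\<in>space M. i < \<kappa> \<omega>} \<in> sets (hist u)" using A[of i] mono[of i] by auto
      moreover have "{\<omega>\<in>space M. i \<le> \<kappa> \<omega>} \<in> sets (hist u)"
      proof (cases i)
        case 0
        then show ?thesis using sets.top[of "hist u"] by simp
      next
        case (Suc j)
        then show ?thesis using A[of j] mono[of j] by (auto simp: Suc_le_eq)
      qed
      ultimately have "{\<omega>\<in>space M. i \<le> \<kappa> \<omega>} - {\<omega>\<in>space M. i < \<kappa> \<omega>} \<in> sets (hist u)" by (intro sets.Diff)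
      also have "{\<omega>\<in>space M. i \<le> \<kappa> \<omega>} - {\<omega>\<in>space M. i < \<kappa> \<omega>} = {\<omega>\<in>space M. \<kappa> \<omega> = i}" by auto
      finally show "{\<omega>\<in>space M. \<kappa> \<omega> = i} \<in> sets (hist u)" .
    qed auto
    finally show "{\<omega>\<in>space M. \<tau> \<omega> \<le> s} \<in> sets (hist u)" .
  qed
  moreover have "expectation (stopped_payoff r f t x \<tau>) = ?w J x"
  proof -
    have "expectation (stopped_payoff r f t x \<tau>) = expectation (\<lambda>\<omega>. ?\<beta> ^ min (\<kappa> \<omega>) J * f (x + X (real (min (\<kappa> \<omega>) J) * h) \<omega>))"
    proof (rule Bochner_Integration.integral_cong)
      fix \<omega>
      have "real (\<kappa> \<omega>) * h \<le> real J * h" using \<kappa>J[of \<omega>] \<open>0 \<le> h\<close> by (intro mult_right_mono) auto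
      then have "min (\<tau> \<omega>) (ennreal t) = ennreal (real (\<kappa> \<omega>) * h)"
        using assms(3) by (simp add: \<tau>_def min_def ennreal_leI)
      then show "stopped_payoff r f t x \<tau> \<omega> = ?\<beta> ^ min (\<kappa> \<omega>) J * f (x + X (real (min (\<kappa> \<omega>) J) * h) \<omega>)"
        using \<kappa>J[of \<omega>] \<open>0 \<le> h\<close> by (simp add: stopped_payoff_def exp_of_nat_mult[symmetric] min_def mult_ac)
    qed simp
    also have "\<dots> = ?w J x"
      by (rule grid_stopping(2)[OF f \<open>0 \<le> h\<close> \<kappa>m]) (use A in \<open>auto simp: \<kappa>_def\<close>)
    finally show ?thesis .
  qed
  ultimately show ?thesis using stopped_payoff_le_opt_value[of f C r \<tau> t x, OF C \<open>0 \<le> r\<close>] by simp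
qed

text \<open>
  Rounding \<open>min \<tau> T\<close> up to the next grid point, strictly so below \<open>T\<close>, gives an exercise rule that
  is admissible for the Bermudan problem.
\<close>

lemma stopped_payoff_approx:
  assumes f: "bounded_continuous f" and "0 \<le> r" "0 < T" and \<tau>: "\<tau> \<in> stopping_times M X"
  shows "stopped_payoff r f T x \<tau> \<in> borel_measurable M"
    and "0 < \<epsilon> \<Longrightarrow> \<exists>m. expectation (stopped_payoff r f T x \<tau>) - \<epsilon> < bermudan (exp (- r * (T / real (Suc m)))) (T / real (Suc m)) f (Suc m) x"
proof -
  obtain C where C: "\<And>y. \<bar>f y\<bar> \<le> C" using f bounded_continuousE by blast
  have [measurable]: "f \<in> borel_measurable borel" using f by (rule bounded_continuous_measurable)
  have [measurable]: "\<tau> \<in> borel_measurable M" by (rule measurable_stopping_times[OF \<tau>])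
  define \<sigma> where "\<sigma> \<omega> = enn2real (min (\<tau> \<omega>) (ennreal T))" for \<omega>
  have \<sigma>T: "0 \<le> \<sigma> \<omega>" "\<sigma> \<omega> \<le> T" for \<omega>
    using \<open>0 < T\<close> by (auto simp: \<sigma>_def intro!: enn2real_leI)
  have \<sigma>_le: "s \<le> \<sigma> \<omega> \<longleftrightarrow> ennreal s \<le> \<tau> \<omega>" if "0 \<le> s" "s \<le> T" for s \<omega>
  proof -
    have "ennreal (\<sigma> \<omega>) = min (\<tau> \<omega>) (ennreal T)" unfolding \<sigma>_def by (rule ennreal_enn2real) (simp add: min_less_iff_disj)
    moreover have "s \<le> \<sigma> \<omega> \<longleftrightarrow> ennreal s \<le> ennreal (\<sigma> \<omega>)" using \<sigma>T by simp
    moreover have "ennreal s \<le> ennreal T" using that by (intro ennreal_leI)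
    ultimately show ?thesis by simp
  qed
  define h where "h m = T / real (Suc m)" for m
  have h: "0 < h m" "real (Suc m) * h m = T" for m using \<open>0 < T\<close> by (auto simp: h_def simp del: of_nat_Suc)
  have h0: "h \<longlonglongrightarrow> 0" unfolding h_def
    by (intro real_tendsto_divide_at_top[OF tendsto_const] filterlim_compose[OF filterlim_real_sequentially filterlim_Suc])
  \<comment> \<open>The index of the first grid point strictly after \<open>\<sigma>\<close>, capped
    at the last one, which is \<open>T\<close>.\<close>
  define \<kappa> where "\<kappa> m \<omega> = min (Suc m) (Suc (nat \<lfloor>\<sigma> \<omega> / h m\<rfloor>))" for m \<omega>
  have [measurable]: "\<sigma> \<in> borel_measurable M" unfolding \<sigma>_def by measurable
  have \<kappa>m[measurable]: "\<kappa> m \<in> measurable M (count_space UNIV)" for m unfolding \<kappa>_def by measurable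
  have \<kappa>_gt: "i < \<kappa> m \<omega> \<longleftrightarrow> ennreal (real i * h m) \<le> \<tau> \<omega>" if "i < Suc m" for i m \<omega>
  proof -
    have "real i * h m \<le> real (Suc m) * h m" using that h(1)[of m] by (intro mult_right_mono) auto
    then have "real i * h m \<le> T" unfolding h .
    have "i < \<kappa> m \<omega> \<longleftrightarrow> i \<le> nat \<lfloor>\<sigma> \<omega> / h m\<rfloor>" using that by (auto simp: \<kappa>_def)
    also have "\<dots> \<longleftrightarrow> real i \<le> \<sigma> \<omega> / h m" using \<sigma>T[of \<omega>] h[of m] by (simp add: le_nat_iff le_floor_iff)
    also have "\<dots> \<longleftrightarrow> real i * h m \<le> \<sigma> \<omega>" using h[of m] by (simp add: pos_le_divide_eq)
    also have "\<dots> \<longleftrightarrow> ennreal (real i * h m) \<le> \<tau> \<omega>" using h(1)[of m] \<open>real i * h m \<le> T\<close> by (intro \<sigma>_le) auto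
    finally show ?thesis .
  qed
  \<comment> \<open>Here \<open>i < \<kappa> m \<omega>\<close> says that \<open>\<tau>\<close> is
    at least \<open>real i * h m\<close>. The complement is a union over rationals below the grid
    point, so it lies in the plain history there although \<open>\<tau>\<close> is a stopping time
    of the right-continuous filtration.\<close>
  have A: "{\<omega>\<in>space M. i < \<kappa> m \<omega>} \<in> sets (hist (ennreal (real i * h m)))" if "i < Suc m" for i m
  proof -
    let ?t = "real i * h m"
    have "{\<omega>\<in>space M. i < \<kappa> m \<omega>} = space (hist (ennreal ?t)) - (\<Union>p\<in>\<rat> \<inter> {0..<?t}. {\<omega>\<in>space M. \<tau> \<omega> \<le> ennreal p})"
    proof -
      have "ennreal ?t \<le> \<tau> \<omega> \<longleftrightarrow> (\<forall>p\<in>\<rat> \<inter> {0..<?t}. \<not> \<tau> \<omega> \<le> ennreal p)" for \<omega>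
      proof
        assume *: "ennreal ?t \<le> \<tau> \<omega>"
        show "\<forall>p\<in>\<rat> \<inter> {0..<?t}. \<not> \<tau> \<omega> \<le> ennreal p"
        proof
          fix p assume "p \<in> \<rat> \<inter> {0..<?t}"
          then have "ennreal p < ennreal ?t" by (intro ennreal_lessI) auto
          then show "\<not> \<tau> \<omega> \<le> ennreal p" using * by auto
        qed
      next
        assume *: "\<forall>p\<in>\<rat> \<inter> {0..<?t}. \<not> \<tau> \<omega> \<le> ennreal p"
        show "ennreal ?t \<le> \<tau> \<omega>"
        proof (rule ccontr)
          assume "\<not> ennreal ?t \<le> \<tau> \<omega>"
          then have lt: "\<tau> \<omega> < ennreal ?t" by simp
          then obtain z where z: "0 \<le> z" "\<tau> \<omega> = ennreal z" by (cases "\<tau> \<omega>" rule: ennreal_cases) auto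
          with lt have "z < ?t" by (simp add: ennreal_less_iff)
          then obtain p where "p \<in> \<rat>" "z < p" "p < ?t" using Rats_dense_in_real by blast
          with z have "p \<in> \<rat> \<inter> {0..<?t}" by auto
          with * have "\<not> \<tau> \<omega> \<le> ennreal p" by blast
          then show False using z \<open>z < p\<close> by (simp add: ennreal_leI)
        qed
      qed
      then show ?thesis unfolding \<kappa>_gt[OF that] by auto
    qed
    also have "\<dots> \<in> sets (hist (ennreal ?t))"
      by (intro sets.compl_sets sets.countable_UN'' countable_Int1 countable_rat stopping_time_hist[OF \<tau>]) (auto intro!: ennreal_lessI)
    finally show ?thesis .
  qed
  let ?F = "\<lambda>m \<omega>. exp (- r * h m) ^ min (\<kappa> m \<omega>) (Suc m) * f (x + X (real (min (\<kappa> m \<omega>) (Suc m)) * h m) \<omega>)"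
  have F_le: "expectation (?F m) \<le> bermudan (exp (- r * h m)) (h m) f (Suc m) x" for m
    by (rule grid_stopping(1)[OF f less_imp_le[OF h(1)] \<kappa>m A]) auto
  have Fm: "?F m \<in> borel_measurable M" for m
  proof -
    have "(\<lambda>\<omega>. X (real (min (\<kappa> m \<omega>) (Suc m)) * h m) \<omega>) \<in> borel_measurable M"
      by (rule measurable_compose_countable[where f="\<lambda>i \<omega>. X (real (min i (Suc m)) * h m) \<omega>", OF _ \<kappa>m])
         (use h(1)[of m] in \<open>auto intro!: measurable_X\<close>)
    then show ?thesis by measurable
  qed
  have lim: "(\<lambda>m. ?F m \<omega>) \<longlonglongrightarrow> stopped_payoff r f T x \<tau> \<omega>" if "\<omega> \<in> space M" for \<omega>
  proof -
    define s where "s m = real (\<kappa> m \<omega>) * h m" for m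
    have s: "\<sigma> \<omega> \<le> s m" "s m \<le> \<sigma> \<omega> + h m" for m
    proof -
      let ?n = "nat \<lfloor>\<sigma> \<omega> / h m\<rfloor>"
      have "0 \<le> \<sigma> \<omega> / h m" using \<sigma>T[of \<omega>] h(1)[of m] by simp
      then have "real ?n \<le> \<sigma> \<omega> / h m" "\<sigma> \<omega> / h m < real ?n + 1" by linarith+
      then have 1: "real ?n * h m \<le> \<sigma> \<omega>" "\<sigma> \<omega> < (real ?n + 1) * h m"
        using h(1)[of m] by (simp_all add: pos_le_divide_eq pos_divide_less_eq)
      have e: "s m = min T ((real ?n + 1) * h m)"
      proof -
        have "s m = min (real (Suc m)) (real ?n + 1) * h m" unfolding s_def \<kappa>_def by (simp only: of_nat_min of_nat_Suc add.commute)
        also have "\<dots> = min (real (Suc m) * h m) ((real ?n + 1) * h m)"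
          using h(1)[of m] by (simp only: min_mult_distrib_right less_imp_le if_True)
        finally show ?thesis unfolding h(2) .
      qed
      show "\<sigma> \<omega> \<le> s m" unfolding e using 1(2) \<sigma>T[of \<omega>] by (simp only: min.bounded_iff less_imp_le)
      have "s m \<le> (real ?n + 1) * h m" unfolding e by (rule min.cobounded2)
      also have "\<dots> = real ?n * h m + h m" by (simp only: distrib_right mult_1_left)
      finally show "s m \<le> \<sigma> \<omega> + h m" using 1(1) by linarith
    qed
    have slim: "s \<longlonglongrightarrow> \<sigma> \<omega>"
    proof (rule real_tendsto_sandwich[of "\<lambda>_. \<sigma> \<omega>" _ _ "\<lambda>m. \<sigma> \<omega> + h m"])
      show "(\<lambda>m. \<sigma> \<omega> + h m) \<longlonglongrightarrow> \<sigma> \<omega>" using tendsto_add[OF tendsto_const h0] by simp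
    qed (use s in auto)
    have F: "?F m \<omega> = exp (- r * s m) * f (x + X (s m) \<omega>)" for m
    proof -
      have "min (\<kappa> m \<omega>) (Suc m) = \<kappa> m \<omega>" by (simp add: \<kappa>_def)
      then show ?thesis by (simp add: s_def exp_of_nat_mult[symmetric] mult_ac)
    qed
    have "(\<lambda>m. exp (- r * s m) * f (x + X (s m) \<omega>)) \<longlonglongrightarrow> exp (- r * \<sigma> \<omega>) * f (x + X (\<sigma> \<omega>) \<omega>)"
      by (intro tendsto_mult tendsto_exp tendsto_const slim bounded_continuous_tendsto[OF f] tendsto_add right_continuous[OF that] \<sigma>T s)
    then show ?thesis unfolding F stopped_payoff_def \<sigma>_def .
  qed
  show "stopped_payoff r f T x \<tau> \<in> borel_measurable M"
    by (rule borel_measurable_AE_limit[where f="?F", OF Fm AE_I2[OF lim]])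
  have C0: "0 \<le> C" using order_trans[OF abs_ge_zero C] .
  have conv: "(\<lambda>m. expectation (?F m)) \<longlonglongrightarrow> expectation (stopped_payoff r f T x \<tau>)"
  proof (rule bounded_convergence_complete[where C=C])
    show "\<bar>?F m \<omega>\<bar> \<le> C" for m \<omega>
    proof -
      have "\<bar>?F m \<omega>\<bar> \<le> 1 * C"
        unfolding abs_mult using \<open>0 \<le> r\<close> h(1)[of m] C C0 by (intro mult_mono) (auto simp: power_le_one mult_nonneg_nonneg less_imp_le)
      then show ?thesis by simp
    qed
  qed (use Fm lim in auto)
  show "\<exists>m. expectation (stopped_payoff r f T x \<tau>) - \<epsilon> < bermudan (exp (- r * (T / real (Suc m)))) (T / real (Suc m)) f (Suc m) x" if "0 < \<epsilon>"
  proof -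
    have "eventually (\<lambda>m. expectation (stopped_payoff r f T x \<tau>) - \<epsilon> < expectation (?F m)) sequentially"
      using conv that by (intro order_tendstoD(1)) auto
    then obtain m where "expectation (stopped_payoff r f T x \<tau>) - \<epsilon> < expectation (?F m)" by (auto dest: eventually_happens)
    with F_le[of m] show ?thesis unfolding h_def by (intro exI[of _ m]) simp
  qed
qed

text \<open>Horizon 0 stands apart because the meshes \<open>T / real (Suc m)\<close>
  degenerate.\<close>

lemma stopped_payoff_0:
  assumes f: "bounded_continuous f"
  shows "stopped_payoff r f 0 x \<tau> \<in> borel_measurable M" "expectation (stopped_payoff r f 0 x \<tau>) = f x"
proof -
  have [measurable]: "f \<in> borel_measurable borel" "X 0 \<in> borel_measurable M"
    using f by (auto intro: bounded_continuous_measurable measurable_X)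
  have "stopped_payoff r f 0 x \<tau> = (\<lambda>\<omega>. f (x + X 0 \<omega>))" by (simp add: stopped_payoff_def fun_eq_iff)
  then show "stopped_payoff r f 0 x \<tau> \<in> borel_measurable M" "expectation (stopped_payoff r f 0 x \<tau>) = f x"
    using expectation_start[of f x] by auto
qed

lemma measurable_stopped_payoff:
  assumes "bounded_continuous f" "0 \<le> r" "0 \<le> T" "\<tau> \<in> stopping_times M X"
  shows "stopped_payoff r f T x \<tau> \<in> borel_measurable M"
  using stopped_payoff_approx(1)[OF assms(1,2) _ assms(4), of T] stopped_payoff_0(1)[OF assms(1)] assms(3)
  by (cases "T = 0") auto

text \<open>The stopping times may vary with \<open>n\<close>: the payoffs differ through the
  discount and through stopping between \<open>T\<close> and \<open>S n\<close>, and the latter is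
  controlled by right continuity of the path at \<open>T\<close>.\<close>

lemma stopped_payoff_diff_tendsto:
  assumes f: "bounded_continuous f" and r: "R \<longlonglongrightarrow> r" "\<And>n. 0 \<le> R n" and S: "S \<longlonglongrightarrow> T" "\<And>n. T \<le> S n" and "0 \<le> T"
    and \<omega>: "\<omega> \<in> space M"
  shows "(\<lambda>n. stopped_payoff (R n) f (S n) x (\<tau> n) \<omega> - stopped_payoff r f T x (\<tau> n) \<omega>) \<longlonglongrightarrow> 0"
proof -
  obtain C where C: "\<And>y. \<bar>f y\<bar> \<le> C" using f bounded_continuousE by blast
  have C0: "0 \<le> C" using order_trans[OF abs_ge_zero C] .
  have "0 \<le> r" using r by (intro LIMSEQ_le_const[OF r(1)]) auto
  have S0: "0 \<le> S n" for n using S(2)[of n] \<open>0 \<le> T\<close> by simp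
  define a where "a n = enn2real (min (\<tau> n \<omega>) (ennreal (S n)))" for n
  define b where "b n = enn2real (min (\<tau> n \<omega>) (ennreal T))" for n
  have aS: "0 \<le> a n" "a n \<le> S n" for n using S0[of n] by (auto simp: a_def intro!: enn2real_leI)
  have b0: "0 \<le> b n" for n by (simp add: b_def)
  have b: "b n = min (a n) T" for n
  proof (cases "\<tau> n \<omega>" rule: ennreal_cases)
    case top
    moreover have "min \<top> z = z" for z :: ennreal by (rule min_absorb2) simp
    ultimately show ?thesis using S0[of n] S(2)[of n] \<open>0 \<le> T\<close> by (simp add: a_def b_def)
  next
    case (real z)
    have m: "enn2real (min (ennreal z) (ennreal t)) = min z t" if "0 \<le> t" for t
      using that real(1) by (cases "z \<le> t") (simp_all add: min_def)
    show ?thesis using real m[OF S0[of n]] m[OF \<open>0 \<le> T\<close>] S(2)[of n] by (simp add: a_def b_def)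
  qed
  \<comment> \<open>Squeezed between \<open>T\<close> and \<open>S n\<close> whatever
    \<open>\<tau> n\<close> is; no convergence of the stopping times themselves is
    available.\<close>
  have "(\<lambda>n. max T (a n)) \<longlonglongrightarrow> T"
    by (rule real_tendsto_sandwich[OF _ _ tendsto_const[of T] S(1)]) (auto intro!: always_eventually simp: S(2) aS)
  then have "(\<lambda>n. f (x + X (max T (a n)) \<omega>)) \<longlonglongrightarrow> f (x + X T \<omega>)"
    by (intro bounded_continuous_tendsto[OF f] tendsto_add tendsto_const right_continuous[OF \<omega>] \<open>0 \<le> T\<close>) auto
  then have lim1: "(\<lambda>n. \<bar>f (x + X (max T (a n)) \<omega>) - f (x + X T \<omega>)\<bar>) \<longlonglongrightarrow> 0"
    by (simp add: LIM_zero_iff tendsto_rabs_zero_iff)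
  have lim2: "(\<lambda>n. C * (\<bar>R n - r\<bar> * S n + r * (S n - T))) \<longlonglongrightarrow> C * (\<bar>r - r\<bar> * T + r * (T - T))"
    by (intro tendsto_intros r S)
  show ?thesis
  proof (rule Lim_null_comparison)
    show "(\<lambda>n. C * (\<bar>R n - r\<bar> * S n + r * (S n - T)) + \<bar>f (x + X (max T (a n)) \<omega>) - f (x + X T \<omega>)\<bar>) \<longlonglongrightarrow> 0"
      using tendsto_add[OF lim2 lim1] by simp
    show "\<forall>\<^sub>F n in sequentially. norm (stopped_payoff (R n) f (S n) x (\<tau> n) \<omega> - stopped_payoff r f T x (\<tau> n) \<omega>) \<le>
       C * (\<bar>R n - r\<bar> * S n + r * (S n - T)) + \<bar>f (x + X (max T (a n)) \<omega>) - f (x + X T \<omega>)\<bar>"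
    proof (rule always_eventually, rule allI)
      fix n
      let ?fa = "f (x + X (a n) \<omega>)" and ?fb = "f (x + X (b n) \<omega>)"
      let ?ea = "exp (- (R n * a n))" and ?eb = "exp (- (r * b n))"
      have "stopped_payoff (R n) f (S n) x (\<tau> n) \<omega> - stopped_payoff r f T x (\<tau> n) \<omega> = ?ea * ?fa - ?eb * ?fb"
        by (simp add: stopped_payoff_def a_def b_def)
      also have "\<dots> = (?ea - ?eb) * ?fa + ?eb * (?fa - ?fb)" by (simp add: algebra_simps)
      also have "\<bar>\<dots>\<bar> \<le> \<bar>?ea - ?eb\<bar> * \<bar>?fa\<bar> + \<bar>?eb\<bar> * \<bar>?fa - ?fb\<bar>"
        by (rule order_trans[OF abs_triangle_ineq]) (simp add: abs_mult)
      also have "\<dots> \<le> (\<bar>R n - r\<bar> * S n + r * (S n - T)) * C + 1 * \<bar>f (x + X (max T (a n)) \<omega>) - f (x + X T \<omega>)\<bar>"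
      proof (rule add_mono; rule mult_mono)
        have "\<bar>?ea - ?eb\<bar> \<le> \<bar>R n * a n - r * b n\<bar>"
          using aS b0 r(2) \<open>0 \<le> r\<close> by (intro abs_exp_minus_diff_le) auto
        also have "\<dots> = \<bar>(R n - r) * a n + r * (a n - b n)\<bar>" by (simp add: algebra_simps)
        also have "\<dots> \<le> \<bar>R n - r\<bar> * a n + r * (a n - b n)"
          using aS(1)[of n] \<open>0 \<le> r\<close> b[of n] by (intro order_trans[OF abs_triangle_ineq]) (simp add: abs_mult)
        also have "\<dots> \<le> \<bar>R n - r\<bar> * S n + r * (S n - T)"
          using aS[of n] \<open>0 \<le> r\<close> b[of n] S(2)[of n] by (intro add_mono mult_left_mono) auto
        finally show "\<bar>?ea - ?eb\<bar> \<le> \<bar>R n - r\<bar> * S n + r * (S n - T)" .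
        show "0 \<le> \<bar>R n - r\<bar> * S n + r * (S n - T)" using S0[of n] S(2)[of n] \<open>0 \<le> r\<close> by simp
        show "\<bar>?eb\<bar> \<le> 1" using b0[of n] \<open>0 \<le> r\<close> by simp
        show "\<bar>?fa - ?fb\<bar> \<le> \<bar>f (x + X (max T (a n)) \<omega>) - f (x + X T \<omega>)\<bar>"
          by (cases "a n \<le> T") (simp_all add: b min_def max_def)
      qed (auto simp: C)
      finally show "norm (stopped_payoff (R n) f (S n) x (\<tau> n) \<omega> - stopped_payoff r f T x (\<tau> n) \<omega>) \<le>
         C * (\<bar>R n - r\<bar> * S n + r * (S n - T)) + \<bar>f (x + X (max T (a n)) \<omega>) - f (x + X T \<omega>)\<bar>"
        by (simp add: mult.commute)
    qed
  qed
qed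

text \<open>Near-optimal stopping times for parameters that violate the claim are also admissible
  for \<open>r\<close> and \<open>T\<close>, and lose nothing there in the limit. The rate varies
  because the converted rate of the randomized problem only tends to \<open>r\<close>, the horizon
  varies to the right because the upper bound is taken at some \<open>a > T\<close>.\<close>

lemma opt_value_upper_semicontinuous:
  assumes f: "bounded_continuous f" and "0 \<le> r" "0 \<le> T" "0 < \<epsilon>"
  shows "\<exists>d>0. \<forall>r' T'. 0 \<le> r' \<longrightarrow> \<bar>r' - r\<bar> < d \<longrightarrow> T \<le> T' \<longrightarrow> T' < T + d \<longrightarrow> opt_value M X r' f T' x \<le> opt_value M X r f T x + \<epsilon>"
proof (rule ccontr)
  assume "\<not> ?thesis"
  then have "\<exists>r' T'. 0 \<le> r' \<and> \<bar>r' - r\<bar> < 1 / real (Suc n) \<and> T \<le> T' \<and> T' < T + 1 / real (Suc n) \<and>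
     opt_value M X r f T x + \<epsilon> < opt_value M X r' f T' x" for n
    by (auto simp: not_le dest: spec[of _ "1 / real (Suc n)"])
  then obtain R S where RS: "\<And>n. 0 \<le> R n" "\<And>n. \<bar>R n - r\<bar> < 1 / real (Suc n)" "\<And>n. T \<le> S n" "\<And>n. S n < T + 1 / real (Suc n)"
     "\<And>n. opt_value M X r f T x + \<epsilon> < opt_value M X (R n) f (S n) x" by metis
  obtain C where C: "\<And>y. \<bar>f y\<bar> \<le> C" using f bounded_continuousE by blast
  have "\<exists>\<tau>\<in>stopping_times M X. opt_value M X r f T x + \<epsilon> < expectation (stopped_payoff (R n) f (S n) x \<tau>)" for n
  proof -
    have "expectation (stopped_payoff (R n) f (S n) x \<tau>') \<le> C" for \<tau>'
      using expectation_stopped_payoff_abs_le[of f C "R n" "S n" x \<tau>', OF C RS(1)] by linarith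
    then have "bdd_above ((\<lambda>\<tau>. expectation (stopped_payoff (R n) f (S n) x \<tau>)) ` stopping_times M X)" by (intro bdd_aboveI2)
    from less_cSUP_iff[OF stopping_times_nonempty this] RS(5)[of n] show ?thesis by (simp add: opt_value_eq)
  qed
  then obtain \<tau> where \<tau>: "\<And>n. \<tau> n \<in> stopping_times M X" "\<And>n. opt_value M X r f T x + \<epsilon> < expectation (stopped_payoff (R n) f (S n) x (\<tau> n))" by metis
  have lim0: "(\<lambda>n. 1 / real (Suc n)) \<longlonglongrightarrow> 0" by (rule lim_1_over_n[THEN LIMSEQ_Suc])
  have "R \<longlonglongrightarrow> r"
  proof -
    have "(\<lambda>n. \<bar>R n - r\<bar>) \<longlonglongrightarrow> 0"
      by (rule real_tendsto_sandwich[OF _ _ tendsto_const lim0]) (use RS(2) in \<open>auto intro!: always_eventually less_imp_le\<close>)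
    then show ?thesis by (simp add: tendsto_rabs_zero_iff LIM_zero_iff)
  qed
  moreover have "S \<longlonglongrightarrow> T"
  proof -
    have "(\<lambda>n. T + 1 / real (Suc n)) \<longlonglongrightarrow> T" using tendsto_add[OF tendsto_const lim0] by simp
    from real_tendsto_sandwich[OF _ _ tendsto_const this] show ?thesis using RS(3,4) by (auto intro!: always_eventually less_imp_le)
  qed
  ultimately have "(\<lambda>n. expectation (\<lambda>\<omega>. stopped_payoff (R n) f (S n) x (\<tau> n) \<omega> - stopped_payoff r f T x (\<tau> n) \<omega>)) \<longlonglongrightarrow> expectation (\<lambda>_. 0)"
  proof (intro bounded_convergence[where C="C + C"])
    fix n
    have "0 \<le> S n" using RS(3)[of n] assms(3) by simp
    then show "(\<lambda>\<omega>. stopped_payoff (R n) f (S n) x (\<tau> n) \<omega> - stopped_payoff r f T x (\<tau> n) \<omega>) \<in> borel_measurable M"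
      using RS(1) assms \<tau>(1) by (intro borel_measurable_diff measurable_stopped_payoff) auto
    show "\<bar>stopped_payoff (R n) f (S n) x (\<tau> n) \<omega> - stopped_payoff r f T x (\<tau> n) \<omega>\<bar> \<le> C + C" for \<omega>
      using stopped_payoff_abs_le[of f C "R n" "S n" x "\<tau> n" \<omega>, OF C RS(1)] stopped_payoff_abs_le[of f C r T x "\<tau> n" \<omega>, OF C assms(2)] by linarith
  qed (auto intro!: AE_I2 stopped_payoff_diff_tendsto f RS assms)
  moreover have "expectation (\<lambda>\<omega>. stopped_payoff (R n) f (S n) x (\<tau> n) \<omega> - stopped_payoff r f T x (\<tau> n) \<omega>) > \<epsilon>" for n
  proof -
    have "0 \<le> S n" using RS(3)[of n] assms(3) by simp
    then have "integrable M (stopped_payoff (R n) f (S n) x (\<tau> n))" "integrable M (stopped_payoff r f T x (\<tau> n))"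
      using assms RS \<tau> by (auto intro!: integrable_bounded[where C=C] measurable_stopped_payoff stopped_payoff_abs_le C)
    moreover have "expectation (stopped_payoff r f T x (\<tau> n)) \<le> opt_value M X r f T x"
      using stopped_payoff_le_opt_value[of f C r "\<tau> n" T x, OF C assms(2) \<tau>(1)] .
    ultimately show ?thesis using \<tau>(2)[of n] by simp
  qed
  ultimately have "\<epsilon> \<le> expectation (\<lambda>_. 0)" by (intro LIMSEQ_le_const) (auto intro: less_imp_le)
  then show False using \<open>0 < \<epsilon>\<close> by simp
qed

end

subsection \<open>Upper bound by an Erlang-distributed horizon\<close>

text \<open>The Erlang law as an iterated convolution that splits off one exponential in front, in
  step with \<open>rand_iter\<close>.\<close>

primrec erlang_measure :: "real \<Rightarrow> nat \<Rightarrow> real measure" where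
  "erlang_measure l 0 = return borel 0"
| "erlang_measure l (Suc k) = distr (density lborel (exponential_density l) \<Otimes>\<^sub>M erlang_measure l k) borel (\<lambda>(s, t). s + t)"

lemma sets_erlang_measure[measurable_cong]: "sets (erlang_measure l k) = sets borel"
  by (cases k) auto

lemma space_erlang_measure: "space (erlang_measure l k) = UNIV"
  by (cases k) auto

lemma prob_space_erlang_measure:
  assumes "0 < l"
  shows "prob_space (erlang_measure l k)"
proof (induction k)
  case (Suc k)
  interpret E: prob_space "density lborel (exponential_density l)" using assms by (rule prob_space_exponential_density)
  interpret R: prob_space "erlang_measure l k" by (rule Suc)
  interpret PP: pair_prob_space "density lborel (exponential_density l)" "erlang_measure l k" ..
  show ?case by (simp, rule PP.P.prob_space_distr) measurable
qed (simp add: prob_space_return)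

text \<open>The superharmonic inequality is available for nonnegative horizons.\<close>

lemma erlang_measure_AE_nonneg:
  assumes "0 < l"
  shows "AE t in erlang_measure l k. 0 \<le> t"
proof (induction k)
  case 0
  show ?case unfolding erlang_measure.simps by (subst AE_return) auto
next
  case (Suc k)
  interpret E: prob_space "density lborel (exponential_density l)" using assms by (rule prob_space_exponential_density)
  interpret R: prob_space "erlang_measure l k" by (rule prob_space_erlang_measure[OF assms])
  interpret PP: pair_prob_space "density lborel (exponential_density l)" "erlang_measure l k" ..
  have "AE s in density lborel (exponential_density l). AE t in erlang_measure l k. 0 \<le> s + t"
    using exponential_AE_pos[of l] by eventually_elim (use Suc in \<open>auto elim: eventually_mono\<close>)
  then have "AE p in density lborel (exponential_density l) \<Otimes>\<^sub>M erlang_measure l k. 0 \<le> fst p + snd p"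
  proof (intro PP.AE_pair_measure)
    show "{p \<in> space (density lborel (exponential_density l) \<Otimes>\<^sub>M erlang_measure l k). 0 \<le> fst p + snd p}
       \<in> sets (density lborel (exponential_density l) \<Otimes>\<^sub>M erlang_measure l k)" by measurable
  qed simp
  then show ?case unfolding erlang_measure.simps by (subst AE_distr_iff) (auto simp: case_prod_beta)
qed

text \<open>Exponential tilting: \<open>exp (\<theta> * s)\<close> times the density of rate
  \<open>l\<close> is \<open>l / (l - \<theta>)\<close> times the density of rate
  \<open>l - \<theta>\<close>.\<close>

lemma nn_integral_exp_erlang_measure:
  assumes "0 < l" "0 \<le> \<theta>" "\<theta> < l"
  shows "(\<integral>\<^sup>+t. ennreal (exp (\<theta> * t)) \<partial>erlang_measure l k) = ennreal ((l / (l - \<theta>)) ^ k)"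
proof (induction k)
  case 0
  show ?case by (simp add: nn_integral_return)
next
  case (Suc k)
  let ?E = "density lborel (exponential_density l)"
  interpret E: prob_space ?E using assms(1) by (rule prob_space_exponential_density)
  interpret R: prob_space "erlang_measure l k" by (rule prob_space_erlang_measure[OF assms(1)])
  interpret E': prob_space "density lborel (exponential_density (l - \<theta>))" using assms by (intro prob_space_exponential_density) simp
  have one: "(\<integral>\<^sup>+s. ennreal (exp (\<theta> * s)) \<partial>?E) = ennreal (l / (l - \<theta>))"
  proof -
    have "(\<integral>\<^sup>+s. ennreal (exp (\<theta> * s)) \<partial>?E) = (\<integral>\<^sup>+s. ennreal (exponential_density l s) * ennreal (exp (\<theta> * s)) \<partial>lborel)"
      by (subst nn_integral_density) auto
    also have "\<dots> = (\<integral>\<^sup>+s. ennreal (l / (l - \<theta>)) * ennreal (exponential_density (l - \<theta>) s) \<partial>lborel)"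
    proof (intro nn_integral_cong)
      fix s :: real
      have "exponential_density l s * exp (\<theta> * s) = l / (l - \<theta>) * exponential_density (l - \<theta>) s"
      proof -
        have "exp (- (s * l)) * exp (\<theta> * s) = exp (- (s * (l - \<theta>)))" by (simp add: exp_add[symmetric] algebra_simps)
        then show ?thesis using assms by (simp add: exponential_density_def mult.assoc)
      qed
      then show "ennreal (exponential_density l s) * ennreal (exp (\<theta> * s)) = ennreal (l / (l - \<theta>)) * ennreal (exponential_density (l - \<theta>) s)"
        using assms by (simp add: ennreal_mult'[symmetric] ennreal_mult''[symmetric] exponential_density_nonneg)
    qed
    also have "\<dots> = ennreal (l / (l - \<theta>)) * (\<integral>\<^sup>+s. ennreal (exponential_density (l - \<theta>) s) \<partial>lborel)"
      by (rule nn_integral_cmult) auto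
    also have "(\<integral>\<^sup>+s. ennreal (exponential_density (l - \<theta>) s) \<partial>lborel) = 1"
      using E'.emeasure_space_1 by (simp add: emeasure_density)
    finally show ?thesis by simp
  qed
  have "(\<integral>\<^sup>+t. ennreal (exp (\<theta> * t)) \<partial>erlang_measure l (Suc k)) =
     (\<integral>\<^sup>+p. ennreal (exp (\<theta> * (fst p + snd p))) \<partial>(?E \<Otimes>\<^sub>M erlang_measure l k))"
    by (simp add: nn_integral_distr case_prod_beta)
  also have "\<dots> = (\<integral>\<^sup>+s. \<integral>\<^sup>+t. ennreal (exp (\<theta> * (s + t))) \<partial>erlang_measure l k \<partial>?E)"
    by (subst R.nn_integral_fst[symmetric]) auto
  also have "\<dots> = (\<integral>\<^sup>+s. ennreal (exp (\<theta> * s)) * ennreal ((l / (l - \<theta>)) ^ k) \<partial>?E)"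
  proof (intro nn_integral_cong)
    fix s
    have "(\<integral>\<^sup>+t. ennreal (exp (\<theta> * (s + t))) \<partial>erlang_measure l k) = (\<integral>\<^sup>+t. ennreal (exp (\<theta> * s)) * ennreal (exp (\<theta> * t)) \<partial>erlang_measure l k)"
      by (simp add: distrib_left exp_add ennreal_mult)
    also have "\<dots> = ennreal (exp (\<theta> * s)) * (\<integral>\<^sup>+t. ennreal (exp (\<theta> * t)) \<partial>erlang_measure l k)"
      by (rule nn_integral_cmult) measurable
    finally show "(\<integral>\<^sup>+t. ennreal (exp (\<theta> * (s + t))) \<partial>erlang_measure l k) = ennreal (exp (\<theta> * s)) * ennreal ((l / (l - \<theta>)) ^ k)"
      by (simp only: Suc)
  qed
  also have "\<dots> = (\<integral>\<^sup>+s. ennreal (exp (\<theta> * s)) \<partial>?E) * ennreal ((l / (l - \<theta>)) ^ k)"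
    by (rule nn_integral_multc) auto
  also have "\<dots> = ennreal ((l / (l - \<theta>)) ^ Suc k)"
    unfolding one using assms by (simp add: ennreal_mult'[symmetric])
  finally show ?case .
qed

text \<open>Markov's inequality for \<open>exp (\<theta> * t)\<close>.\<close>

lemma erlang_measure_tail:
  assumes "0 < l" "0 \<le> \<theta>" "\<theta> < l"
  shows "measure (erlang_measure l k) {a<..} \<le> exp (- \<theta> * a) * (l / (l - \<theta>)) ^ k"
proof -
  interpret R: prob_space "erlang_measure l k" by (rule prob_space_erlang_measure[OF assms(1)])
  have "emeasure (erlang_measure l k) {a<..} = (\<integral>\<^sup>+t. indicator {a<..} t \<partial>erlang_measure l k)"
    by (simp add: sets_erlang_measure)
  also have "\<dots> \<le> (\<integral>\<^sup>+t. ennreal (exp (- \<theta> * a)) * ennreal (exp (\<theta> * t)) \<partial>erlang_measure l k)"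
  proof (intro nn_integral_mono)
    fix t
    have "1 \<le> exp (- \<theta> * a) * exp (\<theta> * t)" if "a < t"
      using that assms(2) by (simp add: exp_add[symmetric] mult_left_mono)
    then show "(indicator {a<..} t :: ennreal) \<le> ennreal (exp (- \<theta> * a)) * ennreal (exp (\<theta> * t))"
      by (auto simp: indicator_def ennreal_mult'[symmetric])
  qed
  also have "\<dots> = ennreal (exp (- \<theta> * a)) * (\<integral>\<^sup>+t. ennreal (exp (\<theta> * t)) \<partial>erlang_measure l k)"
    by (rule nn_integral_cmult) measurable
  also have "\<dots> = ennreal (exp (- \<theta> * a) * (l / (l - \<theta>)) ^ k)"
    unfolding nn_integral_exp_erlang_measure[OF assms] by (simp add: ennreal_mult')
  finally show ?thesis using assms by (simp add: R.emeasure_eq_measure)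
qed

section \<open>Dyadic refinement and the superharmonic envelope\<close>

context complete_levy_process
begin

lemma transition_cmult: "transition t (\<lambda>y. c * g y) y = c * transition t g y"
  by (simp add: transition_def)

lemma bermudan_le_Suc:
  assumes f: "bounded_continuous f" and "0 \<le> \<beta>"
  shows "bermudan \<beta> h f k y \<le> bermudan \<beta> h f (Suc k) y"
proof (induction k arbitrary: y)
  case (Suc k)
  have "\<beta> * transition h (bermudan \<beta> h f k) y \<le> \<beta> * transition h (bermudan \<beta> h f (Suc k)) y"
    using Suc \<open>0 \<le> \<beta>\<close> by (intro mult_left_mono transition_mono bounded_continuous_bermudan f)
  then show ?case by (auto simp: max_def)
qed simp

lemma bermudan_mono:
  assumes "bounded_continuous f" "0 \<le> \<beta>" "j \<le> k"
  shows "bermudan \<beta> h f j y \<le> bermudan \<beta> h f k y"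
  using lift_Suc_mono_le[of "\<lambda>k. bermudan \<beta> h f k y"] bermudan_le_Suc[OF assms(1,2)] assms(3) by blast

text \<open>Halving the mesh adds exercise dates; ignoring them recovers the coarse recursion, with
  discount \<open>\<beta> * \<beta>\<close> per double period.\<close>

lemma bermudan_refine:
  assumes f: "bounded_continuous f" and "0 \<le> \<beta>" "0 \<le> h"
  shows "bermudan (\<beta> * \<beta>) (h + h) f k y \<le> bermudan \<beta> h f (2 * k) y"
proof (induction k arbitrary: y)
  case (Suc k)
  let ?g = "bermudan \<beta> h f (2 * k)"
  note bc = bounded_continuous_bermudan[OF f]
  have "(\<beta> * \<beta>) * transition (h + h) (bermudan (\<beta> * \<beta>) (h + h) f k) y \<le> (\<beta> * \<beta>) * transition (h + h) ?g y"
    using Suc \<open>0 \<le> \<beta>\<close> by (intro mult_left_mono transition_mono bc) auto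
  also have "\<dots> = \<beta> * transition h (\<lambda>y. \<beta> * transition h ?g y) y"
    using \<open>0 \<le> h\<close> by (simp only: transition_add[OF _ _ bc] transition_cmult mult.assoc)
  also have "\<dots> \<le> \<beta> * transition h (bermudan \<beta> h f (Suc (2 * k))) y"
  proof (intro mult_left_mono transition_mono)
    show "bounded_continuous (\<lambda>y. \<beta> * transition h ?g y)" by (intro bounded_continuous_cmult bounded_continuous_transition bc)
  qed (use \<open>0 \<le> \<beta>\<close> bc in \<open>auto simp del: bermudan.simps(2)\<close>, simp)
  finally show ?case by (auto simp: max_def)
qed simp

text \<open>Waiting \<open>i\<close> periods before the first possible exercise is one admissible
  choice.\<close>

lemma bermudan_iterate:
  assumes f: "bounded_continuous f" and "0 \<le> \<beta>" "0 \<le> h"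
  shows "\<beta> ^ i * transition (real i * h) (bermudan \<beta> h f k) y \<le> bermudan \<beta> h f (i + k) y"
proof (induction i arbitrary: y)
  case 0
  show ?case using transition_0[OF bounded_continuous_bermudan[OF f]] by simp
next
  case (Suc i)
  note bc = bounded_continuous_bermudan[OF f]
  let ?g = "bermudan \<beta> h f k"
  have "\<beta> ^ Suc i * transition (real (Suc i) * h) ?g y = \<beta> * transition h (\<lambda>y. \<beta> ^ i * transition (real i * h) ?g y) y"
  proof -
    have "real (Suc i) * h = h + real i * h" by (simp add: distrib_right)
    then have "transition (real (Suc i) * h) ?g y = transition h (transition (real i * h) ?g) y" using \<open>0 \<le> h\<close> transition_add[OF _ _ bc] by simp
    then show ?thesis by (simp add: transition_cmult)
  qed
  also have "\<dots> \<le> \<beta> * transition h (bermudan \<beta> h f (i + k)) y"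
  proof (intro mult_left_mono transition_mono)
    show "bounded_continuous (\<lambda>y. \<beta> ^ i * transition (real i * h) ?g y)" by (intro bounded_continuous_cmult bounded_continuous_transition bc)
  qed (use \<open>0 \<le> \<beta>\<close> bc Suc in auto)
  finally show ?case by simp
qed

definition dyadic :: "real \<Rightarrow> (real \<Rightarrow> real) \<Rightarrow> nat \<Rightarrow> nat \<Rightarrow> real \<Rightarrow> real" where
  "dyadic r f m j = bermudan (exp (- r * (1 / 2 ^ m))) (1 / 2 ^ m) f j"

text \<open>A superharmonic majorant of \<open>f\<close>; monotone limits along dyadic meshes keep it measurable.\<close>

definition envelope :: "real \<Rightarrow> (real \<Rightarrow> real) \<Rightarrow> real \<Rightarrow> real \<Rightarrow> real" where
  "envelope r f t x = (SUP m. dyadic r f m (nat \<lfloor>t * 2 ^ m\<rfloor>) x)"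

context
  fixes r C :: real and f :: "real \<Rightarrow> real"
  assumes f: "bounded_continuous f" and r: "0 \<le> r" and C: "\<And>y. \<bar>f y\<bar> \<le> C"
begin

lemma dyadic_bc: "bounded_continuous (dyadic r f m j)"
  unfolding dyadic_def by (rule bounded_continuous_bermudan[OF f])

lemma dyadic_abs_le: "\<bar>dyadic r f m j x\<bar> \<le> C"
  unfolding dyadic_def by (intro bermudan_abs_le C) (use r in auto)

lemma dyadic_mono: "i \<le> j \<Longrightarrow> dyadic r f m i x \<le> dyadic r f m j x"
  unfolding dyadic_def by (intro bermudan_mono f) auto

lemma dyadic_le_Suc: "dyadic r f m j x \<le> dyadic r f (Suc m) (2 * j) x"
proof -
  have "bermudan (exp (- r * (1 / 2 ^ Suc m)) * exp (- r * (1 / 2 ^ Suc m))) (1 / 2 ^ Suc m + 1 / 2 ^ Suc m) f j x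
     \<le> bermudan (exp (- r * (1 / 2 ^ Suc m))) (1 / 2 ^ Suc m) f (2 * j) x"
    by (intro bermudan_refine f) auto
  moreover have "exp (- r * (1 / 2 ^ Suc m)) * exp (- r * (1 / 2 ^ Suc m)) = exp (- r * (1 / 2 ^ m))"
    by (simp add: exp_add[symmetric])
  moreover have "1 / 2 ^ Suc m + 1 / 2 ^ Suc m = (1 / 2 ^ m :: real)" by simp
  ultimately show ?thesis unfolding dyadic_def by simp
qed

lemma incseq_dyadic: "incseq (\<lambda>m. dyadic r f m (nat \<lfloor>t * 2 ^ m\<rfloor>) x)"
proof (rule incseq_SucI)
  fix m
  \<comment> \<open>Every coarse grid point up to \<open>t\<close> is also a fine grid point up to
    \<open>t\<close>, so rounding the horizon down loses less on the finer mesh.\<close>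
  have "2 * \<lfloor>t * 2 ^ m\<rfloor> \<le> \<lfloor>t * 2 ^ Suc m\<rfloor>" by (simp add: le_floor_iff algebra_simps)
  then have "2 * nat \<lfloor>t * 2 ^ m\<rfloor> \<le> nat \<lfloor>t * 2 ^ Suc m\<rfloor>" by linarith
  then have "dyadic r f (Suc m) (2 * nat \<lfloor>t * 2 ^ m\<rfloor>) x \<le> dyadic r f (Suc m) (nat \<lfloor>t * 2 ^ Suc m\<rfloor>) x" by (rule dyadic_mono)
  with dyadic_le_Suc show "dyadic r f m (nat \<lfloor>t * 2 ^ m\<rfloor>) x \<le> dyadic r f (Suc m) (nat \<lfloor>t * 2 ^ Suc m\<rfloor>) x" by (rule order_trans)
qed

lemma bdd_dyadic: "bdd_above (range (\<lambda>m. dyadic r f m (j m) x))"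
  by (rule bdd_aboveI2[where M=C]) (use dyadic_abs_le in \<open>simp add: abs_le_iff\<close>)

lemma dyadic_tendsto_envelope: "(\<lambda>m. dyadic r f m (nat \<lfloor>t * 2 ^ m\<rfloor>) x) \<longlonglongrightarrow> envelope r f t x"
  unfolding envelope_def by (rule LIMSEQ_incseq_SUP[OF bdd_dyadic incseq_dyadic])

lemma dyadic_le_envelope: "j \<le> nat \<lfloor>t * 2 ^ m\<rfloor> \<Longrightarrow> dyadic r f m j x \<le> envelope r f t x"
  unfolding envelope_def by (rule order_trans[OF dyadic_mono cSUP_upper[OF UNIV_I bdd_dyadic]])

lemma envelope_le: "(\<And>m. dyadic r f m (nat \<lfloor>t * 2 ^ m\<rfloor>) x \<le> c) \<Longrightarrow> envelope r f t x \<le> c"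
  unfolding envelope_def by (rule cSUP_least) auto

lemma envelope_abs_le: "\<bar>envelope r f t x\<bar> \<le> C"
  by (rule LIMSEQ_le_const2[OF tendsto_rabs[OF dyadic_tendsto_envelope]]) (auto intro: dyadic_abs_le)

lemma envelope_mono: "s \<le> t \<Longrightarrow> envelope r f s x \<le> envelope r f t x"
  by (intro envelope_le dyadic_le_envelope nat_mono floor_mono mult_right_mono) auto

lemma le_envelope: "f x \<le> envelope r f t x"
  by (rule order_trans[OF _ dyadic_le_envelope[of 0]]) (simp_all add: dyadic_def)

lemma envelope_le_opt_value:
  assumes "0 \<le> t"
  shows "envelope r f t x \<le> opt_value M X r f t x"
proof (rule envelope_le)
  fix m
  have "real (nat \<lfloor>t * 2 ^ m\<rfloor>) \<le> t * 2 ^ m" using assms by simp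
  then have "real (nat \<lfloor>t * 2 ^ m\<rfloor>) * (1 / 2 ^ m) \<le> t" by (simp add: divide_le_eq)
  then show "dyadic r f m (nat \<lfloor>t * 2 ^ m\<rfloor>) x \<le> opt_value M X r f t x"
    unfolding dyadic_def by (intro bermudan_le_opt_value f r) auto
qed

text \<open>For fixed \<open>m\<close> the horizon enters through an integer index only, so each
  approximation is measurable in the pair.\<close>

lemma measurable_envelope: "(\<lambda>(t, x). envelope r f t x) \<in> borel_measurable (borel \<Otimes>\<^sub>M borel)"
proof (rule borel_measurable_LIMSEQ_real)
  show "(\<lambda>m. case p of (t, x) \<Rightarrow> dyadic r f m (nat \<lfloor>t * 2 ^ m\<rfloor>) x) \<longlonglongrightarrow> (case p of (t, x) \<Rightarrow> envelope r f t x)" for p :: "real \<times> real"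
    using dyadic_tendsto_envelope by (cases p) auto
  have [measurable]: "dyadic r f m j \<in> borel_measurable borel" for m j
    by (rule bounded_continuous_measurable[OF dyadic_bc])
  have "(\<lambda>p :: real \<times> real. dyadic r f m (nat \<lfloor>fst p * 2 ^ m\<rfloor>) (snd p)) \<in> borel_measurable (borel \<Otimes>\<^sub>M borel)" for m
    by (rule measurable_compose_countable[where f="\<lambda>j p. dyadic r f m j (snd p)" and g="\<lambda>p. nat \<lfloor>fst p * 2 ^ m\<rfloor>"]) measurable
  then show "(\<lambda>p :: real \<times> real. case p of (t, x) \<Rightarrow> dyadic r f m (nat \<lfloor>t * 2 ^ m\<rfloor>) x) \<in> borel_measurable (borel \<Otimes>\<^sub>M borel)" for m
    by (simp add: case_prod_beta)
qed

lemma measurable_envelope_compose: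
  assumes "g \<in> borel_measurable A" "h \<in> borel_measurable A"
  shows "(\<lambda>z. envelope r f (g z) (h z)) \<in> borel_measurable A"
  using measurable_compose[OF measurable_Pair[OF assms] measurable_envelope] by simp

text \<open>Waiting for about \<open>s\<close> and then facing horizon \<open>t\<close> is
  admissible for horizon \<open>s + t\<close>. On mesh \<open>m'\<close> the two rounded-down
  horizons add up to at most the rounded-down sum. First \<open>m'\<close> tends to infinity with
  \<open>m\<close> fixed, to reach \<open>s\<close> exactly, and then \<open>m\<close>.\<close>

lemma envelope_superharmonic:
  assumes "0 \<le> s" "0 \<le> t"
  shows "exp (- r * s) * expectation (\<lambda>\<omega>. envelope r f t (x + X s \<omega>)) \<le> envelope r f (s + t) x"
proof -
  have [measurable]: "X s \<in> borel_measurable M" by (rule measurable_X) fact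
  have [measurable]: "dyadic r f m j \<in> borel_measurable borel" for m j
    by (rule bounded_continuous_measurable[OF dyadic_bc])
  have le: "exp (- r * s) * transition s (dyadic r f m (nat \<lfloor>t * 2 ^ m\<rfloor>)) x \<le> envelope r f (s + t) x" for m
  proof -
    let ?g = "dyadic r f m (nat \<lfloor>t * 2 ^ m\<rfloor>)"
    define s' where "s' m' = real (nat \<lfloor>s * 2 ^ m'\<rfloor>) * (1 / 2 ^ m')" for m' :: nat
    have s': "s' \<longlonglongrightarrow> s"
    proof (rule real_tendsto_sandwich[of "\<lambda>m'. s - (1 / 2) ^ m'" _ _ "\<lambda>_. s"])
      have b: "s * 2 ^ m' - 1 \<le> real (nat \<lfloor>s * 2 ^ m'\<rfloor>)" "real (nat \<lfloor>s * 2 ^ m'\<rfloor>) \<le> s * 2 ^ m'" for m' :: nat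
      proof -
        have "0 \<le> s * 2 ^ m'" using assms by simp
        then show "s * 2 ^ m' - 1 \<le> real (nat \<lfloor>s * 2 ^ m'\<rfloor>)" "real (nat \<lfloor>s * 2 ^ m'\<rfloor>) \<le> s * 2 ^ m'" by linarith+
      qed
      have "s - (1 / 2) ^ m' \<le> s' m'" for m'
        using divide_right_mono[OF b(1), of "2 ^ m'" m'] by (simp add: s'_def diff_divide_distrib power_one_over)
      moreover have "s' m' \<le> s" for m'
        using b(2)[of m'] by (simp add: s'_def divide_le_eq)
      ultimately show "\<forall>\<^sub>F m' in sequentially. s - (1 / 2) ^ m' \<le> s' m'" "\<forall>\<^sub>F m' in sequentially. s' m' \<le> s"
        by auto
      show "(\<lambda>m'. s - (1 / 2) ^ m') \<longlonglongrightarrow> s"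
        using tendsto_diff[OF tendsto_const[of s] LIMSEQ_power_zero[of "1 / 2 :: real"]] by simp
    qed simp
    have "(\<lambda>m'. exp (- r * s' m') * transition (s' m') ?g x) \<longlonglongrightarrow> exp (- r * s) * transition s ?g x"
      by (intro tendsto_mult tendsto_exp tendsto_const s' transition_tendsto dyadic_bc)
    then show ?thesis
    proof (rule LIMSEQ_le_const2, intro exI[of _ m] allI impI)
      fix m' assume "m \<le> m'"
      let ?b = "exp (- r * (1 / 2 ^ m'))" and ?i = "nat \<lfloor>s * 2 ^ m'\<rfloor>" and ?k = "nat \<lfloor>t * 2 ^ m'\<rfloor>"
      have "exp (- r * s' m') * transition (s' m') ?g x \<le> exp (- r * s' m') * transition (s' m') (dyadic r f m' ?k) x"
        using incseqD[OF incseq_dyadic \<open>m \<le> m'\<close>] by (intro mult_left_mono transition_mono dyadic_bc) auto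
      also have "\<dots> = ?b ^ ?i * transition (real ?i * (1 / 2 ^ m')) (dyadic r f m' ?k) x"
        by (simp add: s'_def exp_of_nat_mult[symmetric] mult_ac)
      also have "\<dots> \<le> dyadic r f m' (?i + ?k) x"
        unfolding dyadic_def by (intro bermudan_iterate f) auto
      also have "\<dots> \<le> envelope r f (s + t) x"
      proof (rule dyadic_le_envelope)
        have "\<lfloor>s * 2 ^ m'\<rfloor> + \<lfloor>t * 2 ^ m'\<rfloor> \<le> \<lfloor>s * 2 ^ m' + t * 2 ^ m'\<rfloor>" by (rule le_floor_add)
        moreover have "0 \<le> \<lfloor>s * 2 ^ m'\<rfloor>" "0 \<le> \<lfloor>t * 2 ^ m'\<rfloor>" using assms by auto
        ultimately show "?i + ?k \<le> nat \<lfloor>(s + t) * 2 ^ m'\<rfloor>" by (simp add: distrib_right nat_add_distrib[symmetric])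
      qed
      finally show "exp (- r * s' m') * transition (s' m') ?g x \<le> envelope r f (s + t) x" .
    qed
  qed
  have lim: "(\<lambda>m. exp (- r * s) * transition s (dyadic r f m (nat \<lfloor>t * 2 ^ m\<rfloor>)) x) \<longlonglongrightarrow>
      exp (- r * s) * expectation (\<lambda>\<omega>. envelope r f t (x + X s \<omega>))"
  proof (intro tendsto_mult tendsto_const)
    have "(\<lambda>m. expectation (\<lambda>\<omega>. dyadic r f m (nat \<lfloor>t * 2 ^ m\<rfloor>) (x + X s \<omega>))) \<longlonglongrightarrow> expectation (\<lambda>\<omega>. envelope r f t (x + X s \<omega>))"
      by (rule bounded_convergence_complete[where C=C]) (auto intro: dyadic_abs_le dyadic_tendsto_envelope)
    then show "(\<lambda>m. transition s (dyadic r f m (nat \<lfloor>t * 2 ^ m\<rfloor>)) x) \<longlonglongrightarrow> expectation (\<lambda>\<omega>. envelope r f t (x + X s \<omega>))"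
      using assms by (simp add: transition_def)
  qed
  show ?thesis by (rule LIMSEQ_le_const2[OF lim]) (use le in blast)
qed

end

text \<open>
  A killed exponential clock: discounting by the constant \<open>\<beta>\<close> at rate \<open>l\<close> is continuous
  discounting at rate \<open>l (1 - \<beta>)\<close> up to an exponential time of rate \<open>l \<beta>\<close>.
\<close>

lemma discounted_expo:
  assumes "0 < l" "0 < \<beta>" "bounded_continuous g"
  shows "\<beta> * expo l g x = (\<integral>s. exp (- (l * (1 - \<beta>)) * s) * transition s g x \<partial>density lborel (exponential_density (l * \<beta>)))"
proof -
  note [measurable] = measurable_transition_time[OF assms(3)]
  have "\<beta> * expo l g x = (\<integral>s. \<beta> * (exponential_density l s * transition s g x) \<partial>lborel)"
    using assms unfolding expo_def
    by (subst integral_density) (auto simp: exponential_density_nonneg)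
  also have "\<dots> = (\<integral>s. exponential_density (l * \<beta>) s * (exp (- (l * (1 - \<beta>)) * s) * transition s g x) \<partial>lborel)"
  proof (rule Bochner_Integration.integral_cong)
    fix s
    have "\<beta> * exponential_density l s = exponential_density (l * \<beta>) s * exp (- (l * (1 - \<beta>)) * s)"
      by (auto simp: exponential_density_def exp_add[symmetric] algebra_simps)
    then show "\<beta> * (exponential_density l s * transition s g x) = exponential_density (l * \<beta>) s * (exp (- (l * (1 - \<beta>)) * s) * transition s g x)"
      by (simp add: mult.assoc[symmetric])
  qed simp
  also have "\<dots> = (\<integral>s. exp (- (l * (1 - \<beta>)) * s) * transition s g x \<partial>density lborel (exponential_density (l * \<beta>)))"
    using assms by (subst integral_density) (auto simp: exponential_density_nonneg)
  finally show ?thesis .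
qed

text \<open>\<open>discounted_expo\<close> rewrites one step with the converted rate
  \<open>\<rho>\<close>, the induction hypothesis supplies an Erlang horizon \<open>t\<close>, and
  superharmonicity merges it with the exponential time \<open>s\<close> into \<open>s + t\<close>,
  an Erlang horizon with one more stage.\<close>

lemma rand_iter_le_envelope:
  assumes f: "bounded_continuous f" and "0 < l" "0 < \<beta>" "\<beta> \<le> 1"
  defines "\<rho> \<equiv> l * (1 - \<beta>)"
  shows "rand_iter l \<beta> f k x \<le> (\<integral>t. envelope \<rho> f t x \<partial>erlang_measure (l * \<beta>) k)"
proof (induction k arbitrary: x)
  case 0
  obtain C where C: "\<And>y. \<bar>f y\<bar> \<le> C" using f bounded_continuousE by blast
  have \<rho>: "0 \<le> \<rho>" using assms by (simp add: \<rho>_def)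
  have "(\<lambda>t. envelope \<rho> f t x) \<in> borel_measurable borel"
    by (rule measurable_envelope_compose[OF f \<rho> C]) auto
  then show ?case using le_envelope[OF f \<rho> C, of x 0] by (simp add: integral_return)
next
  case (Suc k)
  obtain C where C: "\<And>y. \<bar>f y\<bar> \<le> C" using f bounded_continuousE by blast
  have \<rho>: "0 \<le> \<rho>" and lb: "0 < l * \<beta>" using assms by (auto simp: \<rho>_def)
  note env_meas = measurable_envelope_compose[OF f \<rho> C]
  note env_le = envelope_abs_le[OF f \<rho> C]
  let ?E = "density lborel (exponential_density (l * \<beta>))" and ?R = "erlang_measure (l * \<beta>) k"
  let ?w = "rand_iter l \<beta> f k"
  interpret E: prob_space ?E using lb by (rule prob_space_exponential_density)
  interpret R: prob_space ?R by (rule prob_space_erlang_measure[OF lb])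
  interpret R': prob_space "erlang_measure (l * \<beta>) (Suc k)" by (rule prob_space_erlang_measure[OF lb])
  interpret ER: pair_prob_space ?E ?R ..
  interpret MR: pair_prob_space M ?R ..
  have bcw: "bounded_continuous ?w" by (rule bounded_continuous_rand_iter[OF \<open>0 < l\<close> f])
  have bch: "bounded_continuous (rand_iter l \<beta> f (Suc k))" by (rule bounded_continuous_rand_iter[OF \<open>0 < l\<close> f])
  obtain D where D: "\<And>y. \<bar>?w y\<bar> \<le> D" using bcw bounded_continuousE by blast
  have [measurable]: "?w \<in> borel_measurable borel" by (rule bounded_continuous_measurable[OF bcw])
  note [measurable] = measurable_transition_time[OF bcw]
  have m1: "(\<lambda>t. envelope \<rho> f t x) \<in> borel_measurable (erlang_measure (l * \<beta>) k')" for k' x by (rule env_meas) auto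
  have m2: "(\<lambda>t. envelope \<rho> f (s + t) x) \<in> borel_measurable ?R" for s x by (rule env_meas) auto
  have m3: "(\<lambda>p. envelope \<rho> f (fst p + snd p) x) \<in> borel_measurable (?E \<Otimes>\<^sub>M ?R)" for x by (rule env_meas) measurable
  have int_Suc: "(\<integral>t. envelope \<rho> f t x \<partial>erlang_measure (l * \<beta>) (Suc k)) = (\<integral>s. \<integral>t. envelope \<rho> f (s + t) x \<partial>?R \<partial>?E)" for x
  proof -
    have "(\<integral>t. envelope \<rho> f t x \<partial>erlang_measure (l * \<beta>) (Suc k)) = (\<integral>p. envelope \<rho> f (fst p + snd p) x \<partial>(?E \<Otimes>\<^sub>M ?R))"
      by (simp, subst integral_distr) (auto simp: case_prod_beta intro!: env_meas)
    also have "\<dots> = (\<integral>s. \<integral>t. envelope \<rho> f (s + t) x \<partial>?R \<partial>?E)"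
      using ER.integral_fst'[of "\<lambda>p. envelope \<rho> f (fst p + snd p) x"] ER.P.integrable_bounded[OF m3 env_le] by simp
    finally show ?thesis .
  qed
  have "f x \<le> (\<integral>t. envelope \<rho> f t x \<partial>erlang_measure (l * \<beta>) (Suc k))"
  proof -
    have "(\<integral>t. f x \<partial>erlang_measure (l * \<beta>) (Suc k)) \<le> (\<integral>t. envelope \<rho> f t x \<partial>erlang_measure (l * \<beta>) (Suc k))"
      by (intro integral_mono R'.integrable_const R'.integrable_bounded[OF m1 env_le] le_envelope[OF f \<rho> C])
    then show ?thesis using R'.prob_space by simp
  qed
  moreover have "\<beta> * expo l ?w x \<le> (\<integral>t. envelope \<rho> f t x \<partial>erlang_measure (l * \<beta>) (Suc k))"
    unfolding int_Suc discounted_expo[OF \<open>0 < l\<close> \<open>0 < \<beta>\<close> bcw] \<rho>_def[symmetric]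
  proof (rule integral_mono_AE)
    show "integrable ?E (\<lambda>s. exp (- \<rho> * s) * transition s ?w x)"
    proof (rule E.integrable_const_bound[where B=D])
      show "AE s in ?E. norm (exp (- \<rho> * s) * transition s ?w x) \<le> D"
        using exponential_AE_pos
      proof eventually_elim
        case (elim s)
        have "\<bar>exp (- \<rho> * s)\<bar> * \<bar>transition s ?w x\<bar> \<le> 1 * D"
          using elim \<rho> transition_abs_le[OF D] by (intro mult_mono) auto
        then show ?case by (simp add: abs_mult)
      qed
    qed measurable
    have "(\<lambda>s. \<integral>t. envelope \<rho> f (s + t) x \<partial>?R) \<in> borel_measurable ?E"
      using m3 by (intro R.borel_measurable_lebesgue_integral) (simp add: case_prod_beta)
    moreover have "\<bar>\<integral>t. envelope \<rho> f (s + t) x \<partial>?R\<bar> \<le> C" for s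
      using env_le order_trans[OF abs_ge_zero C] by (intro R.abs_expectation_le) auto
    ultimately show "integrable ?E (\<lambda>s. \<integral>t. envelope \<rho> f (s + t) x \<partial>?R)" by (intro E.integrable_bounded[where C=C])
    show "AE s in ?E. exp (- \<rho> * s) * transition s ?w x \<le> (\<integral>t. envelope \<rho> f (s + t) x \<partial>?R)"
      using exponential_AE_pos
    proof eventually_elim
      case (elim s)
      have [measurable]: "X s \<in> borel_measurable M" using elim by (intro measurable_X) simp
      have m4: "(\<lambda>(\<omega>, t). envelope \<rho> f t (x + X s \<omega>)) \<in> borel_measurable (M \<Otimes>\<^sub>M ?R)"
        unfolding case_prod_beta by (rule env_meas) measurable
      have m5: "(\<lambda>(t, \<omega>). envelope \<rho> f t (x + X s \<omega>)) \<in> borel_measurable (?R \<Otimes>\<^sub>M M)"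
        unfolding case_prod_beta by (rule env_meas) measurable
      have m6: "(\<lambda>t. expectation (\<lambda>\<omega>. envelope \<rho> f t (x + X s \<omega>))) \<in> borel_measurable ?R"
        using m5 by (rule borel_measurable_lebesgue_integral)
      have m7: "(\<lambda>\<omega>. \<integral>t. envelope \<rho> f t (x + X s \<omega>) \<partial>?R) \<in> borel_measurable M"
        using m4 by (rule R.borel_measurable_lebesgue_integral)
      have b7: "\<bar>\<integral>t. envelope \<rho> f t y \<partial>?R\<bar> \<le> C" for y
        using env_le order_trans[OF abs_ge_zero C] by (intro R.abs_expectation_le) auto
      have b6: "\<bar>expectation (\<lambda>\<omega>. envelope \<rho> f t (x + X s \<omega>))\<bar> \<le> C" for t
        using env_le order_trans[OF abs_ge_zero C] by (intro abs_expectation_le) auto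
      have "transition s ?w x = expectation (\<lambda>\<omega>. ?w (x + X s \<omega>))" using elim by (simp add: transition_def)
      also have "\<dots> \<le> expectation (\<lambda>\<omega>. \<integral>t. envelope \<rho> f t (x + X s \<omega>) \<partial>?R)"
        by (intro integral_mono integrable_bounded[OF m7 b7] integrable_bounded[where C=D] Suc D) measurable
      also have "\<dots> = (\<integral>t. expectation (\<lambda>\<omega>. envelope \<rho> f t (x + X s \<omega>)) \<partial>?R)"
        by (rule MR.Fubini_integral[symmetric], rule MR.P.integrable_bounded[OF m4, where C=C]) (simp add: case_prod_beta env_le)
      finally have "exp (- \<rho> * s) * transition s ?w x \<le> exp (- \<rho> * s) * (\<integral>t. expectation (\<lambda>\<omega>. envelope \<rho> f t (x + X s \<omega>)) \<partial>?R)"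
        by (intro mult_left_mono) auto
      also have "\<dots> = (\<integral>t. exp (- \<rho> * s) * expectation (\<lambda>\<omega>. envelope \<rho> f t (x + X s \<omega>)) \<partial>?R)" by simp
      also have "\<dots> \<le> (\<integral>t. envelope \<rho> f (s + t) x \<partial>?R)"
      proof (rule integral_mono_AE)
        show "AE t in ?R. exp (- \<rho> * s) * expectation (\<lambda>\<omega>. envelope \<rho> f t (x + X s \<omega>)) \<le> envelope \<rho> f (s + t) x"
          using erlang_measure_AE_nonneg[OF lb]
        proof eventually_elim
          case (elim t)
          then show ?case using envelope_superharmonic[OF f \<rho> C, of s t x] \<open>0 < s\<close> by simp
        qed
        show "integrable ?R (\<lambda>t. exp (- \<rho> * s) * expectation (\<lambda>\<omega>. envelope \<rho> f t (x + X s \<omega>)))"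
          by (intro integrable_mult_right R.integrable_bounded[OF m6 b6])
        show "integrable ?R (\<lambda>t. envelope \<rho> f (s + t) x)" by (rule R.integrable_bounded[OF m2 env_le])
      qed
      finally show ?case .
    qed
  qed
  ultimately show ?case by simp
qed

text \<open>The envelope increases with the horizon, so horizons up to \<open>a\<close> are bounded
  by the value at \<open>a\<close>; longer ones cost at most \<open>2 * C\<close> times the Erlang
  tail.\<close>

lemma rand_iter_le_opt_value:
  assumes f: "bounded_continuous f" and C: "\<And>y. \<bar>f y\<bar> \<le> C" and "0 < l" "0 < \<beta>" "\<beta> \<le> 1" "0 \<le> a" "0 \<le> \<theta>" "\<theta> < l * \<beta>"
  shows "rand_iter l \<beta> f k x \<le> opt_value M X (l * (1 - \<beta>)) f a x +
    2 * C * (exp (- \<theta> * a) * (l * \<beta> / (l * \<beta> - \<theta>)) ^ k)"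
proof -
  let ?r = "l * (1 - \<beta>)" and ?R = "erlang_measure (l * \<beta>) k"
  have r: "0 \<le> ?r" and lb: "0 < l * \<beta>" using assms by auto
  have C0: "0 \<le> C" using order_trans[OF abs_ge_zero C] .
  interpret R: prob_space ?R by (rule prob_space_erlang_measure[OF lb])
  have le: "envelope ?r f t x \<le> envelope ?r f a x + 2 * C * indicator {a<..} t" for t
  proof (cases "a < t")
    case True
    then show ?thesis using envelope_abs_le[OF f r C, of t x] envelope_abs_le[OF f r C, of a x] by simp
  next
    case False
    then show ?thesis using envelope_mono[OF f r C, of t a x] by simp
  qed
  have ind: "integrable ?R (indicator {a<..} :: real \<Rightarrow> real)"
    by (rule integrable_real_indicator) (auto simp: sets_erlang_measure R.emeasure_eq_measure)
  have "rand_iter l \<beta> f k x \<le> (\<integral>t. envelope ?r f t x \<partial>?R)"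
    by (rule rand_iter_le_envelope) (use assms in auto)
  also have "\<dots> \<le> (\<integral>t. envelope ?r f a x + 2 * C * indicator {a<..} t \<partial>?R)"
  proof (rule integral_mono)
    show "integrable ?R (\<lambda>t. envelope ?r f t x)"
      by (rule R.integrable_bounded[OF measurable_envelope_compose[OF f r C] envelope_abs_le[OF f r C]]) auto
    show "integrable ?R (\<lambda>t. envelope ?r f a x + 2 * C * indicator {a<..} t)"
      using ind by auto
  qed (rule le)
  also have "\<dots> = envelope ?r f a x + 2 * C * measure ?R {a<..}"
    using ind R.prob_space by (simp add: space_erlang_measure)
  also have "\<dots> \<le> opt_value M X ?r f a x + 2 * C * (exp (- \<theta> * a) * (l * \<beta> / (l * \<beta> - \<theta>)) ^ k)"
    using C0 by (intro add_mono mult_left_mono envelope_le_opt_value[OF f r C] erlang_measure_tail lb assms) auto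
  finally show ?thesis .
qed

end

subsection \<open>Asymptotics\<close>

text \<open>Follows from \<open>ln (1 - y) \<ge> - y - 2 * y\<^sup>2\<close> for
  \<open>y = \<theta> / l\<close>. The exponent is \<open>\<theta>\<close> times the mean
  \<open>real k / l\<close> of the Erlang law, up to a term that vanishes as \<open>l\<close> grows
  with \<open>real k / l\<close> bounded.\<close>

lemma geometric_power_le_exp:
  assumes "0 \<le> \<theta>" "2 * \<theta> \<le> l" "0 < (l :: real)"
  shows "(l / (l - \<theta>)) ^ k \<le> exp (real k / l * (\<theta> + 2 * \<theta> * (\<theta> / l)))"
proof -
  define y where "y = \<theta> / l"
  have y: "0 \<le> y" "y \<le> 1 / 2" using assms by (auto simp: y_def divide_le_eq)
  have "- y - 2 * y\<^sup>2 \<le> ln (1 - y)" by (rule ln_one_minus_pos_lower_bound) (use y in auto)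
  then have "exp (- y - 2 * y\<^sup>2) \<le> 1 - y" using y by (subst (asm) ln_ge_iff) auto
  then have "1 / (1 - y) \<le> 1 / exp (- y - 2 * y\<^sup>2)" by (intro divide_left_mono) (use y in auto)
  also have "\<dots> = exp (- (- y - 2 * y\<^sup>2))" by (simp only: exp_minus inverse_eq_divide)
  also have "- (- y - 2 * y\<^sup>2) = y + 2 * y\<^sup>2" by simp
  finally have "l / (l - \<theta>) \<le> exp (y + 2 * y\<^sup>2)" using assms by (simp add: y_def diff_divide_eq_iff)
  then have "(l / (l - \<theta>)) ^ k \<le> exp (y + 2 * y\<^sup>2) ^ k" using assms by (intro power_mono) auto
  also have "\<dots> = exp (real k * (y + 2 * y\<^sup>2))" by (simp add: exp_of_nat_mult)
  also have "real k * (y + 2 * y\<^sup>2) = real k / l * (\<theta> + 2 * \<theta> * (\<theta> / l))" by (simp add: y_def power2_eq_square algebra_simps add_divide_distrib)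
  finally show ?thesis .
qed

section \<open>Elementary bounds and the upper limit of the recursion\<close>

context complete_levy_process
begin

lemma rand_iter_abs_le:
  assumes "0 < l" "\<And>y. \<bar>f y\<bar> \<le> C" "0 \<le> \<beta>" "\<beta> \<le> 1"
  shows "\<bar>rand_iter l \<beta> f k y\<bar> \<le> C"
proof (induction k arbitrary: y)
  case (Suc k)
  have "\<bar>\<beta> * expo l (rand_iter l \<beta> f k) y\<bar> \<le> 1 * C"
    unfolding abs_mult using assms order_trans[OF abs_ge_zero assms(2)] by (intro mult_mono expo_abs_le Suc) auto
  then show ?case using assms(2)[of y] by (auto simp: max_def)
qed (simp add: assms)

lemma rand_iter_mono:
  assumes "0 < l" "bounded_continuous f" "0 \<le> \<beta>" "j \<le> k"
  shows "rand_iter l \<beta> f j y \<le> rand_iter l \<beta> f k y"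
proof -
  have "rand_iter l \<beta> f i y \<le> rand_iter l \<beta> f (Suc i) y" for i y
  proof (induction i arbitrary: y)
    case (Suc i)
    have "\<beta> * expo l (rand_iter l \<beta> f i) y \<le> \<beta> * expo l (rand_iter l \<beta> f (Suc i)) y"
      by (intro mult_left_mono expo_mono assms bounded_continuous_rand_iter Suc)
    then show ?case by (auto simp: max_def)
  qed simp
  then show ?thesis using lift_Suc_mono_le[of "\<lambda>i. rand_iter l \<beta> f i y"] assms(4) by blast
qed

lemma le_rand_iter: "f y \<le> rand_iter l \<beta> f k y"
  by (cases k) auto

lemma expo_cmult: "expo l (\<lambda>y. c * g y) y = c * expo l g y"
  by (simp add: expo_def transition_cmult)

lemma bounded_continuous_expo_power: "0 < l \<Longrightarrow> bounded_continuous g \<Longrightarrow> bounded_continuous ((expo l ^^ j) g)"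
  by (induction j) (auto intro: bounded_continuous_expo)

text \<open>Skipping exercise at the start and at the jumps before the \<open>j\<close>-th is one
  admissible choice.\<close>

lemma rand_iter_ge_power:
  assumes "0 < l" "bounded_continuous f" "0 \<le> \<beta>"
  shows "\<beta> ^ j * (expo l ^^ j) (rand_iter l \<beta> f i) y \<le> rand_iter l \<beta> f (j + i) y"
proof (induction j arbitrary: y)
  case (Suc j)
  note bc = bounded_continuous_rand_iter[OF assms(1,2)]
  have "\<beta> ^ Suc j * (expo l ^^ Suc j) (rand_iter l \<beta> f i) y = \<beta> * expo l (\<lambda>y. \<beta> ^ j * (expo l ^^ j) (rand_iter l \<beta> f i) y) y"
    by (simp add: expo_cmult)
  also have "\<dots> \<le> \<beta> * expo l (rand_iter l \<beta> f (j + i)) y"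
    by (intro mult_left_mono expo_mono assms bounded_continuous_cmult bounded_continuous_expo_power bc Suc)
  finally show ?case by simp
qed simp

lemma eventually_rand_iter_le:
  assumes f: "bounded_continuous f" and r: "0 \<le> r" and T: "0 \<le> T" and k: "(\<lambda>n. real (k n) / real n) \<longlonglongrightarrow> T" and \<epsilon>: "0 < \<epsilon>"
  shows "eventually (\<lambda>n. rand_iter (real n) (exp (- r / real n)) f (k n) x \<le> opt_value M X r f T x + \<epsilon>) sequentially"
proof -
  obtain C where C: "0 \<le> C" "\<And>y. \<bar>f y\<bar> \<le> C" using f bounded_continuousE by blast
  obtain d where d: "0 < d" "\<And>r' T'. 0 \<le> r' \<Longrightarrow> \<bar>r' - r\<bar> < d \<Longrightarrow> T \<le> T' \<Longrightarrow> T' < T + d \<Longrightarrow> opt_value M X r' f T' x \<le> opt_value M X r f T x + \<epsilon> / 2"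
    using opt_value_upper_semicontinuous[OF f r T, of "\<epsilon> / 2" x] \<epsilon> by auto
  \<comment> \<open>Halfway into the window of semicontinuity, this horizon exceeds the limit
    \<open>T\<close> of the Erlang means by \<open>d / 2\<close>.\<close>
  define a where "a = T + d / 2"
  \<comment> \<open>Chosen so that the limiting tail term is
    \<open>2 * C * exp (- (8 * C / \<epsilon>))\<close>, which is at most
    \<open>2 * C * \<epsilon> / (\<epsilon> + 8 * C)\<close> and hence below
    \<open>\<epsilon> / 2\<close>.\<close>
  define \<theta> where "\<theta> = 8 * C / \<epsilon> / (d / 2)"
  have \<theta>: "0 \<le> \<theta>" "\<theta> * (d / 2) = 8 * C / \<epsilon>" using C d \<epsilon> by (auto simp: \<theta>_def)
  define \<beta> where "\<beta> n = exp (- r / real n)" for n :: nat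
  define l where "l n = real n * \<beta> n" for n
  have \<beta>1: "\<beta> \<longlonglongrightarrow> 1"
  proof -
    have "(\<lambda>n. exp (- r / real n)) \<longlonglongrightarrow> exp 0" by (intro tendsto_exp lim_const_over_n)
    then show ?thesis by (simp add: \<beta>_def[abs_def])
  qed
  have l_top: "filterlim l at_top sequentially"
    unfolding l_def mult.commute[of "real _"]
    by (rule filterlim_tendsto_pos_mult_at_top[OF \<beta>1 _ filterlim_real_sequentially]) simp
  have kl: "(\<lambda>n. real (k n) / l n) \<longlonglongrightarrow> T"
    using tendsto_divide[OF k \<beta>1] by (simp add: l_def)
  have \<theta>l: "(\<lambda>n. \<theta> / l n) \<longlonglongrightarrow> 0" by (rule real_tendsto_divide_at_top[OF tendsto_const l_top])
  define q where "q n = - \<theta> * a + real (k n) / l n * (\<theta> + 2 * \<theta> * (\<theta> / l n))" for n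
  have "q \<longlonglongrightarrow> - \<theta> * a + T * (\<theta> + 2 * \<theta> * 0)"
    unfolding q_def by (intro tendsto_add tendsto_mult tendsto_const kl \<theta>l)
  then have "(\<lambda>n. 2 * C * exp (q n)) \<longlonglongrightarrow> 2 * C * exp (- (\<theta> * (d / 2)))"
    by (intro tendsto_mult tendsto_exp tendsto_const) (simp add: a_def algebra_simps)
  moreover have "2 * C * exp (- (\<theta> * (d / 2))) < \<epsilon> / 2"
  proof -
    have "exp (- (8 * C / \<epsilon>)) \<le> 1 / (1 + 8 * C / \<epsilon>)"
      using exp_ge_add_one_self[of "8 * C / \<epsilon>"] C \<epsilon> by (simp add: exp_minus inverse_eq_divide frac_le add_pos_nonneg)
    then have "2 * C * exp (- (8 * C / \<epsilon>)) \<le> 2 * C * (1 / (1 + 8 * C / \<epsilon>))" using C by (intro mult_left_mono) auto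
    also have "\<dots> = 2 * C * \<epsilon> / (\<epsilon> + 8 * C)" using \<epsilon> by (simp add: field_simps)
    also have "\<dots> < \<epsilon> / 2"
    proof -
      have "0 < \<epsilon> * \<epsilon>" "0 \<le> C * \<epsilon>" "0 < \<epsilon> + 8 * C" using C \<epsilon> by auto
      then show ?thesis by (simp add: divide_less_eq algebra_simps)
    qed
    finally show ?thesis unfolding \<theta>(2) .
  qed
  ultimately have ev1: "eventually (\<lambda>n. 2 * C * exp (q n) < \<epsilon> / 2) sequentially" by (rule order_tendstoD(2))
  \<comment> \<open>The added 1 keeps \<open>\<theta> < l n\<close> even for
    \<open>\<theta> = 0\<close>, which occurs when \<open>C = 0\<close>.\<close>
  have ev2: "eventually (\<lambda>n. 2 * \<theta> + 1 \<le> l n) sequentially" using l_top by (simp add: filterlim_at_top)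
  \<comment> \<open>The converted rate \<open>real n * (1 - \<beta> n)\<close> lies between
    \<open>r - r\<^sup>2 / real n\<close> and \<open>r\<close>.\<close>
  have "(\<lambda>n. r\<^sup>2 / real n) \<longlonglongrightarrow> 0" by (rule lim_const_over_n)
  then have ev3: "eventually (\<lambda>n. r\<^sup>2 / real n < d) sequentially" by (rule order_tendstoD(2)) (rule d(1))
  from ev1 ev2 ev3 eventually_gt_at_top[of 0] show ?thesis
  proof eventually_elim
    case (elim n)
    have n: "0 < real n" using elim(4) by simp
    have b: "0 < \<beta> n" "\<beta> n \<le> 1" using r n by (auto simp: \<beta>_def)
    let ?r = "real n * (1 - \<beta> n)"
    have "\<bar>?r - r\<bar> < d"
    proof -
      have "1 - r / real n \<le> \<beta> n" using exp_ge_add_one_self[of "- r / real n"] by (simp add: \<beta>_def)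
      then have "real n * (1 - \<beta> n) \<le> real n * (r / real n)" using n by (intro mult_left_mono) auto
      moreover have "\<beta> n \<le> 1 - r / real n + (r / real n)\<^sup>2" using exp_minus_upper[of "r / real n"] r n by (simp add: \<beta>_def)
      then have "real n * (r / real n - (r / real n)\<^sup>2) \<le> real n * (1 - \<beta> n)" using n by (intro mult_left_mono) auto
      moreover have "real n * (r / real n) = r" "real n * (r / real n - (r / real n)\<^sup>2) = r - r\<^sup>2 / real n"
        using n by (simp_all add: right_diff_distrib power2_eq_square)
      ultimately show ?thesis using elim(3) r n by (auto simp: abs_less_iff)
    qed
    then have opt: "opt_value M X ?r f a x \<le> opt_value M X r f T x + \<epsilon> / 2"
      using n b d(1) by (intro d(2)) (auto simp: a_def)
    have "rand_iter (real n) (\<beta> n) f (k n) x \<le> opt_value M X ?r f a x + 2 * C * (exp (- \<theta> * a) * (real n * \<beta> n / (real n * \<beta> n - \<theta>)) ^ k n)"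
      using elim(2) T d(1) \<theta>(1) by (intro rand_iter_le_opt_value f C n b) (auto simp: a_def l_def)
    also have "\<dots> \<le> opt_value M X ?r f a x + 2 * C * (exp (- \<theta> * a) * exp (real (k n) / l n * (\<theta> + 2 * \<theta> * (\<theta> / l n))))"
      unfolding l_def[symmetric] using elim(2) \<theta>(1) C(1) by (intro add_left_mono mult_left_mono geometric_power_le_exp) auto
    also have "\<dots> = opt_value M X ?r f a x + 2 * C * exp (q n)" by (simp add: q_def exp_add[symmetric])
    also have "\<dots> \<le> opt_value M X r f T x + \<epsilon>" using opt elim(1) by linarith
    finally show ?case by (simp add: \<beta>_def)
  qed
qed

end

section \<open>Lower limit of the recursion\<close>

lemma (in levy_poisson) expectation_at_jump:
  assumes "bounded_continuous g"
  shows "expectation (\<lambda>\<omega>. g (x + X (P.T j \<omega>) \<omega>)) = (expo lam ^^ j) g x"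
  using assms
proof (induction j arbitrary: g)
  case 0
  then show ?case unfolding P.T_0 using expectation_start bounded_continuous_measurable by simp
next
  case (Suc j)
  have "\<forall>q\<ge>0. space M \<inter> {\<omega>\<in>space M. P.T j \<omega> < q} \<in> sets (history (ennreal q))"
    using T_less_history[of j] by (simp add: Int_absorb1 subset_iff)
  from strong_markov[OF this sets.top Suc.prems, of x]
  have "expectation (\<lambda>\<omega>. g (x + X (P.T (Suc j) \<omega>) \<omega>)) = expectation (\<lambda>\<omega>. expo lam g (x + X (P.T j \<omega>) \<omega>))"
    by (simp cong: Bochner_Integration.integral_cong)
  also have "\<dots> = (expo lam ^^ j) (expo lam g) x" by (intro Suc.IH bounded_continuous_expo P.rate_pos Suc.prems)
  finally show ?case by (simp add: funpow_swap1)
qed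

context complete_levy_process
begin

text \<open>
  Lower limits along arbitrary sequences \<open>y \<longlonglongrightarrow> x\<close>, truncated at \<open>0\<close>: this form survives the
  induction, as dominated convergence then applies at the random points \<open>y n + X\<^sub>T\<close>.
\<close>

lemma rand_iter_lower_limit:
  assumes LP: "\<And>n. 1 \<le> n \<Longrightarrow> levy_poisson M X (real n) (N n)"
    and f: "bounded_continuous f" and r: "0 \<le> r" and h: "0 \<le> h" and j: "(\<lambda>n. real (j n) / real (Suc n)) \<longlonglongrightarrow> h"
    and y: "y \<longlonglongrightarrow> x"
  shows "(\<lambda>n. min (rand_iter (real (Suc n)) (exp (- r / real (Suc n))) f (i * j n) (y n) - bermudan (exp (- r * h)) h f i x) 0) \<longlonglongrightarrow> 0"
  using y
proof (induction i arbitrary: x y)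
  case 0
  have "(\<lambda>n. min (f (y n) - f x) 0) \<longlonglongrightarrow> min (f x - f x) 0"
    by (intro tendsto_min tendsto_diff tendsto_const bounded_continuous_tendsto[OF f] 0)
  then show ?case by simp
next
  case (Suc i)
  obtain C where C: "\<And>y. \<bar>f y\<bar> \<le> C" using f bounded_continuousE by blast
  define \<beta> where "\<beta> n = exp (- r / real (Suc n))" for n
  define W where "W n = rand_iter (real (Suc n)) (\<beta> n) f" for n
  define B where "B = bermudan (exp (- r * h)) h f"
  define T where "T n = complete_poisson_process.T (N (Suc n)) (j n)" for n
  have \<beta>: "0 \<le> \<beta> n" "\<beta> n \<le> 1" for n using r by (auto simp: \<beta>_def)
  have W: "bounded_continuous (W n k)" "\<bar>W n k z\<bar> \<le> C" for n k z
    unfolding W_def using \<beta> C by (auto intro!: bounded_continuous_rand_iter f rand_iter_abs_le simp del: of_nat_Suc)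
  have B: "bounded_continuous (B k)" "\<bar>B k z\<bar> \<le> C" for k z
    unfolding B_def using r h C by (auto intro!: bounded_continuous_bermudan f bermudan_abs_le)
  note [measurable] = bounded_continuous_measurable[OF W(1)] bounded_continuous_measurable[OF B(1)]
  have [measurable]: "X h \<in> borel_measurable M" by (rule measurable_X) fact
  have XT[measurable]: "(\<lambda>\<omega>. X (T n \<omega>) \<omega>) \<in> borel_measurable M" for n
    unfolding T_def by (rule levy_poisson.measurable_X_T[OF LP]) simp
  have T0: "0 \<le> T n \<omega>" for n \<omega>
  proof -
    interpret L: levy_poisson M X "real (Suc n)" "N (Suc n)" by (rule LP) simp
    show ?thesis unfolding T_def by (rule L.P.T_nonneg)
  qed
  have Tlim: "AE \<omega> in M. (\<lambda>n. T n \<omega>) \<longlonglongrightarrow> h"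
  proof -
    \<comment> \<open>\<open>j\<close> is indexed from the clock of rate 1; the shift adapts it to
      the index of the clocks.\<close>
    have "AE \<omega> in M. (\<lambda>n. complete_poisson_process.T (N n) (j (n - 1)) \<omega>) \<longlonglongrightarrow> h"
    proof (rule jump_time_LLN)
      show "complete_poisson_process M (real n) (N n)" if "1 \<le> n" for n
        using LP[OF that] by (simp add: levy_poisson_def)
      show "(\<lambda>n. real (j (n - 1)) / real n) \<longlonglongrightarrow> h" by (rule LIMSEQ_imp_Suc) (use j in simp)
    qed fact
    then show ?thesis unfolding T_def by eventually_elim (drule LIMSEQ_Suc, simp)
  qed
  let ?D = "\<lambda>n \<omega>. min (W n (i * j n) (y n + X (T n \<omega>) \<omega>) - B i (x + X h \<omega>)) 0"
  define e where "e n = expectation (?D n)" for n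
  have e: "e \<longlonglongrightarrow> 0"
  proof -
    have "(\<lambda>n. expectation (?D n)) \<longlonglongrightarrow> expectation (\<lambda>_. 0)"
    proof (rule bounded_convergence_complete[where C="C + C"])
      show "AE \<omega> in M. (\<lambda>n. ?D n \<omega>) \<longlonglongrightarrow> 0"
        using Tlim no_fixed_jump[OF h]
      proof eventually_elim
        case (elim \<omega>)
        have "(\<lambda>n. X (T n \<omega>) \<omega>) \<longlonglongrightarrow> X h \<omega>"
          by (rule continuous_within_tendsto_compose'[OF elim(2) _ elim(1)]) (use T0 in auto)
        then have "(\<lambda>n. y n + X (T n \<omega>) \<omega>) \<longlonglongrightarrow> x + X h \<omega>" by (intro tendsto_add Suc.prems)
        from Suc.IH[OF this] show ?case by (simp add: W_def B_def \<beta>_def)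
      qed
      show "\<bar>?D n \<omega>\<bar> \<le> C + C" for n \<omega>
        using W(2)[of n "i * j n" "y n + X (T n \<omega>) \<omega>"] B(2)[of i "x + X h \<omega>"] by (auto simp: min_def abs_if split: if_splits)
    qed measurable
    then show ?thesis by (simp add: e_def[abs_def])
  qed
  define p where "p = transition h (B i) x"
  \<comment> \<open>Compared with \<open>B i\<close>, the value after waiting \<open>j n\<close>
    jumps falls short in mean by no more than the truncated error \<open>e n\<close>, which tends to
    0. Immediate exercise gives the other entry of the maximum.\<close>
  have Wge: "max (f (y n)) (\<beta> n ^ j n * (p + e n)) \<le> W n (Suc i * j n) (y n)" for n
  proof -
    interpret L: levy_poisson M X "real (Suc n)" "N (Suc n)" by (rule LP) simp
    have "p + e n = expectation (\<lambda>\<omega>. B i (x + X h \<omega>)) + expectation (?D n)" using h by (simp add: p_def e_def transition_def)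
    also have "\<dots> = expectation (\<lambda>\<omega>. B i (x + X h \<omega>) + ?D n \<omega>)"
    proof (rule Bochner_Integration.integral_add[symmetric])
      show "integrable M (\<lambda>\<omega>. B i (x + X h \<omega>))" by (rule integrable_bounded[where C=C]) (auto simp: B)
      show "integrable M (?D n)"
      proof (rule integrable_bounded[where C="C + C"])
        show "\<bar>?D n \<omega>\<bar> \<le> C + C" for \<omega>
          using W(2)[of n "i * j n" "y n + X (T n \<omega>) \<omega>"] B(2)[of i "x + X h \<omega>"] by (auto simp: min_def abs_if split: if_splits)
      qed measurable
    qed
    also have "\<dots> \<le> expectation (\<lambda>\<omega>. W n (i * j n) (y n + X (T n \<omega>) \<omega>))"
    proof (rule integral_mono)
      show "integrable M (\<lambda>\<omega>. B i (x + X h \<omega>) + ?D n \<omega>)"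
      proof (rule integrable_bounded[where C="C + (C + C)"])
        show "\<bar>B i (x + X h \<omega>) + ?D n \<omega>\<bar> \<le> C + (C + C)" for \<omega>
          using W(2)[of n "i * j n" "y n + X (T n \<omega>) \<omega>"] B(2)[of i "x + X h \<omega>"] by (auto simp: min_def abs_if split: if_splits)
      qed measurable
      show "integrable M (\<lambda>\<omega>. W n (i * j n) (y n + X (T n \<omega>) \<omega>))" by (rule integrable_bounded[where C=C]) (auto simp: W)
    qed auto
    also have "\<dots> = (expo (real (Suc n)) ^^ j n) (W n (i * j n)) (y n)"
      unfolding T_def by (rule L.expectation_at_jump[OF W(1)])
    finally have "\<beta> n ^ j n * (p + e n) \<le> \<beta> n ^ j n * (expo (real (Suc n)) ^^ j n) (W n (i * j n)) (y n)"
      using \<beta> by (intro mult_left_mono) auto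
    also have "\<dots> \<le> W n (j n + i * j n) (y n)"
      unfolding W_def by (rule rand_iter_ge_power) (use f \<beta> in auto)
    finally show ?thesis using le_rand_iter[of f "y n" "real (Suc n)" "\<beta> n" "Suc i * j n"] by (simp add: W_def)
  qed
  have "(\<lambda>n. exp (- r * (real (j n) / real (Suc n)))) \<longlonglongrightarrow> exp (- r * h)" by (intro tendsto_exp tendsto_mult tendsto_const j)
  moreover have "exp (- r * (real (j n) / real (Suc n))) = \<beta> n ^ j n" for n
    by (simp add: \<beta>_def exp_of_nat_mult[symmetric] mult.commute)
  ultimately have \<beta>lim: "(\<lambda>n. \<beta> n ^ j n) \<longlonglongrightarrow> exp (- r * h)" by simp
  have "(\<lambda>n. min (max (f (y n)) (\<beta> n ^ j n * (p + e n)) - B (Suc i) x) 0) \<longlonglongrightarrow> min (max (f x) (exp (- r * h) * (p + 0)) - B (Suc i) x) 0"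
    by (intro tendsto_min tendsto_max tendsto_diff tendsto_mult tendsto_add tendsto_const \<beta>lim e bounded_continuous_tendsto[OF f] Suc.prems)
  then have low: "(\<lambda>n. min (max (f (y n)) (\<beta> n ^ j n * (p + e n)) - B (Suc i) x) 0) \<longlonglongrightarrow> 0"
    by (simp add: B_def p_def)
  have "(\<lambda>n. min (W n (Suc i * j n) (y n) - B (Suc i) x) 0) \<longlonglongrightarrow> 0"
  proof (rule real_tendsto_sandwich[OF _ _ low tendsto_const])
    show "\<forall>\<^sub>F n in sequentially. min (max (f (y n)) (\<beta> n ^ j n * (p + e n)) - B (Suc i) x) 0 \<le> min (W n (Suc i * j n) (y n) - B (Suc i) x) 0"
      using Wge by (intro always_eventually allI min.mono diff_right_mono) auto
  qed auto
  then show ?case by (simp only: W_def B_def \<beta>_def)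
qed

text \<open>\<open>k n\<close> jumps contain \<open>Suc m\<close> blocks of
  \<open>k n div Suc m\<close> jumps, each lasting about \<open>T / real (Suc m)\<close>, so the
  comparison with the Bermudan recursion applies; the jumps left over can only raise the
  value.\<close>

lemma eventually_rand_iter_ge:
  assumes LP: "\<And>n. 1 \<le> n \<Longrightarrow> levy_poisson M X (real n) (N n)"
    and f: "bounded_continuous f" and r: "0 \<le> r" and T: "0 \<le> T" and k: "(\<lambda>n. real (k n) / real n) \<longlonglongrightarrow> T" and \<epsilon>: "0 < \<epsilon>"
  shows "eventually (\<lambda>n. opt_value M X r f T x - \<epsilon> \<le> rand_iter (real n) (exp (- r / real n)) f (k n) x) sequentially"
proof (cases "T = 0")
  case True
  have "opt_value M X r f T x = f x"
    unfolding opt_value_eq True stopped_payoff_0(2)[OF f] using stopping_times_nonempty by simp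
  then show ?thesis using le_rand_iter[of f x] \<epsilon> by (auto intro!: always_eventually intro: order_trans[of _ "f x"])
next
  case False
  with T have T: "0 < T" by simp
  obtain C where C: "\<And>y. \<bar>f y\<bar> \<le> C" using f bounded_continuousE by blast
  have "expectation (stopped_payoff r f T x \<tau>) \<le> C" for \<tau>
    using expectation_stopped_payoff_abs_le[of f C r T x \<tau>, OF C r] by linarith
  then have "bdd_above ((\<lambda>\<tau>. expectation (stopped_payoff r f T x \<tau>)) ` stopping_times M X)" by (intro bdd_aboveI2)
  \<comment> \<open>The error splits into \<open>\<epsilon> / 2\<close> for a near-optimal stopping
    time, \<open>\<epsilon> / 4\<close> for the Bermudan grid and \<open>\<epsilon> / 4\<close> for
    the limit in \<open>n\<close>.\<close>
  from less_cSUP_iff[OF stopping_times_nonempty this, of "opt_value M X r f T x - \<epsilon> / 2"]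
  obtain \<tau> where \<tau>: "\<tau> \<in> stopping_times M X" "opt_value M X r f T x - \<epsilon> / 2 < expectation (stopped_payoff r f T x \<tau>)"
    using \<epsilon> by (auto simp: opt_value_eq)
  obtain m where m: "expectation (stopped_payoff r f T x \<tau>) - \<epsilon> / 4 < bermudan (exp (- r * (T / real (Suc m)))) (T / real (Suc m)) f (Suc m) x"
    using stopped_payoff_approx(2)[OF f r T \<tau>(1), of "\<epsilon> / 4" x] \<epsilon> by auto
  define h where "h = T / real (Suc m)"
  define j where "j n = k (Suc n) div Suc m" for n
  have h: "0 \<le> h" using T by (simp add: h_def)
  have k': "(\<lambda>n. real (k (Suc n)) / real (Suc n)) \<longlonglongrightarrow> T" using k by (rule LIMSEQ_Suc)
  have "(\<lambda>n. real (j n) / real (Suc n)) \<longlonglongrightarrow> h"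
  proof (rule real_tendsto_sandwich)
    have b: "real (k (Suc n)) / real (Suc m) - 1 \<le> real (j n)" "real (j n) \<le> real (k (Suc n)) / real (Suc m)" for n
    proof -
      have "real (j n) = real_of_int \<lfloor>real (k (Suc n)) / real (Suc m)\<rfloor>"
        unfolding j_def by (metis floor_divide_of_nat_eq of_int_of_nat_eq)
      then show "real (k (Suc n)) / real (Suc m) - 1 \<le> real (j n)" "real (j n) \<le> real (k (Suc n)) / real (Suc m)" by linarith+
    qed
    show "\<forall>\<^sub>F n in sequentially. (real (k (Suc n)) / real (Suc m) - 1) / real (Suc n) \<le> real (j n) / real (Suc n)"
      "\<forall>\<^sub>F n in sequentially. real (j n) / real (Suc n) \<le> (real (k (Suc n)) / real (Suc m)) / real (Suc n)"
      by (intro always_eventually allI divide_right_mono b; simp)+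
    have e: "real (k (Suc n)) / real (Suc m) / real (Suc n) = real (k (Suc n)) / real (Suc n) / real (Suc m)" for n
      by (simp add: mult.commute)
    show lim: "(\<lambda>n. (real (k (Suc n)) / real (Suc m)) / real (Suc n)) \<longlonglongrightarrow> h"
      unfolding h_def e by (intro tendsto_divide k' tendsto_const) simp
    have "(\<lambda>n. real (k (Suc n)) / real (Suc m) / real (Suc n) - 1 / real (Suc n)) \<longlonglongrightarrow> h - 0"
      by (intro tendsto_diff lim lim_1_over_n[THEN LIMSEQ_Suc])
    then show "(\<lambda>n. (real (k (Suc n)) / real (Suc m) - 1) / real (Suc n)) \<longlonglongrightarrow> h"
      by (simp only: diff_divide_distrib diff_zero)
  qed
  from rand_iter_lower_limit[OF LP f r h this tendsto_const[of x], of "Suc m"]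
  have "eventually (\<lambda>n. - (\<epsilon> / 4) < min (rand_iter (real (Suc n)) (exp (- r / real (Suc n))) f (Suc m * j n) x - bermudan (exp (- r * h)) h f (Suc m) x) 0) sequentially"
    using \<epsilon> by (intro order_tendstoD(1)) auto
  then have "eventually (\<lambda>n. opt_value M X r f T x - \<epsilon> \<le> rand_iter (real (Suc n)) (exp (- r / real (Suc n))) f (k (Suc n)) x) sequentially"
  proof eventually_elim
    case (elim n)
    have "Suc m * j n \<le> k (Suc n)" unfolding j_def by (rule times_div_less_eq_dividend)
    then have "rand_iter (real (Suc n)) (exp (- r / real (Suc n))) f (Suc m * j n) x \<le> rand_iter (real (Suc n)) (exp (- r / real (Suc n))) f (k (Suc n)) x"
      by (intro rand_iter_mono f) auto
    then show ?case using elim m \<tau>(2) unfolding h_def[symmetric] by linarith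
  qed
  then show ?thesis by (simp only: eventually_sequentially_Suc[of "\<lambda>n. opt_value M X r f T x - \<epsilon> \<le> rand_iter (real n) (exp (- r / real n)) f (k n) x"])
qed

end

section \<open>Passing to the completed space\<close>

lemma (in prob_space) prob_space_completion: "prob_space (completion M)"
  by (rule prob_spaceI) (simp add: emeasure_space_1)

lemma (in prob_space) indep_sets_completion:
  assumes "indep_sets F I"
  shows "prob_space.indep_sets (completion M) F I"
proof -
  interpret C: prob_space "completion M" by (rule prob_space_completion)
  have ev: "F i \<subseteq> events" if "i \<in> I" for i using assms that by (auto simp: indep_sets_def)
  show ?thesis
  proof (rule C.indep_setsI)
    show "F i \<subseteq> C.events" if "i \<in> I" for i using ev[OF that] by auto
    fix A J assume *: "J \<noteq> {}" "J \<subseteq> I" "finite J" "\<forall>j\<in>J. A j \<in> F j"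
    then have A: "A j \<in> events" if "j \<in> J" for j using that ev by auto
    have "(\<Inter>j\<in>J. A j) \<in> events" using * A by (intro sets.finite_INT) auto
    then have "C.prob (\<Inter>j\<in>J. A j) = prob (\<Inter>j\<in>J. A j)" by (rule measure_completion)
    also have "\<dots> = (\<Prod>j\<in>J. prob (A j))" using * by (intro indep_setsD[OF assms]) auto
    also have "\<dots> = (\<Prod>j\<in>J. C.prob (A j))" using A by (intro prod.cong refl) simp
    finally show "C.prob (\<Inter>j\<in>J. A j) = (\<Prod>j\<in>J. C.prob (A j))" .
  qed
qed

lemma (in prob_space) indep_set_completion: "indep_set A B \<Longrightarrow> prob_space.indep_set (completion M) A B"
  using indep_sets_completion[of "case_bool A B" UNIV] prob_space.indep_set_def[OF prob_space_completion]
  by (simp add: indep_set_def)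

lemma (in prob_space) indep_vars_completion:
  assumes "indep_vars S Y I"
  shows "prob_space.indep_vars (completion M) S Y I"
proof -
  interpret C: prob_space "completion M" by (rule prob_space_completion)
  show ?thesis
    using assms indep_sets_completion unfolding indep_vars_def2 C.indep_vars_def2
    by (auto intro: measurable_completion)
qed

lemma levy_process_completion:
  assumes "levy_process M X"
  shows "complete_levy_process (completion M) X"
proof -
  interpret levy_process M X by fact
  interpret C: prob_space "completion M" by (rule prob_space_completion)
  interpret C: complete_prob_space "completion M" by unfold_locales (rule completion_idem)
  have "levy_process (completion M) X"
  proof unfold_locales
    show "X t \<in> borel_measurable (completion M)" if "0 \<le> t" for t using measurable_X[OF that] by (rule measurable_completion)
    show "AE \<omega> in completion M. X 0 \<omega> = 0" using start by (rule AE_completion)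
    show "C.indep_vars (\<lambda>_. borel) (\<lambda>i \<omega>. X (u (Suc i)) \<omega> - X (u i) \<omega>) {..<m}" if "0 \<le> u 0" "mono u" for u and m :: nat
      using independent_increments[OF that] by (rule indep_vars_completion)
    show "distr (completion M) borel (\<lambda>\<omega>. X t \<omega> - X s \<omega>) = distr (completion M) borel (X (t - s))" if "0 \<le> s" "s \<le> t" for s t
      using stationary_increments[OF that] that by (simp add: distr_completion borel_measurable_diff measurable_X)
    show "cadlag (\<lambda>t. X t \<omega>)" if "\<omega> \<in> space (completion M)" for \<omega> using cadlag_paths that by simp
  qed
  then show ?thesis using C.complete_prob_space_axioms by (simp add: complete_levy_process_def)
qed

lemma process_events_completion: "process_events (completion M) S Y = process_events M S Y"
  by (simp add: process_events_def)

lemma levy_poisson_completion: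
  assumes "levy_process M X" "poisson_process M lam N"
    and "prob_space.indep_set M (process_events M borel X) (process_events M (count_space UNIV) N)"
  shows "levy_poisson (completion M) X lam N"
proof -
  interpret X: levy_process M X by fact
  interpret N: poisson_process M lam N by fact
  interpret CX: complete_levy_process "completion M" X by (rule levy_process_completion) fact
  interpret CN: complete_levy_process "completion M" "\<lambda>t \<omega>. real (N t \<omega>)"
    by (rule levy_process_completion) (rule N.levy_process_axioms)
  have "poisson_process (completion M) lam N"
  proof unfold_locales
    show "0 < lam" by (rule N.rate_pos)
    show "distr (completion M) (count_space UNIV) (N t) = measure_pmf (poisson_pmf (lam * t))" if "0 < t" for t
    proof -
      have [measurable]: "(\<lambda>\<omega>. real (N t \<omega>)) \<in> borel_measurable M" by (rule N.measurable_X) (use that in simp)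
      have "(\<lambda>\<omega>. nat \<lfloor>real (N t \<omega>)\<rfloor>) \<in> measurable M (count_space UNIV)" by measurable
      then show ?thesis using N.poisson_marginals[OF that] by (simp add: distr_completion)
    qed
  qed
  then have "complete_poisson_process (completion M) lam N"
    using CX.complete_prob_space_axioms by (simp add: complete_poisson_process_def)
  then show ?thesis
    using CX.complete_levy_process_axioms X.indep_set_completion[OF assms(3)]
    by (simp add: levy_poisson_def levy_poisson_axioms_def process_events_completion)
qed

text \<open>The definition already takes its null sets from \<open>completion M\<close>, so
  completing once more changes nothing; the same holds for the integrals in the two values.\<close>

lemma nat_filtration_completion: "nat_filtration (completion M) S Y = nat_filtration M S Y"
  by (simp add: nat_filtration_def completed_history_def completion_idem fun_eq_iff)

lemma opt_value_completion: "opt_value (completion M) X r f T x = opt_value M X r f T x"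
  by (simp add: opt_value_def stopping_times_def nat_filtration_completion completion_idem)

lemma rand_value_completion: "rand_value (completion M) X N r f n k x = rand_value M X N r f n k x"
  by (simp add: rand_value_def jump_stopping_times_def nat_filtration_completion completion_idem)

theorem theorem3p1:
  fixes M :: "'a measure"
    and X :: "real \<Rightarrow> 'a \<Rightarrow> real"
    and N :: "nat \<Rightarrow> real \<Rightarrow> 'a \<Rightarrow> nat"
    and r :: real
    and f :: "real \<Rightarrow> real"
  assumes "levy_process M X"
    and "\<And>n. n \<ge> 1 \<Longrightarrow> poisson_process M (real n) (N n)"
    and "\<And>n. n \<ge> 1 \<Longrightarrow>
           prob_space.indep_set M (process_events M borel X)
             (process_events M (count_space UNIV) (N n))"
    and "r \<ge> 0"
    and "bounded (range f)"
    and "continuous_on UNIV f"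
  defines "v \<equiv> opt_value M X r f"
    and "V \<equiv> \<lambda>n. rand_value M X (N n) r f n"
  shows "(\<forall>n\<ge>1.
            (\<forall>x. V n 0 x = f x) \<and>
            (\<forall>\<xi>. distributed M lborel \<xi> (exponential_density (real n)) \<longrightarrow>
                 prob_space.indep_set M (process_events M borel X)
                   (sets (vimage_algebra (space M) \<xi> borel)) \<longrightarrow>
                 (\<forall>k\<ge>1. \<forall>x. V n k x =
                    max (f x)
                      (exp (- r / real n) *
                       (\<integral>\<omega>. V n (k - 1) (x + X (\<xi> \<omega>) \<omega>) \<partial>completion M))))) \<and>
         (\<forall>T\<ge>0. \<forall>k :: nat \<Rightarrow> nat. (\<lambda>n. real (k n) / real n) \<longlonglongrightarrow> T \<longrightarrow>
            (AE \<omega> in M. (\<lambda>n. jump_time (N n) (k n) \<omega>) \<longlonglongrightarrow> ennreal T) \<and>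
            (\<forall>x. (\<lambda>n. V n (k n) x) \<longlonglongrightarrow> v T x))"
proof -
  interpret X: levy_process M X by fact
  interpret C: complete_levy_process "completion M" X by (rule levy_process_completion) fact
  have LP: "levy_poisson (completion M) X (real n) (N n)" if "1 \<le> n" for n
    using that assms(1-3) by (intro levy_poisson_completion) auto
  have f: "bounded_continuous f" using assms(5,6) by (simp add: bounded_continuous_def)
  have V: "V n k x = C.rand_iter (real n) (exp (- r / real n)) f k x" if "1 \<le> n" for n k x
    using levy_poisson.rand_value_eq[OF LP[OF that] f] by (simp add: V_def rand_value_completion)
  have v: "v T x = opt_value (completion M) X r f T x" for T x by (simp add: v_def opt_value_completion)
  show ?thesis
  proof (intro conjI allI impI)
    fix n :: nat and x assume "1 \<le> n"
    then show "V n 0 x = f x" by (simp add: V)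
  next
    fix n :: nat and \<xi> and k :: nat and x
    assume n: "1 \<le> n" and D: "distributed M lborel \<xi> (exponential_density (real n))"
      and ind: "prob_space.indep_set M (process_events M borel X) (sets (vimage_algebra (space M) \<xi> borel))" and k: "1 \<le> k"
    obtain j where j: "k = Suc j" using k by (cases k) auto
    have D': "distributed (completion M) lborel \<xi> (exponential_density (real n))"
      using D by (auto simp: distributed_def distr_completion measurable_completion)
    \<comment> \<open>Every independent exponential \<open>\<xi>\<close> yields the same operator
      \<open>expo\<close>, so the recursion stated with \<open>\<xi>\<close> is the defining
      equation of \<open>rand_iter\<close>.\<close>
    have "C.indep_set (process_events (completion M) borel X) (sets (vimage_algebra (space (completion M)) \<xi> borel))"
      using X.indep_set_completion[OF ind] by (simp add: process_events_completion)
    moreover have "0 < real n" using n by simp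
    ultimately have "C.expectation (\<lambda>\<omega>. V n j (x + X (\<xi> \<omega>) \<omega>)) = C.expo (real n) (C.rand_iter (real n) (exp (- r / real n)) f j) x"
      unfolding V[OF n] using D' by (intro C.expectation_at_exponential_time C.bounded_continuous_rand_iter f) auto
    then show "V n k x = max (f x) (exp (- r / real n) * (\<integral>\<omega>. V n (k - 1) (x + X (\<xi> \<omega>) \<omega>) \<partial>completion M))"
      unfolding V[OF n, of k] by (simp add: j)
  next
    fix T :: real and k :: "nat \<Rightarrow> nat" assume T: "0 \<le> T" and k: "(\<lambda>n. real (k n) / real n) \<longlonglongrightarrow> T"
    have CP: "complete_poisson_process (completion M) (real n) (N n)" if "1 \<le> n" for n
      using LP[OF that] by (simp add: levy_poisson_def)
    \<comment> \<open>Shifted by one because \<open>N 0\<close> is unconstrained; the limit does not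
      see the first term.\<close>
    have "AE \<omega> in completion M. \<forall>n. complete_poisson_process.regular (completion M) (N (Suc n)) \<omega>"
      using complete_poisson_process.AE_regular[OF CP[of "Suc n" for n]] by (simp add: AE_all_countable)
    moreover have "AE \<omega> in completion M. (\<lambda>n. complete_poisson_process.T (N n) (k n) \<omega>) \<longlonglongrightarrow> T"
      by (rule jump_time_LLN[OF CP k T])
    ultimately have "AE \<omega> in completion M. (\<lambda>n. jump_time (N n) (k n) \<omega>) \<longlonglongrightarrow> ennreal T"
    proof eventually_elim
      case (elim \<omega>)
      have "(\<lambda>n. ennreal (complete_poisson_process.T (N (Suc n)) (k (Suc n)) \<omega>)) \<longlonglongrightarrow> ennreal T"
        using LIMSEQ_Suc[OF elim(2)] by (rule tendsto_ennrealI)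
      then have "(\<lambda>n. jump_time (N (Suc n)) (k (Suc n)) \<omega>) \<longlonglongrightarrow> ennreal T"
        using complete_poisson_process.regularD(2)[OF CP elim(1)[rule_format]] by simp
      then show ?case by (rule LIMSEQ_imp_Suc)
    qed
    then show "AE \<omega> in M. (\<lambda>n. jump_time (N n) (k n) \<omega>) \<longlonglongrightarrow> ennreal T" by (simp add: AE_completion_iff)
    fix x
    show "(\<lambda>n. V n (k n) x) \<longlonglongrightarrow> v T x"
    proof (rule tendstoI)
      fix e :: real assume "0 < e"
      then have e: "0 < e / 2" by simp
      have "\<forall>\<^sub>F n in sequentially. opt_value (completion M) X r f T x - e / 2 \<le> C.rand_iter (real n) (exp (- r / real n)) f (k n) x"
        by (rule C.eventually_rand_iter_ge[OF LP f assms(4) T k e])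
      with C.eventually_rand_iter_le[OF f assms(4) T k e, of x] eventually_ge_at_top[of 1]
      show "\<forall>\<^sub>F n in sequentially. dist (V n (k n) x) (v T x) < e"
      proof eventually_elim
        case (elim n)
        then show ?case using \<open>0 < e\<close> unfolding V[OF elim(2)] v dist_real_def by (simp add: abs_less_iff field_simps)
      qed
    qed
  qed
qed

end
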